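(* For every positive integer $n$, \[ W_{(1,22)}(n)=\tfrac{17}{1464}\sigma_3(n)-\tfrac1{122}\sigma_3(\tfrac n2)+\tfrac{35}{488}\sigma_3(\tfrac n{11})+\tfrac{125}{366}\sigma_3(\tfrac n{22})+(\tfrac1{24}-\tfrac n{88})\sigma(n)+(\tfrac1{24}-\tfrac n4)\sigma(\tfrac n{22})-\tfrac{21}{2684}b_1(n)-\tfrac{159}{5368}b_2(n)-\tfrac{69}{5368}b_3(n)-\tfrac{32}{671}b_4(n)+\tfrac2{61}b_5(n)-\tfrac78b_6(n)-\tfrac3{88}b_7(n). \]
   Context: $\sigma_k(n)=\sum_{d\mid n}d^k$ for $n\in\mathbb{N}$, $\sigma_k(x)=0$ for $x\notin\mathbb{N}$, $\sigma=\sigma_1$. $W_{(\alpha,\beta)}(n)=\sum_{(l,m)\in\mathbb{N}_0^2,\ \alpha l+\beta m=n}\sigma(l)\sigma(m)$. With $q=e^{2\pi iz}$ and $\eta(z)=q^{1/24}\prod_{n\ge1}(1-q^n)$, the integers $b_i(n)$ are defined by $B_i=\sum_{n\ge1}b_i(n)q^n$ where $B_1=\frac{\eta^6(z)\eta^6(11z)}{\eta^2(2z)\eta^2(22z)}$, $B_2=\eta^4(z)\eta^4(11z)$, $B_3=\eta^2(z)\eta^2(2z)\eta^2(11z)\eta^2(22z)$, $B_4=\eta^4(2z)\eta^4(22z)$, $B_5=\frac{\eta^6(2z)\eta^6(22z)}{\eta^2(z)\eta^2(11z)}$, $B_6=\frac{\eta(2z)\eta^3(11z)\eta^5(22z)}{\eta(z)}$,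 $B_7=\frac{\eta^9(2z)\eta^7(11z)}{\eta^5(z)\eta^3(22z)}$. *)

theory Defs
  imports Complex_Main "HOL-Computational_Algebra.Formal_Power_Series"
begin

definition sigmak :: "nat \<Rightarrow> nat \<Rightarrow> nat" where
  "sigmak k n = (if n = 0 then 0 else (\<Sum>d | d dvd n. d ^ k))"

definition sigmak_frac :: "nat \<Rightarrow> nat \<Rightarrow> nat \<Rightarrow> nat" where
  "sigmak_frac k n d = (if d dvd n then sigmak k (n div d) else 0)"

definition W :: "nat \<Rightarrow> nat \<Rightarrow> nat \<Rightarrow> nat" where
  "W a b n = (\<Sum>(l, m) \<in> {(l, m). a * l + b * m = n}. sigmak 1 l * sigmak 1 m)"

(* the formal power series prod_{k>=1} (1 - q^(d k)); its n-th coefficient is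
   determined by the finite product over k = 1..n *)
definition eta_prod :: "nat \<Rightarrow> real fps" where
  "eta_prod d = Abs_fps (\<lambda>n. fps_nth (\<Prod>k\<in>{1..n}. (1 - fps_X ^ (d * k))) n)"

definition eta_pow :: "nat \<Rightarrow> int \<Rightarrow> real fps" where
  "eta_pow d r = (if r \<ge> 0 then eta_prod d ^ nat r else inverse (eta_prod d ^ nat (- r)))"

(* eta quotients: the q-power prefactor q^{(sum r_delta * delta)/24} is written explicitly *)
definition B1 :: "real fps" where
  "B1 = fps_X ^ 1 * eta_pow 1 6 * eta_pow 11 6 * eta_pow 2 (-2) * eta_pow 22 (-2)"
definition B2 :: "real fps" where
  "B2 = fps_X ^ 2 * eta_pow 1 4 * eta_pow 11 4"
definition B3 :: "real fps" where
  "B3 = fps_X ^ 3 * eta_pow 1 2 * eta_pow 2 2 * eta_pow 11 2 * eta_pow 22 2"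
definition B4 :: "real fps" where
  "B4 = fps_X ^ 4 * eta_pow 2 4 * eta_pow 22 4"
definition B5 :: "real fps" where
  "B5 = fps_X ^ 5 * eta_pow 2 6 * eta_pow 22 6 * eta_pow 1 (-2) * eta_pow 11 (-2)"
definition B6 :: "real fps" where
  "B6 = fps_X ^ 6 * eta_pow 2 1 * eta_pow 11 3 * eta_pow 22 5 * eta_pow 1 (-1)"
definition B7 :: "real fps" where
  "B7 = fps_X ^ 1 * eta_pow 2 9 * eta_pow 11 7 * eta_pow 1 (-5) * eta_pow 22 (-3)"

end

theory Submission
  imports Defs "HOL-Complex_Analysis.Complex_Analysis" "HOL-Number_Theory.Cong"
begin

text \<open>
  With \<open>L(q) = 1 - 24 \<Sum> \<sigma>(n) q^n\<close>, the sum \<open>W_(1,22)(n)\<close> is the only unknown part of the \<open>n\<close>-th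
  coefficient of \<open>(L(q) - 22 L(q^22))^2\<close>: the squares are evaluated by the classical formula for
  \<open>\<Sum> \<sigma>(k) \<sigma>(n - k)\<close>. This function is a modular form of weight four for \<open>\<Gamma>_0(22)\<close>, because \<open>L\<close> is
  quasimodular, and so are the weight four Eisenstein series at \<open>q, q^2, q^11, q^22\<close> and
  \<open>B_1, \<dots>, B_5\<close>. Let \<open>F\<close> be the corresponding combination and \<open>h\<close> that of \<open>B_6\<close> and \<open>B_7\<close>; these two
  contain odd powers of eta, so that only \<open>h^2\<close> is treated as a modular form. The form \<open>F^2 - h^2\<close> of weight
  eight vanishes to order \<open>25\<close> at infinity by a computation of coefficients. The product of its conjugates over
  the \<open>36\<close> cosets of \<open>\<Gamma>_0(22)\<close> then vanishes to a higher order than its weight allows at level one, so it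
  is zero, and \<open>F = h\<close> because \<open>F = - h\<close> contradicts the first coefficient.
\<close>

section \<open>The convolution of the divisor sum with itself\<close>

text \<open>The multiplier of eta itself is a 24th root of unity given by Dedekind sums. Here only
  \<open>eta z ^ 2\<close> is transformed: its multiplier is a twelfth root of unity whose exponent
  is a polynomial in the matrix entries, so every character condition becomes a finite check modulo
  3 and modulo 4. This restriction is what forces the passage to squares: the exponents in
  \<open>B6\<close> and \<open>B7\<close> are odd, but those in \<open>B6^2\<close>,
  \<open>B6 B7\<close> and \<open>B7^2\<close> are even. Squaring is cheap, because
  \<open>F^2 - h^2 = (F - h)(F + h)\<close> vanishes at least to the order of \<open>F - h\<close>,
  which is the only quantity computed. The order 25 is the first one above 3 * 8: the discriminant
  has weight 12 and a simple zero at infinity, so with 36 cosets a form of weight k that vanishes to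
  an order above 36 k / 12 = 3 k is zero. The convolution formula for sigma serves twice. It
  evaluates the two squares, and it is also the coefficient form of Ramanujan's differential
  equation for \<open>L\<close>, through which the transformation law in weight four follows by
  differentiating the one in weight two.\<close>

definition factor_quads :: "nat \<Rightarrow> (nat \<times> nat \<times> nat \<times> nat) set" where
  "factor_quads n = {(a, b, x, y). a > 0 \<and> b > 0 \<and> x > 0 \<and> y > 0 \<and> a * x + b * y = n}"

lemma finite_factor_quads [simp]: "finite (factor_quads n)"
proof (rule finite_subset)
  show "factor_quads n \<subseteq> {..n} \<times> {..n} \<times> {..n} \<times> {..n}"
  proof (clarsimp simp: factor_quads_def)
    fix a b x y :: nat
    assume h: "0 < a" "0 < b" "0 < x" "0 < y"
    have "a \<le> a * x" "b \<le> b * y" "x \<le> a * x" "y \<le> b * y" using h by auto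
    thus "a \<le> a * x + b * y \<and> b \<le> a * x + b * y \<and> x \<le> a * x + b * y \<and> y \<le> a * x + b * y"
      by linarith
  qed
qed auto

definition quad_sum :: "nat \<Rightarrow> (nat \<Rightarrow> nat \<Rightarrow> nat \<Rightarrow> nat \<Rightarrow> bool) \<Rightarrow> (nat \<Rightarrow> nat \<Rightarrow> real) \<Rightarrow> real" where
  "quad_sum n P F = (\<Sum>(a, b, x, y) \<in> {q \<in> factor_quads n. case q of (a, b, x, y) \<Rightarrow> P a b x y}. F a b)"

lemma quad_sum_add: "quad_sum n P (\<lambda>a b. F a b + G a b) = quad_sum n P F + quad_sum n P G"
  unfolding quad_sum_def by (simp add: sum.distrib case_prod_unfold)

lemma quad_sum_cmult: "quad_sum n P (\<lambda>a b. c * F a b) = c * quad_sum n P F"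
  unfolding quad_sum_def by (simp add: sum_distrib_left case_prod_unfold)

lemma quad_sum_cong:
  assumes "\<And>a b x y. P a b x y \<Longrightarrow> F a b = G a b"
  shows "quad_sum n P F = quad_sum n P G"
  unfolding quad_sum_def using assms by (intro sum.cong) auto

lemma quad_sum_split:
  assumes "\<And>a b x y. P a b x y \<Longrightarrow> \<not> Q a b x y"
  shows "quad_sum n (\<lambda>a b x y. P a b x y \<or> Q a b x y) F = quad_sum n P F + quad_sum n Q F"
  unfolding quad_sum_def
  by (subst sum.union_disjoint [symmetric]) (use assms in \<open>auto intro!: sum.cong\<close>)

lemma quad_sum_swap: "quad_sum n P F = quad_sum n (\<lambda>a b x y. P b a y x) (\<lambda>a b. F b a)"
  unfolding quad_sum_def
  by (rule sum.reindex_bij_witness[where i = "\<lambda>(a, b, x, y). (b, a, y, x)"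
        and j = "\<lambda>(a, b, x, y). (b, a, y, x)"]) (auto simp: factor_quads_def)

text \<open>The substitution \<open>(a, b, x, y) \<mapsto> (a - b, b, x, x + y)\<close> preserves \<open>a x + b y\<close>.\<close>
lemma quad_sum_shear:
  "quad_sum n (\<lambda>a b x y. b < a) (\<lambda>a b. F (a - b) b) = quad_sum n (\<lambda>a b x y. x < y) F"
  unfolding quad_sum_def
proof (rule sum.reindex_bij_witness[where i = "\<lambda>(a, b, x, y). (a + b, b, x, y - x)"
        and j = "\<lambda>(a, b, x, y). (a - b, b, x, x + y)"], goal_cases)
  case (2 q)
  obtain a b x y where q: "q = (a, b, x, y)" by (cases q)
  with 2 have h: "b < a" "b > 0" "x > 0" "y > 0" "a * x + b * y = n" by (auto simp: factor_quads_def)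
  from h(1) obtain c where "a = b + c" "c > 0" using less_imp_add_positive by blast
  with h q show ?case by (auto simp: factor_quads_def algebra_simps)
next
  case (4 q)
  obtain a b x y where q: "q = (a, b, x, y)" by (cases q)
  with 4 have h: "x < y" "a > 0" "b > 0" "x > 0" "a * x + b * y = n" by (auto simp: factor_quads_def)
  from h(1) obtain c where "y = x + c" "c > 0" using less_imp_add_positive by blast
  with h q show ?case by (auto simp: factor_quads_def algebra_simps)
qed auto

lemma quad_sum_trichotomy:
  "quad_sum n (\<lambda>_ _ _ _. True) F = quad_sum n (\<lambda>a b x y. b < a) F + quad_sum n (\<lambda>a b x y. a = b) F
     + quad_sum n (\<lambda>a b x y. b < a) (\<lambda>a b. F b a)"
  "quad_sum n (\<lambda>_ _ _ _. True) F = quad_sum n (\<lambda>a b x y. x < y) F + quad_sum n (\<lambda>a b x y. x = y) F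
     + quad_sum n (\<lambda>a b x y. x < y) (\<lambda>a b. F b a)"
proof -
  have "quad_sum n (\<lambda>_ _ _ _. True) F = quad_sum n (\<lambda>a b x y. (b < a \<or> a = b) \<or> a < b) F"
    by (rule arg_cong[where f = "\<lambda>P. quad_sum n P F"]) (auto simp: fun_eq_iff)
  also have "\<dots> = quad_sum n (\<lambda>a b x y. b < a) F + quad_sum n (\<lambda>a b x y. a = b) F
     + quad_sum n (\<lambda>a b x y. a < b) F"
    by (subst quad_sum_split, force, subst quad_sum_split) auto
  also have "quad_sum n (\<lambda>a b x y. a < b) F = quad_sum n (\<lambda>a b x y. b < a) (\<lambda>a b. F b a)"
    by (rule quad_sum_swap)
  finally show "quad_sum n (\<lambda>_ _ _ _. True) F = quad_sum n (\<lambda>a b x y. b < a) F + quad_sum n (\<lambda>a b x y. a = b) F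
     + quad_sum n (\<lambda>a b x y. b < a) (\<lambda>a b. F b a)" .
  have "quad_sum n (\<lambda>_ _ _ _. True) F = quad_sum n (\<lambda>a b x y. (x < y \<or> x = y) \<or> y < x) F"
    by (rule arg_cong[where f = "\<lambda>P. quad_sum n P F"]) (auto simp: fun_eq_iff)
  also have "\<dots> = quad_sum n (\<lambda>a b x y. x < y) F + quad_sum n (\<lambda>a b x y. x = y) F
     + quad_sum n (\<lambda>a b x y. y < x) F"
    by (subst quad_sum_split, force, subst quad_sum_split) auto
  also have "quad_sum n (\<lambda>a b x y. y < x) F = quad_sum n (\<lambda>a b x y. x < y) (\<lambda>a b. F b a)"
    by (rule quad_sum_swap)
  finally show "quad_sum n (\<lambda>_ _ _ _. True) F = quad_sum n (\<lambda>a b x y. x < y) F + quad_sum n (\<lambda>a b x y. x = y) F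
     + quad_sum n (\<lambda>a b x y. x < y) (\<lambda>a b. F b a)" .
qed

text \<open>With a = b = d the equation reads d (x + y) = n, so every divisor d contributes once for
  each of the n/d - 1 splittings of n/d into two positive parts.\<close>

lemma quad_sum_diag_ab:
  assumes "n > 0"
  shows "quad_sum n (\<lambda>a b x y. a = b) F = (\<Sum>d | d dvd n. (real n / real d - 1) * F d d)"
proof -
  have "quad_sum n (\<lambda>a b x y. a = b) F = (\<Sum>(d, x) \<in> (SIGMA d:{d. d dvd n}. {0<..<n div d}). F d d)"
    unfolding quad_sum_def
  proof (rule sum.reindex_bij_witness[where i = "\<lambda>(d, x). (d, d, x, n div d - x)"
        and j = "\<lambda>(a, b, x, y). (a, x)"], goal_cases)
    case (1 q)
    then show ?case by (auto simp: factor_quads_def simp flip: add_mult_distrib2)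
  next
    case (2 q)
    then obtain d x y where q: "q = (d, d, x, y)" "d > 0" "x > 0" "y > 0" "d * x + d * y = n"
      by (auto simp: factor_quads_def)
    have "n = d * (x + y)" using q by (simp add: algebra_simps)
    then show ?case using q by (auto)
  next
    case (4 p)
    then obtain d x where p: "p = (d, x)" "d dvd n" "0 < x" "x < n div d" by auto
    then obtain k where k: "n = d * k" by auto
    have "d > 0" using k assms by (cases d) auto
    then show ?case using p k by (auto simp: factor_quads_def diff_mult_distrib2)
  qed auto
  also have "\<dots> = (\<Sum>d | d dvd n. \<Sum>x\<in>{0<..<n div d}. F d d)"
    using assms by (intro sum.Sigma [symmetric]) auto
  also have "\<dots> = (\<Sum>d | d dvd n. (real n / real d - 1) * F d d)"
  proof (rule sum.cong)
    fix d assume "d \<in> {d. d dvd n}"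
    then obtain k where k: "n = d * k" by auto
    hence "d > 0" "k > 0" using assms by auto
    then show "(\<Sum>x\<in>{0<..<n div d}. F d d) = (real n / real d - 1) * F d d"
      using k by (simp add: of_nat_diff)
  qed simp
  finally show ?thesis .
qed

lemma quad_sum_diag_xy:
  assumes "n > 0"
  shows "quad_sum n (\<lambda>a b x y. x = y) F = (\<Sum>d | d dvd n. \<Sum>a<d. if a = 0 then 0 else F a (d - a))"
proof -
  have "quad_sum n (\<lambda>a b x y. x = y) F = (\<Sum>(d, a) \<in> (SIGMA d:{d. d dvd n}. {0<..<d}). F a (d - a))"
    unfolding quad_sum_def
  proof (rule sum.reindex_bij_witness[where i = "\<lambda>(d, a). (a, d - a, n div d, n div d)"
        and j = "\<lambda>(a, b, x, y). (a + b, a)"], goal_cases)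
    case (1 q)
    then show ?case by (auto simp: factor_quads_def)
       (metis add_gr_0 add_mult_distrib nonzero_mult_div_cancel_left less_numeral_extra(3))+
  next
    case (2 q)
    then obtain a b x where q: "q = (a, b, x, x)" "a > 0" "b > 0" "x > 0" "a * x + b * x = n"
      by (auto simp: factor_quads_def)
    have "n = (a + b) * x" using q by (simp add: algebra_simps)
    then show ?case using q by auto
  next
    case (4 p)
    then obtain d a where p: "p = (d, a)" "d dvd n" "0 < a" "a < d" by auto
    then obtain k where k: "n = d * k" by auto
    have "k > 0" using k assms by (cases k) auto
    then show ?case using p k by (auto simp: factor_quads_def diff_mult_distrib)
  qed auto
  also have "\<dots> = (\<Sum>d | d dvd n. \<Sum>a\<in>{0<..<d}. F a (d - a))"
    using assms by (intro sum.Sigma [symmetric]) auto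
  also have "\<dots> = (\<Sum>d | d dvd n. \<Sum>a<d. if a = 0 then 0 else F a (d - a))"
    by (intro sum.cong sum.mono_neutral_cong_left) auto
  finally show ?thesis .
qed

text \<open>The weight 1/2 on the mixed product is the combination of diagonal sums that survives in
  \<open>sigma_convolution\<close>.\<close>

lemma sum_interval_squares_products:
  "(\<Sum>a<d. if a = 0 then 0 else real a * real a + real a * real (d - a) / 2)
     = (5 * real d ^ 3 - 6 * real d ^ 2 + real d) / 12"
proof -
  have s: "(\<Sum>a<k. real a * real a / 2 + real a * c / 2) =
      ((real k - 1) * real k * (2 * real k - 1) / 12 + real k * (real k - 1) * c / 4)" for k c
    by (induction k) (auto simp: field_simps)
  have "(\<Sum>a<d. if a = 0 then 0 else real a * real a + real a * real (d - a) / 2)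
      = (\<Sum>a<d. real a * real a / 2 + real a * real d / 2)"
    by (rule sum.cong) (auto simp: of_nat_diff field_simps)
  also have "\<dots> = (5 * real d ^ 3 - 6 * real d ^ 2 + real d) / 12"
    by (subst s) (simp add: field_simps power2_eq_square power3_eq_cube)
  finally show ?thesis .
qed

lemma sigmak_conv_pairs:
  assumes "k > 0"
  shows "real (sigmak 1 k) = (\<Sum>(a, x) \<in> {(a, x). 0 < a \<and> 0 < x \<and> a * x = k}. real a)"
proof -
  have "(\<Sum>(a, x) \<in> {(a, x). 0 < a \<and> 0 < x \<and> a * x = k}. real a) = (\<Sum>d | d dvd k. real d)"
    using assms
    by (intro sum.reindex_bij_witness[where i = "\<lambda>d. (d, k div d)" and j = fst]) (auto simp: dvd_def)
  with assms show ?thesis by (simp add: sigmak_def)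
qed

text \<open>Liouville's method. The left side is the sum of a b over all a x + b y = n. It is split
  by comparing a with b and again by comparing x with y; the shear turns one kind of off-diagonal
  sum into the other. Applied to quadratic weights this gives enough linear relations to express
  everything by the diagonals, which are divisor sums, and there the terms with
  \<open>sigmak 2 n\<close> cancel.\<close>

lemma sigma_convolution:
  assumes "n > 0"
  shows "12 * (\<Sum>k\<le>n. real (sigmak 1 k) * real (sigmak 1 (n - k)))
     = 5 * real (sigmak 3 n) + (1 - 6 * real n) * real (sigmak 1 n)"
proof -
  define A where "A k = {(a, x). 0 < a \<and> 0 < x \<and> a * x = (k::nat)}" for k
  have finA: "finite (A k)" for k
    by (rule finite_subset[of _ "{..k} \<times> {..k}"]) (auto simp: A_def)
  have sig0: "sigmak 1 0 = 0" by (simp add: sigmak_def)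
  have "(\<Sum>k\<le>n. real (sigmak 1 k) * real (sigmak 1 (n - k)))
      = (\<Sum>k\<in>{0<..<n}. real (sigmak 1 k) * real (sigmak 1 (n - k)))"
    by (intro sum.mono_neutral_right) (auto simp: sig0 simp del: One_nat_def)
  also have "\<dots> = (\<Sum>k\<in>{0<..<n}. \<Sum>(p, r) \<in> A k \<times> A (n - k). real (fst p) * real (fst r))"
  proof (rule sum.cong)
    fix k assume k: "k \<in> {0<..<n}"
    have sig: "real (sigmak 1 j) = (\<Sum>p \<in> A j. real (fst p))" if "j > 0" for j
      using sigmak_conv_pairs[OF that] by (simp add: A_def case_prod_unfold)
    show "real (sigmak 1 k) * real (sigmak 1 (n - k)) = (\<Sum>(p, r) \<in> A k \<times> A (n - k). real (fst p) * real (fst r))"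
      using k by (simp add: sig sum_product sum.cartesian_product case_prod_unfold del: One_nat_def)
  qed simp
  also have "\<dots> = (\<Sum>(k, p, r) \<in> (SIGMA k:{0<..<n}. A k \<times> A (n - k)). real (fst p) * real (fst r))"
    by (subst sum.Sigma) (auto simp: finA case_prod_unfold)
  also have "\<dots> = quad_sum n (\<lambda>_ _ _ _. True) (\<lambda>a b. real a * real b)"
    unfolding quad_sum_def
    by (rule sum.reindex_bij_witness[where i = "\<lambda>(a, b, x, y). (a * x, (a, x), (b, y))"
          and j = "\<lambda>(k, (a, x), (b, y)). (a, b, x, y)"]) (auto simp: factor_quads_def A_def)
  also define T where "T = quad_sum n (\<lambda>_ _ _ _. True) (\<lambda>a b. real a * real b)"
  define P where "P = quad_sum n (\<lambda>a b x y. b < a) (\<lambda>a b. real a * real a)"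
  define R where "R = quad_sum n (\<lambda>a b x y. b < a) (\<lambda>a b. real b * real b)"
  define M where "M = quad_sum n (\<lambda>a b x y. b < a) (\<lambda>a b. real a * real b)"
  define P' where "P' = quad_sum n (\<lambda>a b x y. x < y) (\<lambda>a b. real a * real a)"
  define R' where "R' = quad_sum n (\<lambda>a b x y. x < y) (\<lambda>a b. real b * real b)"
  define M' where "M' = quad_sum n (\<lambda>a b x y. x < y) (\<lambda>a b. real a * real b)"
  define D1 where "D1 = quad_sum n (\<lambda>a b x y. a = b) (\<lambda>a b. real a * real a)"
  define D1' where "D1' = quad_sum n (\<lambda>a b x y. a = b) (\<lambda>a b. real a * real b)"
  define D2 where "D2 = quad_sum n (\<lambda>a b x y. x = y) (\<lambda>a b. real a * real b)"
  define D3 where "D3 = quad_sum n (\<lambda>a b x y. x = y) (\<lambda>a b. real a * real a)"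
  have D1': "D1' = D1" unfolding D1_def D1'_def by (rule quad_sum_cong) auto
  have 1: "P + (-2) * M + R = P'"
  proof -
    have "P' = quad_sum n (\<lambda>a b x y. b < a) (\<lambda>a b. real (a - b) * real (a - b))"
      unfolding P'_def by (rule quad_sum_shear[symmetric])
    also have "\<dots> = quad_sum n (\<lambda>a b x y. b < a)
         (\<lambda>a b. real a * real a + (-2) * (real a * real b) + real b * real b)"
      by (rule quad_sum_cong) (simp add: of_nat_diff algebra_simps)
    finally show ?thesis by (simp only: quad_sum_add quad_sum_cmult P_def R_def M_def)
  qed
  have 2: "P = P' + 2 * M' + R'"
  proof -
    have "P' + 2 * M' + R' = quad_sum n (\<lambda>a b x y. x < y)
         (\<lambda>a b. real a * real a + 2 * (real a * real b) + real b * real b)"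
      by (simp only: quad_sum_add quad_sum_cmult P'_def R'_def M'_def)
    also have "\<dots> = quad_sum n (\<lambda>a b x y. x < y) (\<lambda>a b. real (a + b) * real (a + b))"
      by (rule quad_sum_cong) (simp add: algebra_simps)
    also have "\<dots> = quad_sum n (\<lambda>a b x y. b < a) (\<lambda>a b. real ((a - b) + b) * real ((a - b) + b))"
      by (rule quad_sum_shear[symmetric])
    also have "\<dots> = P" unfolding P_def by (rule quad_sum_cong) auto
    finally show ?thesis by simp
  qed
  have 3: "R = R'" unfolding R_def R'_def by (rule quad_sum_shear)
  have 4: "T = M + D1' + M" "T = M' + D2 + M'"
    unfolding T_def M_def D1'_def M'_def D2_def
    by (subst quad_sum_trichotomy, simp add: mult.commute)+
  have 5: "P + D1 + R = P' + D3 + R'"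
    unfolding P_def D1_def R_def P'_def D3_def R'_def
    by (simp only: quad_sum_trichotomy(1)[symmetric] quad_sum_trichotomy(2)[symmetric])
  \<comment> \<open>The relations give 2 M = D3 - D1 + R and 2 M' = D3 - D1 - R, so the unknown R
    disappears on adding the two expressions for T.\<close>
  have T: "T = (D3 + (1/2) * D2) - D1 / 2" using 1 2 3 4 5 D1' by linarith
  have D32: "D3 + (1/2) * D2 = (5 * real (sigmak 3 n) - 6 * real (sigmak 2 n) + real (sigmak 1 n)) / 12"
  proof -
    have "D3 + (1/2) * D2 = quad_sum n (\<lambda>a b x y. x = y) (\<lambda>a b. real a * real a + (1/2) * (real a * real b))"
      by (simp only: quad_sum_add quad_sum_cmult D3_def D2_def)
    also have "\<dots> = (\<Sum>d | d dvd n. \<Sum>a<d. if a = 0 then 0 else real a * real a + (1/2) * (real a * real (d - a)))"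
      by (rule quad_sum_diag_xy[OF assms])
    also have "\<dots> = (\<Sum>d | d dvd n. (5 * real d ^ 3 - 6 * real d ^ 2 + real d) / 12)"
      by (intro sum.cong refl, subst sum_interval_squares_products [symmetric]) (auto intro!: sum.cong)
    also have "\<dots> = (5 * real (sigmak 3 n) - 6 * real (sigmak 2 n) + real (sigmak 1 n)) / 12"
      using assms by (simp add: sigmak_def sum.distrib sum_subtractf sum_distrib_left sum_divide_distrib add_divide_distrib diff_divide_distrib)
    finally show ?thesis .
  qed
  have D1: "D1 = real n * real (sigmak 1 n) - real (sigmak 2 n)"
  proof -
    have "D1 = (\<Sum>d | d dvd n. (real n / real d - 1) * (real d * real d))"
      unfolding D1_def by (rule quad_sum_diag_ab[OF assms])
    also have "\<dots> = (\<Sum>d | d dvd n. real n * real d - real d ^ 2)"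
    proof (intro sum.cong refl)
      fix d assume "d \<in> {d. d dvd n}"
      hence "d > 0" using assms by (auto intro: Nat.gr0I)
      thus "(real n / real d - 1) * (real d * real d) = real n * real d - real d ^ 2"
        by (simp add: field_simps power2_eq_square)
    qed
    also have "\<dots> = real n * real (sigmak 1 n) - real (sigmak 2 n)"
      using assms by (simp add: sigmak_def sum_subtractf sum_distrib_left)
    finally show ?thesis .
  qed
  from T D32 D1 show ?thesis
    unfolding T_def [symmetric] calculation by (simp add: field_simps)
qed

section \<open>Partial fractions of the cotangent\<close>

lemma sin_pi_neq_0:
  fixes w :: complex
  assumes "w \<notin> \<int>"
  shows "sin (of_real pi * w) \<noteq> 0"
proof
  assume "sin (of_real pi * w) = 0"
  then obtain n :: int where "of_real pi * w = of_real (of_int n * pi)" by (auto simp: Complex_Transcendental.sin_eq_0)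
  hence "w = of_int n" by simp
  with assms show False by simp
qed

text \<open>Logarithmic derivative of the reflection formula: the product of \<open>Gamma w\<close>,
  \<open>Gamma (1 - w)\<close> and the sine is the constant pi away from the integers.
  Differentiating once more gives \<open>Polygamma_1_reflection\<close>.\<close>

lemma Digamma_reflection:
  fixes w :: complex
  assumes "w \<notin> \<int>"
  shows "Digamma (1 - w) - Digamma w = of_real pi * cot (of_real pi * w)"
proof -
  have w: "w \<notin> \<int>\<^sub>\<le>\<^sub>0" "1 - w \<notin> \<int>\<^sub>\<le>\<^sub>0"
    using assms nonpos_Ints_Int Ints_diff[of 1 "1 - w"] by (auto dest: nonpos_Ints_Int)
  have sin: "sin (of_real pi * w) \<noteq> 0" using sin_pi_neq_0[OF assms] .
  have "((\<lambda>w. Gamma w * Gamma (1 - w) * sin (of_real pi * w)) has_field_derivative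
      Gamma w * Gamma (1 - w) * ((Digamma w - Digamma (1 - w)) * sin (of_real pi * w) 
        + of_real pi * cos (of_real pi * w))) (at w)"
    using w by (auto intro!: derivative_eq_intros simp: algebra_simps)
  moreover have "((\<lambda>w. Gamma w * Gamma (1 - w) * sin (of_real pi * w)) has_field_derivative 0) (at w)"
  proof (rule has_field_derivative_transform_within_open)
    show "((\<lambda>w. of_real pi) has_field_derivative 0) (at w)" by simp
    show "open (- \<int> :: complex set)" using closed_Ints by (auto simp: open_Compl)
    show "w \<in> - \<int>" using assms by auto
    show "of_real pi = Gamma v * Gamma (1 - v) * sin (of_real pi * v)" if "v \<in> -\<int>" for v :: complex
      using sin_pi_neq_0[of v] that by (simp add: Gamma_reflection_complex)
  qed
  ultimately have "Gamma w * Gamma (1 - w) * ((Digamma w - Digamma (1 - w)) * sin (of_real pi * w) 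
        + of_real pi * cos (of_real pi * w)) = 0"
    using DERIV_unique by blast
  moreover have "Gamma w \<noteq> 0" "Gamma (1 - w) \<noteq> 0" using w by (auto simp: Gamma_eq_zero_iff)
  ultimately have "(Digamma w - Digamma (1 - w)) * sin (of_real pi * w) + of_real pi * cos (of_real pi * w) = 0"
    by simp
  then show ?thesis using sin by (simp add: cot_def field_simps)
qed

lemma Polygamma_1_reflection:
  fixes w :: complex
  assumes "w \<notin> \<int>"
  shows "Polygamma 1 w + Polygamma 1 (1 - w) = of_real pi ^ 2 / sin (of_real pi * w) ^ 2"
proof -
  have w: "w \<notin> \<int>\<^sub>\<le>\<^sub>0" "1 - w \<notin> \<int>\<^sub>\<le>\<^sub>0"
    using assms nonpos_Ints_Int Ints_diff[of 1 "1 - w"] by (auto dest: nonpos_Ints_Int)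
  have sin: "sin (of_real pi * w) \<noteq> 0" using sin_pi_neq_0[OF assms] .
  have "((\<lambda>w. of_real pi * cot (of_real pi * w)) has_field_derivative - (of_real pi ^ 2 / sin (of_real pi * w) ^ 2)) (at w)"
  proof -
    have "((\<lambda>w. of_real pi * w) has_field_derivative of_real pi) (at w)"
      by (auto intro!: derivative_eq_intros)
    from DERIV_cmult[OF DERIV_chain2[OF DERIV_cot[OF sin] this], of "of_real pi"] show ?thesis
      by (simp add: power2_eq_square field_simps)
  qed
  moreover have "((\<lambda>w. of_real pi * cot (of_real pi * w)) has_field_derivative - (Polygamma 1 w + Polygamma 1 (1 - w))) (at w)"
  proof (rule has_field_derivative_transform_within_open)
    show "((\<lambda>w. Digamma (1 - w) - Digamma w) has_field_derivative - (Polygamma 1 w + Polygamma 1 (1 - w))) (at w)"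
      using w by (auto intro!: derivative_eq_intros)
    show "open (- \<int> :: complex set)" using closed_Ints by (auto simp: open_Compl)
    show "w \<in> - \<int>" using assms by auto
    show "Digamma (1 - v) - Digamma v = of_real pi * cot (of_real pi * v)" if "v \<in> -\<int>" for v :: complex
      using Digamma_reflection that by auto
  qed
  ultimately have "- (of_real pi ^ 2 / sin (of_real pi * w) ^ 2) = - (Polygamma 1 w + Polygamma 1 (1 - w))"
    by (rule DERIV_unique)
  then show ?thesis by (simp only: neg_equal_iff_equal)
qed

lemma has_sum_Polygamma_1:
  fixes w :: complex
  assumes "w \<notin> \<int>\<^sub>\<le>\<^sub>0"
  shows "((\<lambda>k. 1 / (w + of_nat k) ^ 2) has_sum Polygamma 1 w) UNIV"
proof (rule norm_summable_imp_has_sum)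
  have "w \<noteq> 0" using assms by auto
  then show "(\<lambda>k. 1 / (w + of_nat k) ^ 2) sums Polygamma 1 w"
    using summable_sums[OF Polygamma_converges'[of w 2]]
    by (simp add: Polygamma_def field_simps numeral_2_eq_2)
  show "summable (\<lambda>k. norm (1 / (w + of_nat k) ^ 2))"
  proof (rule summable_comparison_test_ev)
    show "summable (\<lambda>k. 4 * (1 / real k ^ 2))"
      using inverse_power_summable[of 2] by (intro summable_mult) (auto simp: field_simps)
    have "eventually (\<lambda>k. real k > 2 * norm w) sequentially"
      by real_asymp
    then show "eventually (\<lambda>k. norm (norm (1 / (w + of_nat k) ^ 2)) \<le> 4 * (1 / real k ^ 2)) sequentially"
    proof eventually_elim
      case (elim k)
      have "norm (of_nat k :: complex) \<le> norm (w + of_nat k) + norm w"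
        using norm_triangle_ineq4[of "w + of_nat k" w] by simp
      with elim have 1: "real k / 2 \<le> norm (w + of_nat k)" by simp
      have k: "real k > 0" using elim norm_ge_zero[of w] by linarith
      have "(real k / 2) ^ 2 \<le> norm (w + of_nat k) ^ 2" using 1 by (intro power_mono) auto
      hence "1 / norm (w + of_nat k) ^ 2 \<le> 1 / (real k / 2) ^ 2" using k by (intro divide_left_mono) (auto intro!: mult_pos_pos simp: zero_less_norm_iff intro: order.strict_trans2[OF _ 1])
      then show ?case by (simp add: norm_divide norm_power power_divide)
    qed
  qed
qed

text \<open>The nonnegative integers contribute the trigamma series at w and the negative ones the
  series at 1 - w, so the sum is given by the reflection formula.\<close>

lemma has_sum_inverse_squares_int:
  fixes w :: complex
  assumes "w \<notin> \<int>"
  shows "((\<lambda>n::int. 1 / (w + of_int n) ^ 2) has_sum (of_real pi ^ 2 / sin (of_real pi * w) ^ 2)) UNIV"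
proof -
  have w: "w \<notin> \<int>\<^sub>\<le>\<^sub>0" "1 - w \<notin> \<int>\<^sub>\<le>\<^sub>0"
    using assms nonpos_Ints_Int Ints_diff[of 1 "1 - w"] by (auto dest: nonpos_Ints_Int)
  have 1: "((\<lambda>n::int. 1 / (w + of_int n) ^ 2) has_sum Polygamma 1 w) {0..}"
  proof (subst has_sum_reindex_bij_witness)
    show "((\<lambda>k. 1 / (w + of_nat k) ^ 2) has_sum Polygamma 1 w) UNIV" by (rule has_sum_Polygamma_1[OF w(1)])
    show "\<And>a. a \<in> {0..} \<Longrightarrow> int (nat a) = a" by auto
  qed auto
  have 2: "((\<lambda>n::int. 1 / (w + of_int n) ^ 2) has_sum Polygamma 1 (1 - w)) {..<0}"
  proof (subst has_sum_reindex_bij_witness)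
    show "((\<lambda>k. 1 / (1 - w + of_nat k) ^ 2) has_sum Polygamma 1 (1 - w)) UNIV" by (rule has_sum_Polygamma_1[OF w(2)])
    show "\<And>a. a \<in> {..<0} \<Longrightarrow> - int (nat (-a - 1)) - 1 = a" by auto
    show "1 / (1 - w + of_nat (nat (- a - 1)))\<^sup>2 = 1 / (w + of_int a)\<^sup>2" if "a \<in> {..<0}" for a
    proof -
      have "1 - w + of_nat (nat (- a - 1)) = - (w + of_int a)" using that by simp
      thus ?thesis by (simp only: power2_minus)
    qed
  qed auto
  have "((\<lambda>n::int. 1 / (w + of_int n) ^ 2) has_sum (Polygamma 1 w + Polygamma 1 (1 - w))) ({0..} \<union> {..<0})"
    by (intro has_sum_Un_disjoint 1 2) auto
  also have "{0..} \<union> {..<0} = (UNIV :: int set)" by auto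
  finally show ?thesis by (simp only: Polygamma_1_reflection[OF assms])
qed

text \<open>Termwise difference of the digamma series at 1 - u and 1 + u: the harmonic terms cancel,
  and moving from 1 + u to u accounts for 1 / u.\<close>

lemma cot_partial_fractions:
  fixes u :: complex
  assumes "u \<notin> \<int>"
  shows "(\<lambda>k. 1 / (u + of_nat (Suc k)) + 1 / (u - of_nat (Suc k))) sums (of_real pi * cot (of_real pi * u) - 1 / u)"
proof -
  have "u \<noteq> -1" using assms by auto
  hence u: "u \<noteq> 0" "1 - u \<noteq> 0" "1 + u \<noteq> 0" using assms by (auto simp: add_eq_0_iff)
  have "(\<lambda>k. (inverse (of_nat (Suc k)) - inverse ((1 - u) + of_nat k)) - (inverse (of_nat (Suc k)) - inverse ((1 + u) + of_nat k)))
      sums ((Digamma (1 - u) + euler_mascheroni) - (Digamma (1 + u) + euler_mascheroni))"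
    unfolding Digamma_def diff_add_cancel
    by (intro sums_diff summable_sums summable_Digamma u)
  also have "(Digamma (1 - u) + euler_mascheroni) - (Digamma (1 + u) + euler_mascheroni) = of_real pi * cot (of_real pi * u) - 1 / u"
  proof -
    have "Digamma (1 + u) = Digamma u + 1 / u" using Digamma_plus1[OF u(1)] by (simp only: add.commute)
    thus ?thesis using Digamma_reflection[OF assms] by (simp add: algebra_simps)
  qed
  also have "(\<lambda>k. (inverse (of_nat (Suc k)) - inverse ((1 - u) + of_nat k)) - (inverse (of_nat (Suc k)) - inverse ((1 + u) + of_nat k)))
     = (\<lambda>k. 1 / (u + of_nat (Suc k)) + 1 / (u - of_nat (Suc k)))"
  proof
    fix k
    have 1: "1 - u + of_nat k = - (u - of_nat (Suc k))" "1 + u + of_nat k = u + of_nat (Suc k)" by simp_all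
    show "(inverse (of_nat (Suc k)) - inverse ((1 - u) + of_nat k)) - (inverse (of_nat (Suc k)) - inverse ((1 + u) + of_nat k))
      = 1 / (u + of_nat (Suc k)) + 1 / (u - of_nat (Suc k))"
      unfolding 1 inverse_minus_eq by (simp only: divide_inverse) algebra
  qed
  finally show ?thesis .
qed

text \<open>Passes from unordered sums to symmetric partial sums, on which the telescoping terms can
  be evaluated.\<close>

lemma has_sum_int_imp_symmetric_limit:
  fixes f :: "int \<Rightarrow> 'a :: {topological_comm_monoid_add, t2_space}"
  assumes "(f has_sum S) UNIV"
  shows "(\<lambda>N. \<Sum>n\<in>{- int N..int N}. f n) \<longlonglongrightarrow> S"
proof -
  have "filterlim (\<lambda>N. {- int N..int N}) (finite_subsets_at_top UNIV) sequentially"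
    unfolding filterlim_finite_subsets_at_top
  proof safe
    fix X :: "int set" assume X: "finite X"
    define M where "M = nat (Max (insert 0 (abs ` X)))"
    have M: "\<bar>x\<bar> \<le> int M" if "x \<in> X" for x
    proof -
      have "\<bar>x\<bar> \<le> Max (insert 0 (abs ` X))" using X that by (intro Max_ge) auto
      thus ?thesis unfolding M_def by linarith
    qed
    show "\<forall>\<^sub>F y in sequentially. finite {- int y..int y} \<and> X \<subseteq> {- int y..int y} \<and> {- int y..int y} \<subseteq> UNIV"
      using eventually_ge_at_top[of M]
    proof eventually_elim
      case (elim N)
      have "x \<in> {- int N..int N}" if "x \<in> X" for x
        using M[OF that] elim by auto
      then show ?case by auto
    qed
  qed
  from filterlim_compose[OF assms[unfolded has_sum_def] this] show ?thesis .
qed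

section \<open>Inversion of the Eisenstein series of weight two\<close>

definition qexp :: "complex \<Rightarrow> complex" where
  "qexp z = exp (2 * of_real pi * \<i> * z)"

lemma norm_qexp: "norm (qexp z) = exp (- 2 * pi * Im z)"
  by (simp add: qexp_def)

lemma norm_qexp_less_1: "Im z > 0 \<Longrightarrow> norm (qexp z) < 1"
  by (simp add: norm_qexp)

lemma qexp_nonzero [simp]: "qexp z \<noteq> 0"
  by (simp add: qexp_def)

lemma qexp_plus_1: "qexp (z + 1) = qexp z"
  by (simp add: qexp_def algebra_simps exp_add)

lemma qexp_of_nat_mult: "qexp (of_nat n * z) = qexp z ^ n"
  by (simp add: qexp_def exp_of_nat_mult [symmetric] mult_ac)

lemma inverse_sin_squared_conv_qexp:
  assumes "Im w > 0"
  shows "1 / sin (of_real pi * w) ^ 2 = - 4 * (qexp w / (1 - qexp w) ^ 2)"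
proof -
  define e where "e = exp (\<i> * of_real pi * w)"
  have e: "e \<noteq> 0" by (simp add: e_def)
  have q: "qexp w = e ^ 2" by (simp add: qexp_def e_def exp_of_nat_mult [symmetric] mult_ac)
  have s: "sin (of_real pi * w) = (e - 1 / e) / (2 * \<i>)"
    by (simp add: sin_exp_eq' sin_exp_eq e_def exp_minus field_simps)
  have "norm (e^2) < 1" using norm_qexp_less_1[OF assms] q by simp
  hence ne: "e ^ 2 \<noteq> 1" by auto
  have sq: "sin (of_real pi * w) ^ 2 = - ((1 - e^2) ^ 2) / (4 * e ^ 2)"
    using e unfolding s by (simp add: power_divide power_mult_distrib field_simps power2_eq_square)
  show ?thesis unfolding sq q by simp
qed

text \<open>Stated for real coefficients because \<open>eis_term_bound\<close> needs it at lattice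
  points shifted by 1/2.\<close>

lemma norm_lattice_lower_bound:
  assumes "Im z > 0"
  obtains c where "c > 0" "\<And>m r :: real. norm (of_real m * z + of_real r) \<ge> c * (\<bar>m\<bar> + \<bar>r\<bar>)"
proof -
  define K where "K = 1 / Im z + (1 + norm z / Im z)"
  have K: "K > 0" using assms unfolding K_def by (intro add_pos_pos add_pos_nonneg) auto
  show ?thesis
  proof
    show "1 / K > 0" using K by simp
    fix m r :: real
    define N where "N = norm (of_real m * z + of_real r)"
    have "\<bar>Im (of_real m * z + of_real r)\<bar> \<le> N" unfolding N_def by (rule abs_Im_le_cmod)
    hence "\<bar>m\<bar> * Im z \<le> N" using assms by (simp add: abs_mult)
    hence m: "\<bar>m\<bar> \<le> N * (1 / Im z)" using assms by (simp add: field_simps)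
    have "norm (of_real r :: complex) \<le> N + norm (of_real m * z)"
      using norm_triangle_ineq4[of "of_real m * z + of_real r" "of_real m * z"] by (simp add: N_def)
    hence "\<bar>r\<bar> \<le> N + \<bar>m\<bar> * norm z" by (simp add: norm_mult)
    also have "\<dots> \<le> N + N * (1 / Im z) * norm z" using m by (intro add_left_mono mult_right_mono) auto
    finally have "\<bar>m\<bar> + \<bar>r\<bar> \<le> N * K" using m by (simp add: K_def algebra_simps)
    thus "norm (of_real m * z + of_real r) \<ge> 1 / K * (\<bar>m\<bar> + \<bar>r\<bar>)" using K by (simp add: N_def field_simps)
  qed
qed

text \<open>Subtracting the telescoping term \<open>1 / (w\<^sup>2 - 1/4)\<close> from \<open>1 / w\<^sup>2\<close> makes the lattice
  sum of weight two absolutely convergent.\<close>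
definition eis_term :: "complex \<Rightarrow> complex" where
  "eis_term w = 1 / w ^ 2 - 1 / (w ^ 2 - 1 / 4)"

lemma eis_term_minus: "eis_term (- w) = eis_term w"
  by (simp add: eis_term_def)

text \<open>The two terms combine to - 1 / (4 w^2 (w - 1/2) (w + 1/2)), which decays like the fourth
  power of the distance. Half of this decay is spent on m and half on n, so that the bound is a
  product of two summable functions.\<close>

lemma eis_term_bound:
  fixes m n :: real
  assumes c: "c > 0" "\<And>m r :: real. norm (of_real m * z + of_real r) \<ge> c * (\<bar>m\<bar> + \<bar>r\<bar>)"
    and m: "\<bar>m\<bar> \<ge> 1"
  shows "norm (eis_term (of_real m * z + of_real n)) \<le> 1 / c ^ 4 * (1 / m ^ 2) * (1 / (1 + \<bar>n\<bar>) ^ 2)"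
proof -
  define w where "w = of_real m * z + of_real n"
  define s where "s = \<bar>m\<bar> + \<bar>n\<bar>"
  have s: "s \<ge> 1" "s \<ge> \<bar>m\<bar>" "s \<ge> 1 + \<bar>n\<bar>" using m by (auto simp: s_def)
  have w: "norm w \<ge> c * s" using c(2)[of m n] by (simp add: w_def s_def)
  have half: "(a + b) / 2 \<le> a + x" if "b \<le> x + 1/2" "1 \<le> a" "0 \<le> b" for a b x :: real
    using that by simp
  have w1: "norm (w - 1/2) \<ge> c * s / 2"
  proof -
    have "norm (w - 1/2) \<ge> c * (\<bar>m\<bar> + \<bar>n - 1/2\<bar>)" using c(2)[of m "n - 1/2"] by (simp add: w_def add_diff_eq)
    moreover have "\<bar>n\<bar> \<le> \<bar>n - 1/2\<bar> + 1/2" by linarith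
    hence "\<bar>m\<bar> + \<bar>n - 1/2\<bar> \<ge> s / 2" unfolding s_def by (rule half) (use m in auto)
    hence "c * (\<bar>m\<bar> + \<bar>n - 1/2\<bar>) \<ge> c * (s / 2)" using c(1) by (intro mult_left_mono) auto
    ultimately show ?thesis by simp
  qed
  have w2: "norm (w + 1/2) \<ge> c * s / 2"
  proof -
    have "norm (w + 1/2) \<ge> c * (\<bar>m\<bar> + \<bar>n + 1/2\<bar>)" using c(2)[of m "n + 1/2"] by (simp add: w_def add.assoc)
    moreover have "\<bar>n\<bar> \<le> \<bar>n + 1/2\<bar> + 1/2" by linarith
    hence "\<bar>m\<bar> + \<bar>n + 1/2\<bar> \<ge> s / 2" unfolding s_def by (rule half) (use m in auto)
    hence "c * (\<bar>m\<bar> + \<bar>n + 1/2\<bar>) \<ge> c * (s / 2)" using c(1) by (intro mult_left_mono) auto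
    ultimately show ?thesis by simp
  qed
  have pos: "c * s > 0" using c s by simp
  have f: "w ^ 2 - 1 / 4 = (w - 1/2) * (w + 1/2)" by (simp add: power2_eq_square algebra_simps)
  have nz: "w \<noteq> 0" "w - 1/2 \<noteq> 0" "w + 1/2 \<noteq> 0"
  proof -
    have "norm w > 0" "norm (w - 1/2) > 0" "norm (w + 1/2) > 0" using w w1 w2 pos by linarith+
    thus "w \<noteq> 0" "w - 1/2 \<noteq> 0" "w + 1/2 \<noteq> 0" unfolding zero_less_norm_iff by blast+
  qed
  have "eis_term w = - 1 / (4 * w^2 * ((w - 1/2) * (w + 1/2)))"
    unfolding eis_term_def f using nz by (simp add: divide_simps) (simp add: power2_eq_square algebra_simps)
  hence "norm (eis_term w) = 1 / (4 * norm w ^ 2 * (norm (w - 1/2) * norm (w + 1/2)))"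
    by (simp add: norm_divide norm_mult norm_power)
  also have "\<dots> \<le> 1 / (4 * (c * s) ^ 2 * ((c * s / 2) * (c * s / 2)))"
  proof (rule divide_left_mono)
    show "4 * (c * s)\<^sup>2 * (c * s / 2 * (c * s / 2)) \<le> 4 * (cmod w)\<^sup>2 * (cmod (w - 1 / 2) * cmod (w + 1 / 2))"
      using w w1 w2 pos by (intro mult_mono power_mono) auto
    show "0 < 4 * (cmod w)\<^sup>2 * (cmod (w - 1 / 2) * cmod (w + 1 / 2)) * (4 * (c * s)\<^sup>2 * (c * s / 2 * (c * s / 2)))"
      using nz pos c s by (intro mult_pos_pos zero_less_power) auto
  qed simp
  also have "4 * (c * s) ^ 2 * ((c * s / 2) * (c * s / 2)) = c ^ 4 * (s ^ 2 * s ^ 2)"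
    by (simp add: power2_eq_square power4_eq_xxxx)
  also have "1 / (c ^ 4 * (s ^ 2 * s ^ 2)) \<le> 1 / (c ^ 4 * (m ^ 2 * (1 + \<bar>n\<bar>) ^ 2))"
  proof (rule divide_left_mono)
    have "m ^ 2 \<le> s ^ 2" using s(2) power_mono[of "\<bar>m\<bar>" s 2] by simp
    moreover have "(1 + \<bar>n\<bar>) ^ 2 \<le> s ^ 2" using s(3) by (intro power_mono) auto
    ultimately have "m ^ 2 * (1 + \<bar>n\<bar>) ^ 2 \<le> s ^ 2 * s ^ 2" by (intro mult_mono) auto
    thus "c ^ 4 * (m ^ 2 * (1 + \<bar>n\<bar>) ^ 2) \<le> c ^ 4 * (s ^ 2 * s ^ 2)"
      using c by (intro mult_left_mono) auto
    have "0 < m ^ 2" using m by auto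
    thus "0 < c ^ 4 * (s\<^sup>2 * s\<^sup>2) * (c ^ 4 * (m\<^sup>2 * (1 + \<bar>n\<bar>)\<^sup>2))"
      using s c by (intro mult_pos_pos) auto
  qed simp
  finally show ?thesis by (simp add: w_def field_simps)
qed

text \<open>Row m + 1 is taken together with its negative, as the partial fractions in the columns
  require. The row of real lattice points is left out; it would contain the pole.\<close>

definition row_term :: "complex \<Rightarrow> nat \<Rightarrow> int \<Rightarrow> complex" where
  "row_term z m n = eis_term (of_nat (Suc m) * z + of_int n) + eis_term (- of_nat (Suc m) * z + of_int n)"

lemma summable_inverse_square_int: "(\<lambda>n::int. 1 / (1 + \<bar>real_of_int n\<bar>) ^ 2) summable_on UNIV"
proof -
  have nat: "(\<lambda>k. 1 / (1 + real k) ^ 2) summable_on UNIV"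
  proof (subst summable_on_UNIV_nonneg_real_iff)
    have "summable (\<lambda>k. inverse (real (Suc k) ^ 2))"
      using inverse_power_summable[of 2, where 'a = real] by (subst summable_Suc_iff) auto
    thus "summable (\<lambda>k. 1 / (1 + real k) ^ 2)" by (simp add: field_simps)
  qed auto
  have 1: "(\<lambda>n::int. 1 / (1 + \<bar>real_of_int n\<bar>) ^ 2) summable_on {0..}"
  proof (subst summable_on_reindex_bij_witness)
    show "(\<lambda>k. 1 / (1 + real k) ^ 2) summable_on UNIV" by (rule nat)
    show "\<And>a. a \<in> {0..} \<Longrightarrow> int (nat a) = a" by auto
  qed auto
  have 2: "(\<lambda>n::int. 1 / (1 + \<bar>real_of_int n\<bar>) ^ 2) summable_on {..0}"
  proof (subst summable_on_reindex_bij_witness)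
    show "(\<lambda>k. 1 / (1 + real k) ^ 2) summable_on UNIV" by (rule nat)
    show "\<And>a. a \<in> {..0} \<Longrightarrow> - int (nat (- a)) = a" by auto
  qed auto
  have "(\<lambda>n::int. 1 / (1 + \<bar>real_of_int n\<bar>) ^ 2) summable_on ({0..} \<union> {..0})"
    using 1 2 by (rule summable_on_union)
  also have "{0..} \<union> {..0} = (UNIV :: int set)" by auto
  finally show ?thesis .
qed

lemma summable_row_term:
  assumes "Im z > 0"
  shows "(\<lambda>(m, n). row_term z m n) summable_on (UNIV \<times> UNIV)"
proof -
  obtain c where c: "c > 0" "\<And>m r :: real. norm (of_real m * z + of_real r) \<ge> c * (\<bar>m\<bar> + \<bar>r\<bar>)"
    using norm_lattice_lower_bound[OF assms] by blast
  define g where "g = (\<lambda>(m::nat, n::int). 2 / c ^ 4 * (1 / real (Suc m) ^ 2) * (1 / (1 + \<bar>real_of_int n\<bar>) ^ 2))"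
  obtain S where S: "((\<lambda>n::int. 1 / (1 + \<bar>real_of_int n\<bar>) ^ 2) has_sum S) UNIV"
    using summable_inverse_square_int by (auto simp: summable_on_def)
  have g: "g summable_on (UNIV \<times> UNIV)"
  proof (rule summable_on_SigmaI)
    show "((\<lambda>n. g (m, n)) has_sum (2 / c ^ 4 * (1 / real (Suc m) ^ 2) * S)) UNIV" for m
      unfolding g_def prod.case by (intro has_sum_cmult_right S)
    have "summable (\<lambda>k. inverse (real (Suc k) ^ 2))"
      using inverse_power_summable[of 2, where 'a = real] by (subst summable_Suc_iff) auto
    hence "(\<lambda>k. inverse (real (Suc k) ^ 2)) summable_on UNIV"
      by (subst summable_on_UNIV_nonneg_real_iff) auto
    hence "(\<lambda>m. (2 / c ^ 4 * S) * inverse (real (Suc m) ^ 2)) summable_on UNIV"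
      by (intro summable_on_cmult_right)
    thus "(\<lambda>m. 2 / c ^ 4 * (1 / real (Suc m) ^ 2) * S) summable_on UNIV"
      by (simp add: field_simps)
  qed (auto simp: g_def)
  have "norm (row_term z m n) \<le> g (m, n)" for m n
  proof -
    have "norm (eis_term (of_nat (Suc m) * z + of_int n)) \<le> 1 / c ^ 4 * (1 / real (Suc m) ^ 2) * (1 / (1 + \<bar>real_of_int n\<bar>) ^ 2)"
      using eis_term_bound[OF c, of "real (Suc m)" "of_int n"] by simp
    moreover have "norm (eis_term (- of_nat (Suc m) * z + of_int n)) \<le> 1 / c ^ 4 * (1 / real (Suc m) ^ 2) * (1 / (1 + \<bar>real_of_int n\<bar>) ^ 2)"
      using eis_term_bound[OF c, of "- real (Suc m)" "of_int n"] by (simp add: power2_commute[of "-1 - real m"] power2_eq_square algebra_simps)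
    ultimately show ?thesis
      unfolding row_term_def g_def prod.case
      by (intro order.trans[OF norm_triangle_ineq]) (simp add: field_simps)
  qed
  hence "(\<lambda>x. norm (case x of (m, n) \<Rightarrow> row_term z m n)) summable_on (UNIV \<times> UNIV)"
    by (intro Infinite_Sum.abs_summable_on_comparison_test'[OF g]) auto
  thus ?thesis by (rule abs_summable_summable)
qed

section \<open>Row sums and column sums of the regularised lattice series\<close>

lemma tendsto_inverse_linear:
  fixes a :: complex
  assumes "c \<noteq> 0"
  shows "(\<lambda>N. 1 / (a + c * of_nat N)) \<longlonglongrightarrow> 0"
proof -
  have "filterlim (\<lambda>N. c * of_nat N) at_infinity sequentially"
    by (rule tendsto_mult_filterlim_at_infinity[OF tendsto_const assms tendsto_of_nat])
  hence "filterlim (\<lambda>N. a + c * of_nat N) at_infinity sequentially"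
    by (rule tendsto_add_filterlim_at_infinity[OF tendsto_const])
  thus ?thesis using filterlim_compose[OF tendsto_inverse_0] by (fastforce simp: divide_inverse)
qed

lemma sum_symmetric_telescope:
  fixes g :: "int \<Rightarrow> 'a :: ab_group_add"
  shows "(\<Sum>n\<in>{- int N..int N}. g n - g (n + 1)) = g (- int N) - g (int N + 1)"
proof (induction N)
  case (Suc N)
  have "{- int (Suc N)..int (Suc N)} = insert (- int (Suc N)) (insert (int (Suc N)) {- int N..int N})"
    by auto
  then show ?case using Suc by (simp add: algebra_simps)
qed simp

lemma sum_symmetric_int:
  fixes f :: "int \<Rightarrow> 'a :: ab_group_add"
  shows "(\<Sum>n\<in>{- int N..int N}. f n) = f 0 + (\<Sum>k<N. f (int (Suc k)) + f (- int (Suc k)))"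
proof (induction N)
  case (Suc N)
  have "{- int (Suc N)..int (Suc N)} = insert (- int (Suc N)) (insert (int (Suc N)) {- int N..int N})"
    by auto
  then show ?case using Suc by (simp add: algebra_simps)
qed simp

lemma not_Ints_if_Im: "Im w \<noteq> 0 \<Longrightarrow> w \<notin> \<int>"
  by (auto elim!: Ints_cases)

lemma eis_term_alt:
  assumes "Im w \<noteq> 0"
  shows "eis_term w = 1 / w ^ 2 - (1 / (w - 1/2) - 1 / (w + 1/2))"
proof -
  have nz: "w - 1/2 \<noteq> 0" "w + 1/2 \<noteq> 0" using assms by (auto simp: complex_eq_iff)
  have "w ^ 2 - 1 / 4 = (w - 1/2) * (w + 1/2)" by (simp add: power2_eq_square algebra_simps)
  hence "1 / (w ^ 2 - 1 / 4) = 1 / (w - 1/2) - 1 / (w + 1/2)"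
    by (simp add: diff_frac_eq[OF nz])
  thus ?thesis by (simp add: eis_term_def)
qed

text \<open>Along a row the subtracted terms telescope and both ends tend to 0, so the
  regularisation does not change the sum of inverse squares.\<close>

lemma has_sum_eis_term_row:
  assumes "Im w > 0"
  shows "((\<lambda>n::int. eis_term (w + of_int n)) has_sum (of_real pi ^ 2 / sin (of_real pi * w) ^ 2)) UNIV"
proof -
  obtain c where c: "c > 0" "\<And>m r :: real. norm (of_real m * w + of_real r) \<ge> c * (\<bar>m\<bar> + \<bar>r\<bar>)"
    using norm_lattice_lower_bound[OF assms] by blast
  have "(\<lambda>n::int. 1 / c ^ 4 * (1 / (1 + \<bar>real_of_int n\<bar>) ^ 2)) summable_on UNIV"
    by (intro summable_on_cmult_right summable_inverse_square_int)
  hence "(\<lambda>n::int. norm (eis_term (w + of_int n))) summable_on UNIV"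
  proof (rule Infinite_Sum.abs_summable_on_comparison_test')
    show "norm (eis_term (w + of_int n)) \<le> 1 / c ^ 4 * (1 / (1 + \<bar>real_of_int n\<bar>) ^ 2)" for n
      using eis_term_bound[OF c, of 1 "of_int n"] by simp
  qed
  hence "(\<lambda>n::int. eis_term (w + of_int n)) summable_on UNIV"
    by (rule abs_summable_summable)
  then obtain S where S: "((\<lambda>n::int. eis_term (w + of_int n)) has_sum S) UNIV"
    by (auto simp: summable_on_def)
  define R where "R = of_real pi ^ 2 / sin (of_real pi * w) ^ 2"
  have R: "((\<lambda>n::int. 1 / (w + of_int n) ^ 2) has_sum R) UNIV"
    unfolding R_def using assms by (intro has_sum_inverse_squares_int not_Ints_if_Im) auto
  define g where "g = (\<lambda>n::int. 1 / (w + of_int n - 1/2))"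
  have "((\<lambda>n::int. 1 / (w + of_int n) ^ 2 + - eis_term (w + of_int n)) has_sum (R + - S)) UNIV"
    by (intro has_sum_add R has_sum_uminusI S)
  also have "(\<lambda>n::int. 1 / (w + of_int n) ^ 2 + - eis_term (w + of_int n)) = (\<lambda>n. g n - g (n + 1))"
    using assms by (auto simp: eis_term_alt g_def algebra_simps)
  finally have "(\<lambda>N. \<Sum>n\<in>{- int N..int N}. g n - g (n + 1)) \<longlonglongrightarrow> R + - S"
    by (rule has_sum_int_imp_symmetric_limit)
  moreover have "(\<lambda>N. \<Sum>n\<in>{- int N..int N}. g n - g (n + 1)) \<longlonglongrightarrow> 0 - 0"
    unfolding sum_symmetric_telescope
  proof (rule tendsto_diff)
    show "(\<lambda>N. g (- int N)) \<longlonglongrightarrow> 0"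
      using tendsto_inverse_linear[of "-1" "w - 1/2"] by (simp add: g_def algebra_simps)
    show "(\<lambda>N. g (int N + 1)) \<longlonglongrightarrow> 0"
      using tendsto_inverse_linear[of 1 "w + 1/2"] by (simp add: g_def algebra_simps)
  qed
  ultimately have "R + - S = 0 - 0" by (rule LIMSEQ_unique)
  thus ?thesis using S by (simp add: R_def)
qed

lemma has_sum_row_term_row:
  assumes "Im z > 0"
  shows "((\<lambda>n. row_term z m n) has_sum (2 * of_real pi ^ 2 * (1 / sin (of_real pi * (of_nat (Suc m) * z)) ^ 2))) UNIV"
proof -
  define w where "w = of_nat (Suc m) * z"
  define R where "R = of_real pi ^ 2 / sin (of_real pi * w) ^ 2"
  have w: "Im w > 0" using assms by (simp add: w_def add_pos_nonneg)
  have 1: "((\<lambda>n::int. eis_term (w + of_int n)) has_sum R) UNIV"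
    unfolding R_def by (rule has_sum_eis_term_row[OF w])
  have "((\<lambda>n::int. eis_term (- w + of_int n)) has_sum R) UNIV"
  proof (subst has_sum_reindex_bij_witness[where i = uminus and j = uminus])
    show "((\<lambda>n::int. eis_term (w + of_int n)) has_sum R) UNIV" by (rule 1)
    show "eis_term (w + of_int (- a)) = eis_term (- w + of_int a)" for a :: int
      using eis_term_minus[of "- w + of_int a"] by simp
  qed auto
  from has_sum_add[OF 1 this] show ?thesis
    by (simp add: row_term_def w_def R_def del: of_nat_Suc)
qed

lemma inverse_scale: "1 / c * (1 / a + 1 / b) = 1 / (c * a) + 1 / (c * b :: 'a :: field)"
  by (simp add: distrib_left)

text \<open>The closed form of the sum of 1 / (x + m z) over nonzero integers m, with m and -m
  paired.\<close>

definition cot_rest :: "complex \<Rightarrow> complex \<Rightarrow> complex" where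
  "cot_rest z x = of_real pi / z * cot (of_real pi * (x / z)) - 1 / x"

lemma Im_divide_real_neq_0:
  assumes "Im z > 0" "x \<noteq> 0"
  shows "Im (of_real x / z) \<noteq> 0"
  using assms by (auto simp: Im_divide complex_eq_iff sum_power2_eq_zero_iff)

lemma cot_rest_sums:
  assumes "Im z > 0" "x \<noteq> 0"
  shows "(\<lambda>m. 1 / (of_real x + of_nat (Suc m) * z) + 1 / (of_real x - of_nat (Suc m) * z)) sums cot_rest z (of_real x)"
proof -
  have z: "z \<noteq> 0" using assms by auto
  have "of_real x / z \<notin> \<int>" using Im_divide_real_neq_0[OF assms] by (rule not_Ints_if_Im)
  from sums_mult[OF cot_partial_fractions[OF this], of "1 / z"]
  have "(\<lambda>m. 1 / z * (1 / (of_real x / z + of_nat (Suc m)) + 1 / (of_real x / z - of_nat (Suc m)))) sums cot_rest z (of_real x)"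
    using z assms by (simp add: cot_rest_def algebra_simps)
  also have "(\<lambda>m. 1 / z * (1 / (of_real x / z + of_nat (Suc m)) + 1 / (of_real x / z - of_nat (Suc m))))
     = (\<lambda>m. 1 / (of_real x + of_nat (Suc m) * z) + 1 / (of_real x - of_nat (Suc m) * z))"
  proof
    fix m
    have *: "z * (of_real x / z + of_nat (Suc m)) = of_real x + of_nat (Suc m) * z"
         "z * (of_real x / z - of_nat (Suc m)) = of_real x - of_nat (Suc m) * z"
      using z by (auto simp: field_simps)
    show "1 / z * (1 / (of_real x / z + of_nat (Suc m)) + 1 / (of_real x / z - of_nat (Suc m)))
      = 1 / (of_real x + of_nat (Suc m) * z) + 1 / (of_real x - of_nat (Suc m) * z)"
      by (simp only: *[symmetric] inverse_scale)
  qed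
  finally show ?thesis .
qed

lemma cot_rest_minus: "cot_rest z (- x) = - cot_rest z x"
  by (simp add: cot_rest_def cot_def)

text \<open>The closed form of the sum of 1 / (n + m z)^2 over nonzero integers m. For n = 0 this is
  2 zeta(2) / z^2; otherwise the term m = 0 has to be removed from the full sum.\<close>

definition column_squares :: "complex \<Rightarrow> int \<Rightarrow> complex" where
  "column_squares z n = (if n = 0 then of_real pi ^ 2 / (3 * z ^ 2)
     else of_real pi ^ 2 / (z ^ 2 * sin (of_real pi * (of_int n / z)) ^ 2) - 1 / of_int n ^ 2)"

lemma column_squares_minus: "column_squares z (- n) = column_squares z n"
  by (simp add: column_squares_def)

lemma column_squares_sums:
  assumes "Im z > 0"
  shows "(\<lambda>m. 1 / (of_int n + of_nat (Suc m) * z) ^ 2 + 1 / (of_int n - of_nat (Suc m) * z) ^ 2) sums column_squares z n"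
proof (cases "n = 0")
  case True
  have "(\<lambda>n. of_real (1 / (real n + 1) ^ 2) :: complex) sums of_real (pi ^ 2 / 6)"
    unfolding sums_of_real_iff using inverse_squares_sums by (simp add: add.commute)
  from sums_mult[OF this, of "2 / z ^ 2"]
  have "(\<lambda>m. 2 / z ^ 2 * of_real (1 / (real m + 1) ^ 2)) sums column_squares z n"
    using True by (simp add: column_squares_def)
  also have "(\<lambda>m. 2 / z ^ 2 * of_real (1 / (real m + 1) ^ 2)) =
     (\<lambda>m. 1 / (of_int n + of_nat (Suc m) * z) ^ 2 + 1 / (of_int n - of_nat (Suc m) * z) ^ 2)"
    using True by (auto simp: fun_eq_iff power_mult_distrib add.commute simp del: of_nat_Suc) (simp add: add.commute)
  finally show ?thesis .
next
  case False
  have z: "z \<noteq> 0" using assms by auto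
  define f where "f = (\<lambda>k::int. 1 / (of_int n / z + of_int k) ^ 2)"
  define S where "S = of_real pi ^ 2 / sin (of_real pi * (of_int n / z)) ^ 2"
  have "of_int n / z \<notin> \<int>" using Im_divide_real_neq_0[OF assms, of "of_int n"] False by (intro not_Ints_if_Im) auto
  hence "(f has_sum S) UNIV"
    unfolding f_def S_def by (rule has_sum_inverse_squares_int)
  hence "(\<lambda>N. f 0 + (\<Sum>k<N. f (int (Suc k)) + f (- int (Suc k)))) \<longlonglongrightarrow> S"
    using has_sum_int_imp_symmetric_limit by (fastforce simp: sum_symmetric_int)
  hence "(\<lambda>k. f (int (Suc k)) + f (- int (Suc k))) sums (S - f 0)"
    unfolding sums_def using tendsto_diff[OF _ tendsto_const[of "f 0"]] by fastforce
  from sums_mult[OF this, of "1 / z ^ 2"]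
  have "(\<lambda>k. 1 / z ^ 2 * (f (int (Suc k)) + f (- int (Suc k)))) sums (1 / z ^ 2 * (S - f 0))" .
  also have "1 / z ^ 2 * (S - f 0) = column_squares z n"
    using False z by (simp add: S_def f_def column_squares_def power_divide right_diff_distrib)
  also have "(\<lambda>k. 1 / z ^ 2 * (f (int (Suc k)) + f (- int (Suc k))))
      = (\<lambda>m. 1 / (of_int n + of_nat (Suc m) * z) ^ 2 + 1 / (of_int n - of_nat (Suc m) * z) ^ 2)"
  proof
    fix m
    have "z * (of_int n / z + of_int (int (Suc m))) = of_int n + of_nat (Suc m) * z"
         "z * (of_int n / z + of_int (- int (Suc m))) = of_int n - of_nat (Suc m) * z"
      using z by (auto simp: field_simps)
    hence *: "z ^ 2 * (of_int n / z + of_int (int (Suc m))) ^ 2 = (of_int n + of_nat (Suc m) * z) ^ 2"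
         "z ^ 2 * (of_int n / z + of_int (- int (Suc m))) ^ 2 = (of_int n - of_nat (Suc m) * z) ^ 2"
      by (metis power_mult_distrib)+
    show "1 / z ^ 2 * (f (int (Suc m)) + f (- int (Suc m)))
       = 1 / (of_int n + of_nat (Suc m) * z) ^ 2 + 1 / (of_int n - of_nat (Suc m) * z) ^ 2"
      unfolding f_def by (simp only: *[symmetric] inverse_scale)
  qed
  finally show ?thesis .
qed

lemma row_term_column_sums:
  assumes "Im z > 0"
  shows "(\<lambda>m. row_term z m n) sums (column_squares z n
           - (cot_rest z (of_int n - 1/2) - cot_rest z (of_int n + 1/2)))"
proof -
  define a where "a = (\<lambda>m. 1 / (of_int n + of_nat (Suc m) * z) ^ 2 + 1 / (of_int n - of_nat (Suc m) * z) ^ 2)"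
  define k where "k = (\<lambda>(x::real) m. 1 / (of_real x + of_nat (Suc m) * z) + 1 / (of_real x - of_nat (Suc m) * z))"
  have nz: "real_of_int n - 1/2 \<noteq> 0" "real_of_int n + 1/2 \<noteq> 0"
  proof -
    have "2 * n \<noteq> 1" "2 * n \<noteq> -1" by presburger+
    hence "real_of_int (2 * n) \<noteq> 1" "real_of_int (2 * n) \<noteq> - 1" by linarith+
    thus "real_of_int n - 1/2 \<noteq> 0" "real_of_int n + 1/2 \<noteq> 0" by auto
  qed
  have "(\<lambda>m. a m - (k (of_int n - 1/2) m - k (of_int n + 1/2) m)) sums (column_squares z n
           - (cot_rest z (of_real (of_int n - 1/2)) - cot_rest z (of_real (of_int n + 1/2))))"
    unfolding a_def k_def by (intro sums_diff column_squares_sums cot_rest_sums assms nz)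
  also have "(\<lambda>m. a m - (k (of_int n - 1/2) m - k (of_int n + 1/2) m)) = (\<lambda>m. row_term z m n)"
  proof
    fix m
    have im: "Im (of_nat (Suc m) * z + of_int n) \<noteq> 0" "Im (- of_nat (Suc m) * z + of_int n) \<noteq> 0"
      using assms by auto
    show "a m - (k (of_int n - 1/2) m - k (of_int n + 1/2) m) = row_term z m n"
      unfolding row_term_def eis_term_alt[OF im(1)] eis_term_alt[OF im(2)] a_def k_def
      by (simp add: algebra_simps)
  qed
  finally show ?thesis by simp
qed

text \<open>Written with e = exp (i x), the cotangent of x is i (1 + e^-2) / (1 - e^-2), and here e
  grows without bound.\<close>

lemma cot_tendsto_i:
  assumes "Im u < 0"
  shows "(\<lambda>N. cot (u * of_nat N + v)) \<longlonglongrightarrow> \<i>"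
proof -
  define a where "a N = exp (\<i> * (u * of_nat N + v))" for N
  have "filterlim (\<lambda>N. norm (a N)) at_top sequentially"
  proof -
    have "(\<lambda>N. norm (a N)) = (\<lambda>N. exp (- Im u * real N - Im v))"
      by (simp add: a_def fun_eq_iff)
    moreover have "filterlim (\<lambda>N. exp (- Im u * real N - Im v)) at_top sequentially"
      using assms by real_asymp
    ultimately show ?thesis by simp
  qed
  hence "filterlim a at_infinity sequentially"
    by (simp add: filterlim_at_infinity_conv_norm_at_top)
  hence "(\<lambda>N. inverse (a N)) \<longlonglongrightarrow> 0"
    by (rule filterlim_compose[OF tendsto_inverse_0])
  hence "(\<lambda>N. \<i> * ((1 + inverse (a N) * inverse (a N)) / (1 - inverse (a N) * inverse (a N)))) \<longlonglongrightarrow> \<i> * ((1 + 0 * 0) / (1 - 0 * 0))"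
    by (intro tendsto_intros) auto
  moreover have "cot (u * of_nat N + v) = \<i> * ((1 + inverse (a N) * inverse (a N)) / (1 - inverse (a N) * inverse (a N)))" for N
  proof -
    define e where "e = a N"
    have e: "e \<noteq> 0" by (simp add: e_def a_def)
    have "cot (u * of_nat N + v) = ((e + inverse e) / 2) / ((e - inverse e) / (2 * \<i>))"
      unfolding cot_def cos_exp_eq sin_exp_eq by (simp add: e_def a_def exp_minus)
    also have "\<dots> = \<i> * ((e + inverse e) / (e - inverse e))"
      by (cases "e - inverse e = 0") (auto simp: divide_simps)
    also have "(e + inverse e) / (e - inverse e) = (inverse e * (e + inverse e)) / (inverse e * (e - inverse e))"
      using e by (subst mult_divide_mult_cancel_left) auto
    also have "\<dots> = (1 + inverse e * inverse e) / (1 - inverse e * inverse e)"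
      using e by (simp add: distrib_left right_diff_distrib)
    finally show ?thesis by (simp add: e_def)
  qed
  ultimately show ?thesis by simp
qed

lemma cot_rest_tendsto:
  assumes "Im z > 0"
  shows "(\<lambda>N. cot_rest z (of_nat N + 1/2)) \<longlonglongrightarrow> of_real pi / z * \<i>"
proof -
  have "Im (of_real pi / z) < 0"
    using assms by (auto simp: Im_divide sum_power2_gt_zero_iff divide_neg_pos complex_eq_iff)
  from cot_tendsto_i[OF this, of "of_real pi / z / 2"]
  have "(\<lambda>N. cot (of_real pi * ((of_nat N + 1/2) / z))) \<longlonglongrightarrow> \<i>"
    by (simp add: algebra_simps add_divide_distrib)
  moreover have "(\<lambda>N. 1 / (of_nat N + 1/2 :: complex)) \<longlonglongrightarrow> 0"
    using tendsto_inverse_linear[of 1 "1/2"] by (simp add: add.commute)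
  ultimately have "(\<lambda>N. of_real pi / z * cot (of_real pi * ((of_nat N + 1/2) / z)) - 1 / (of_nat N + 1/2)) \<longlonglongrightarrow> of_real pi / z * \<i> - 0"
    by (intro tendsto_intros)
  thus ?thesis by (simp add: cot_rest_def)
qed

section \<open>Exchange of the two orders of summation\<close>

definition sin_sum :: "complex \<Rightarrow> complex" where
  "sin_sum z = (\<Sum>m. 1 / sin (of_real pi * (of_nat (Suc m) * z)) ^ 2)"

lemma sin_sum_has_sum_rows:
  assumes "Im z > 0"
  shows "((\<lambda>(m, n). row_term z m n) has_sum (2 * of_real pi ^ 2 * sin_sum z)) (UNIV \<times> UNIV)"
    and "(\<lambda>m. 1 / sin (of_real pi * (of_nat (Suc m) * z)) ^ 2) sums sin_sum z"
proof -
  obtain S where S: "((\<lambda>(m, n). row_term z m n) has_sum S) (UNIV \<times> UNIV)"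
    using summable_row_term[OF assms] by (auto simp: summable_on_def)
  have "((\<lambda>m. 2 * of_real pi ^ 2 * (1 / sin (of_real pi * (of_nat (Suc m) * z)) ^ 2)) has_sum S) UNIV"
    by (rule has_sum_SigmaD[OF S]) (use has_sum_row_term_row[OF assms] in simp)
  from sums_mult[OF has_sum_imp_sums[OF this], of "1 / (2 * of_real pi ^ 2)"]
  have 1: "(\<lambda>m. 1 / sin (of_real pi * (of_nat (Suc m) * z)) ^ 2) sums (S / (2 * of_real pi ^ 2))"
    by simp
  hence 2: "sin_sum z = S / (2 * of_real pi ^ 2)"
    unfolding sin_sum_def by (rule sums_unique[symmetric])
  show "(\<lambda>m. 1 / sin (of_real pi * (of_nat (Suc m) * z)) ^ 2) sums sin_sum z" using 1 2 by simp
  show "((\<lambda>(m, n). row_term z m n) has_sum (2 * of_real pi ^ 2 * sin_sum z)) (UNIV \<times> UNIV)"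
    using S 2 by simp
qed

lemma Im_minus_inverse_pos: "Im z > 0 \<Longrightarrow> Im (- 1 / z) > 0"
  by (auto simp: Im_divide complex_eq_iff sum_power2_gt_zero_iff)

text \<open>One absolutely convergent double series is summed by rows and by columns. The
  regularising terms contribute nothing to the rows, but along the columns they leave differences of
  \<open>cot_rest\<close> at half-integers. These telescope in n; since \<open>cot_rest\<close> is
  odd the two ends add up, and in the limit they give 2 pi i / z, the failure of modularity in
  weight two.\<close>

lemma sin_sum_inversion:
  assumes "Im z > 0"
  shows "2 * of_real pi ^ 2 * sin_sum z = 2 * of_real pi ^ 2 / z ^ 2 * sin_sum (- 1 / z)
     - of_real pi ^ 2 / 3 + of_real pi ^ 2 / (3 * z ^ 2) + 2 * of_real pi * \<i> / z"
proof -
  have z: "z \<noteq> 0" using assms by auto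
  define S where "S = 2 * of_real pi ^ 2 * sin_sum z"
  define col where "col = (\<lambda>n. column_squares z n - (cot_rest z (of_int n - 1/2) - cot_rest z (of_int n + 1/2)))"
  have "((\<lambda>(n, m). row_term z m n) has_sum S) (UNIV \<times> UNIV)"
    using sin_sum_has_sum_rows(1)[OF assms] unfolding S_def
    by (subst (asm) has_sum_swap) (simp add: case_prod_unfold)
  moreover have "((\<lambda>m. case (n, m) of (n, m) \<Rightarrow> row_term z m n) has_sum col n) UNIV" for n :: int
  proof -
    have "(\<lambda>(n, m). row_term z m n) summable_on (UNIV \<times> UNIV)"
      using calculation by (auto simp: summable_on_def)
    from summable_on_SigmaD1[OF this, of n] obtain T where T: "((\<lambda>m. row_term z m n) has_sum T) UNIV"
      by (auto simp: summable_on_def)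
    with row_term_column_sums[OF assms, of n] have "T = col n"
      unfolding col_def by (intro sums_unique2[OF has_sum_imp_sums])
    with T show ?thesis by simp
  qed
  ultimately have "(col has_sum S) UNIV"
    by (rule has_sum_SigmaD)
  hence "(\<lambda>N. \<Sum>n\<in>{- int N..int N}. col n) \<longlonglongrightarrow> S"
    by (rule has_sum_int_imp_symmetric_limit)
  also have "(\<lambda>N. \<Sum>n\<in>{- int N..int N}. col n) =
     (\<lambda>N. column_squares z 0 + (\<Sum>k<N. 2 * column_squares z (int (Suc k))) + 2 * cot_rest z (of_nat N + 1/2))"
  proof
    fix N
    define g where "g = (\<lambda>n::int. cot_rest z (of_int n - 1/2))"
    have "col n = column_squares z n - (g n - g (n + 1))" for n
      by (simp add: col_def g_def algebra_simps)
    hence "(\<Sum>n\<in>{- int N..int N}. col n) = (\<Sum>n\<in>{- int N..int N}. column_squares z n)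
        - (\<Sum>n\<in>{- int N..int N}. g n - g (n + 1))"
      by (simp only: sum_subtractf)
    also note sum_symmetric_telescope
    also have "g (- int N) - g (int N + 1) = - 2 * cot_rest z (of_nat N + 1/2)"
      using cot_rest_minus[of z "of_nat N + 1/2"] by (simp add: g_def algebra_simps)
    also have "(\<Sum>n\<in>{- int N..int N}. column_squares z n) = column_squares z 0 + (\<Sum>k<N. 2 * column_squares z (int (Suc k)))"
      by (subst sum_symmetric_int) (simp add: column_squares_minus del: of_nat_Suc)
    finally show "(\<Sum>n\<in>{- int N..int N}. col n) =
       column_squares z 0 + (\<Sum>k<N. 2 * column_squares z (int (Suc k))) + 2 * cot_rest z (of_nat N + 1/2)"
      by simp
  qed
  finally have "(\<lambda>N. (column_squares z 0 + (\<Sum>k<N. 2 * column_squares z (int (Suc k))) + 2 * cot_rest z (of_nat N + 1/2))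
       - column_squares z 0 - 2 * cot_rest z (of_nat N + 1/2)) \<longlonglongrightarrow> S - column_squares z 0 - 2 * (of_real pi / z * \<i>)"
    by (intro tendsto_diff tendsto_mult tendsto_const cot_rest_tendsto assms)
  hence 1: "(\<lambda>k. 2 * column_squares z (int (Suc k))) sums (S - column_squares z 0 - 2 * (of_real pi / z * \<i>))"
    unfolding sums_def by simp
  \<comment> \<open>Adding 2 zeta(2) cancels the terms - 1 / n^2 in the columns; what remains is the
    series \<open>sin_sum\<close> at - 1 / z up to a factor.\<close>
  have 2: "(\<lambda>k. 2 * (1 / of_nat (Suc k) ^ 2) :: complex) sums (2 * of_real (pi ^ 2 / 6))"
  proof (rule sums_mult)
    have "(\<lambda>n. of_real (1 / (real n + 1) ^ 2) :: complex) sums of_real (pi ^ 2 / 6)"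
      unfolding sums_of_real_iff using inverse_squares_sums by (simp add: add.commute)
    thus "(\<lambda>k. 1 / of_nat (Suc k) ^ 2 :: complex) sums of_real (pi ^ 2 / 6)" by (simp add: add.commute)
  qed
  have 3: "(\<lambda>k. 2 * column_squares z (int (Suc k)) + 2 * (1 / of_nat (Suc k) ^ 2)) sums
      (S - column_squares z 0 - 2 * (of_real pi / z * \<i>) + 2 * of_real (pi ^ 2 / 6))"
    by (rule sums_add[OF 1 2])
  also have "(\<lambda>k. 2 * column_squares z (int (Suc k)) + 2 * (1 / of_nat (Suc k) ^ 2)) =
     (\<lambda>k. 2 * of_real pi ^ 2 / z ^ 2 * (1 / sin (of_real pi * (of_nat (Suc k) * (- 1 / z))) ^ 2))"
  proof
    fix k
    have "sin (of_real pi * (of_nat (Suc k) * (- 1 / z))) = - sin (of_real pi * (of_int (int (Suc k)) / z))"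
      by simp
    thus "2 * column_squares z (int (Suc k)) + 2 * (1 / of_nat (Suc k) ^ 2) =
      2 * of_real pi ^ 2 / z ^ 2 * (1 / sin (of_real pi * (of_nat (Suc k) * (- 1 / z))) ^ 2)"
      by (simp add: column_squares_def del: of_nat_Suc)
  qed
  finally have "S - column_squares z 0 - 2 * (of_real pi / z * \<i>) + 2 * of_real (pi ^ 2 / 6)
      = 2 * of_real pi ^ 2 / z ^ 2 * sin_sum (- 1 / z)"
    using sums_mult[OF sin_sum_has_sum_rows(2)[OF Im_minus_inverse_pos[OF assms]], of "2 * of_real pi ^ 2 / z ^ 2"]
    by (rule sums_unique2)
  thus ?thesis by (simp add: S_def column_squares_def algebra_simps)
qed

section \<open>The Lambert series of the divisor sum\<close>

lemma sigmak_1_le: "sigmak 1 n \<le> n ^ 2"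
proof (cases "n = 0")
  case False
  have "(\<Sum>d | d dvd n. d) \<le> (\<Sum>d\<in>{1..n}. d)"
    using False by (intro sum_mono2) (auto simp: dvd_imp_le Suc_le_eq intro: Nat.gr0I)
  also have "\<dots> \<le> (\<Sum>d\<in>{1..n}. n)" by (intro sum_mono) auto
  finally show ?thesis using False by (simp add: sigmak_def power2_eq_square)
qed (simp add: sigmak_def)

lemma summable_square_power:
  fixes x :: real
  assumes "\<bar>x\<bar> < 1"
  shows "summable (\<lambda>n. real n ^ 2 * \<bar>x\<bar> ^ n)"
proof -
  have 1: "summable (\<lambda>n. diffs (\<lambda>n. 1) n * y ^ n)" if "norm y < 1" for y :: real
    by (rule termdiff_converges[where K = 1]) (use that summable_geometric in auto)
  have 2: "summable (\<lambda>n. diffs (diffs (\<lambda>n. 1)) n * \<bar>x\<bar> ^ n)"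
    by (rule termdiff_converges[where K = 1]) (use assms 1 in auto)
  show ?thesis
  proof (rule summable_comparison_test[OF _ 2])
    have "real n ^ 2 \<le> diffs (diffs (\<lambda>n. 1)) n" for n
      by (simp add: diffs_def power2_eq_square algebra_simps)
    hence "norm (real n ^ 2 * \<bar>x\<bar> ^ n) \<le> diffs (diffs (\<lambda>n. 1)) n * \<bar>x\<bar> ^ n" for n
      by (auto simp: norm_mult intro!: mult_right_mono)
    thus "\<exists>N. \<forall>n\<ge>N. norm (real n ^ 2 * \<bar>x\<bar> ^ n) \<le> diffs (diffs (\<lambda>n. 1)) n * \<bar>x\<bar> ^ n" by blast
  qed
qed

lemma summable_norm_sigma:
  fixes Q :: complex
  assumes "norm Q < 1"
  shows "summable (\<lambda>n. norm (of_nat (sigmak 1 n) * Q ^ n))"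
proof (rule summable_comparison_test)
  show "summable (\<lambda>n. real n ^ 2 * norm Q ^ n)" using summable_square_power[of "norm Q"] assms by simp
  have "norm (norm (of_nat (sigmak 1 n) * Q ^ n)) \<le> real n ^ 2 * norm Q ^ n" for n
    using of_nat_mono[OF sigmak_1_le[of n], where 'a = real]
    by (auto simp: norm_mult norm_power intro!: mult_right_mono simp del: One_nat_def)
  thus "\<exists>N. \<forall>n\<ge>N. norm (norm (of_nat (sigmak 1 n) * Q ^ n)) \<le> real n ^ 2 * norm Q ^ n" by blast
qed

text \<open>Both sides are the sum of d Q^n over all n > 0 and d dividing n. Writing n as a product
  of d and a second factor and fixing that factor leaves the derivative of a geometric series.
  Absolute convergence comes from the same double sum at \<open>norm Q\<close>.\<close>

lemma lambert_series_sigma: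
  fixes Q :: complex
  assumes Q: "norm Q < 1"
  shows "(\<lambda>m. Q ^ Suc m / (1 - Q ^ Suc m) ^ 2) sums (\<Sum>n. of_nat (sigmak 1 n) * Q ^ n)"
proof -
  define D where "D = (SIGMA n:{0::nat<..}. {d. d dvd n})"
  define f where "f = (\<lambda>(n::nat, d::nat). of_nat d * Q ^ n)"
  define h where "h = (\<lambda>(n::nat, d::nat). real d * norm Q ^ n)"
  have norm_eq: "norm (of_nat (sigmak 1 n) * Q ^ n) = real (sigmak 1 n) * norm Q ^ n" for n
    by (simp add: norm_mult norm_power)
  have rows: "((\<lambda>d. h (n, d)) has_sum (norm (of_nat (sigmak 1 n) * Q ^ n))) {d. d dvd n}"
    "((\<lambda>d. f (n, d)) has_sum (of_nat (sigmak 1 n) * Q ^ n)) {d. d dvd n}" if "n > 0" for n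
    using that unfolding norm_eq by (auto intro!: has_sum_finiteI simp: h_def f_def sigmak_def sum_distrib_right)
  have "(\<lambda>n. norm (of_nat (sigmak 1 n) * Q ^ n)) summable_on UNIV"
    by (subst summable_on_UNIV_nonneg_real_iff) (use summable_norm_sigma[OF Q] in auto)
  hence "(\<lambda>n. norm (of_nat (sigmak 1 n) * Q ^ n)) summable_on {0<..}"
    by (rule summable_on_subset) auto
  hence "h summable_on D"
    unfolding D_def by (intro summable_on_SigmaI[OF rows(1)]) (auto simp: h_def)
  hence "(\<lambda>x. norm (f x)) summable_on D"
    by (rule summable_on_cong[THEN iffD1, rotated]) (auto simp: f_def h_def norm_mult norm_power)
  hence summ: "f summable_on D" by (rule abs_summable_summable)
  have "(\<lambda>n. of_nat (sigmak 1 n) * Q ^ n) sums (\<Sum>n. of_nat (sigmak 1 n) * Q ^ n)"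
    using summable_norm_sigma[OF Q] by (intro summable_sums) (rule summable_norm_cancel)
  hence "((\<lambda>n. of_nat (sigmak 1 n) * Q ^ n) has_sum (\<Sum>n. of_nat (sigmak 1 n) * Q ^ n)) UNIV"
    by (intro norm_summable_imp_has_sum summable_norm_sigma Q)
  also have "?this \<longleftrightarrow> ((\<lambda>n. of_nat (sigmak 1 n) * Q ^ n) has_sum (\<Sum>n. of_nat (sigmak 1 n) * Q ^ n)) {0<..}"
    by (rule has_sum_cong_neutral) (auto simp: sigmak_def)
  finally have "(f has_sum (\<Sum>n. of_nat (sigmak 1 n) * Q ^ n)) D"
    unfolding D_def using summ rows(2) by (intro has_sum_SigmaI) (auto simp: D_def)
  also have "?this \<longleftrightarrow> ((\<lambda>(m, d). of_nat (Suc d) * Q ^ (Suc m * Suc d)) has_sum (\<Sum>n. of_nat (sigmak 1 n) * Q ^ n)) (UNIV \<times> UNIV)"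
  proof (rule has_sum_reindex_bij_witness[where i = "\<lambda>(m, d). (Suc m * Suc d, Suc d)" and j = "\<lambda>(n, d). (n div d - 1, d - 1)"], goal_cases)
    case (1 a)
    then obtain n d where a: "a = (n, d)" "n > 0" "d dvd n" by (auto simp: D_def)
    then obtain k where k: "n = d * k" by auto
    from a k have "d > 0" "k > 0" by auto
    thus ?case using a k by (auto simp del: mult_Suc mult_Suc_right)
  next
    case (5 a)
    then obtain n d where a: "a = (n, d)" "n > 0" "d dvd n" by (auto simp: D_def)
    then obtain k where k: "n = d * k" by auto
    from a k have "d > 0" "k > 0" by auto
    thus ?case using a k by (auto simp: f_def mult.commute simp del: mult_Suc mult_Suc_right)
  qed (auto simp: D_def simp del: mult_Suc mult_Suc_right)
  finally have *: "((\<lambda>(m, d). of_nat (Suc d) * Q ^ (Suc m * Suc d)) has_sum (\<Sum>n. of_nat (sigmak 1 n) * Q ^ n)) (UNIV \<times> UNIV)" .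
  have "((\<lambda>m. Q ^ Suc m / (1 - Q ^ Suc m) ^ 2) has_sum (\<Sum>n. of_nat (sigmak 1 n) * Q ^ n)) UNIV"
  proof (rule has_sum_SigmaD[OF *])
    fix m
    define x where "x = Q ^ Suc m"
    have x: "norm x < 1" using power_Suc_less_one[of "norm Q" m] Q by (cases "Q = 0") (auto simp: x_def norm_power norm_mult)
    have "(\<lambda>d. x * (of_nat (Suc d) * x ^ d)) sums (x * (1 / (1 - x) ^ 2))"
      by (intro sums_mult geometric_deriv_sums x)
    moreover have "summable (\<lambda>d. norm (x * (of_nat (Suc d) * x ^ d)))"
      using sums_summable[OF geometric_deriv_sums[of "norm x"]] x
      by (auto simp: norm_mult norm_power intro!: summable_mult simp del: of_nat_Suc)
    ultimately have "((\<lambda>d. x * (of_nat (Suc d) * x ^ d)) has_sum (x * (1 / (1 - x) ^ 2))) UNIV"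
      by (intro norm_summable_imp_has_sum)
    thus "((\<lambda>d. case (m, d) of (m, d) \<Rightarrow> of_nat (Suc d) * Q ^ (Suc m * Suc d)) has_sum Q ^ Suc m / (1 - Q ^ Suc m) ^ 2) UNIV"
    proof -
      have "Q ^ (Suc m * Suc d) = x * x ^ d" for d
        unfolding x_def power_mult by (rule power_Suc)
      hence "(\<lambda>d. of_nat (Suc d) * Q ^ (Suc m * Suc d)) = (\<lambda>d. x * (of_nat (Suc d) * x ^ d))"
        by (simp only: mult.left_commute)
      moreover have "x * (1 / (1 - x) ^ 2) = Q ^ Suc m / (1 - Q ^ Suc m) ^ 2" by (simp add: x_def)
      ultimately show ?thesis
        using \<open>((\<lambda>d. x * (of_nat (Suc d) * x ^ d)) has_sum (x * (1 / (1 - x) ^ 2))) UNIV\<close> by simp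
    qed
  qed
  thus ?thesis by (rule has_sum_imp_sums)
qed

definition eis2 :: "complex \<Rightarrow> complex" where
  "eis2 z = 1 - 24 * (\<Sum>n. of_nat (sigmak 1 n) * qexp z ^ n)"

lemma eis2_conv_sin_sum:
  assumes "Im z > 0"
  shows "eis2 z = 1 + 6 * sin_sum z"
proof -
  have "(\<lambda>m. - 4 * (qexp z ^ Suc m / (1 - qexp z ^ Suc m) ^ 2)) sums (- 4 * (\<Sum>n. of_nat (sigmak 1 n) * qexp z ^ n))"
    by (intro sums_mult lambert_series_sigma norm_qexp_less_1 assms)
  moreover have "1 / sin (of_real pi * (of_nat (Suc m) * z)) ^ 2 = - 4 * (qexp z ^ Suc m / (1 - qexp z ^ Suc m) ^ 2)" for m
    using assms by (subst inverse_sin_squared_conv_qexp) (auto simp: qexp_of_nat_mult[of "Suc m"] add_pos_nonneg simp del: of_nat_Suc power_Suc)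
  ultimately have "sin_sum z = - 4 * (\<Sum>n. of_nat (sigmak 1 n) * qexp z ^ n)"
    using sin_sum_has_sum_rows(2)[OF assms] by (simp only: sums_unique2)
  thus ?thesis by (simp add: eis2_def)
qed

lemma eis2_inversion:
  assumes "Im z > 0"
  shows "eis2 (- 1 / z) = z ^ 2 * eis2 z + 6 / (of_real pi * \<i>) * z"
proof -
  have z: "z \<noteq> 0" using assms by auto
  define A :: complex where "A = of_real pi"
  have A: "A \<noteq> 0" by (simp add: A_def)
  have "2 * A ^ 2 * sin_sum z = 2 * A ^ 2 / z ^ 2 * sin_sum (- 1 / z) - A ^ 2 / 3 + A ^ 2 / (3 * z ^ 2) + 2 * A * \<i> / z"
    unfolding A_def by (rule sin_sum_inversion[OF assms])
  hence "3 * z ^ 2 / A ^ 2 * (2 * A ^ 2 * sin_sum z) = 3 * z ^ 2 / A ^ 2 *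
      (2 * A ^ 2 / z ^ 2 * sin_sum (- 1 / z) - A ^ 2 / 3 + A ^ 2 / (3 * z ^ 2) + 2 * A * \<i> / z)"
    by (rule arg_cong)
  also have "\<dots> = 6 * sin_sum (- 1 / z) - z ^ 2 + 1 + 6 * \<i> * z / A"
    using z A by (simp add: field_simps power2_eq_square)
  finally have "6 * z ^ 2 * sin_sum z = 6 * sin_sum (- 1 / z) - z ^ 2 + 1 + 6 * \<i> * z / of_real pi"
    using A by (simp add: A_def mult.assoc)
  moreover have "6 / (of_real pi * \<i>) * z = - (6 * \<i> * z / of_real pi)"
    by (simp add: divide_simps)
  ultimately show ?thesis
    using assms Im_minus_inverse_pos[OF assms] by (simp add: eis2_conv_sin_sum algebra_simps)
qed

lemma eis2_plus_1: "eis2 (z + 1) = eis2 z"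
  by (simp add: eis2_def qexp_plus_1)

section \<open>The modular group and the eta function\<close>

abbreviation uhp :: "complex set" where "uhp \<equiv> {z. Im z > 0}"

lemma open_uhp [simp]: "open uhp"
  by (rule open_halfspace_Im_gt)

lemma convex_uhp [simp]: "convex uhp"
  by (rule convex_halfspace_Im_gt)

lemma holomorphic_on_uhpI:
  "(\<And>z. Im z > 0 \<Longrightarrow> (f has_field_derivative f' z) (at z)) \<Longrightarrow> f holomorphic_on uhp"
  unfolding holomorphic_on_def field_differentiable_def using has_field_derivative_at_within by blast

abbreviation jac :: "int \<Rightarrow> int \<Rightarrow> complex \<Rightarrow> complex" where
  "jac c d z \<equiv> of_int c * z + of_int d"

definition mob :: "int \<Rightarrow> int \<Rightarrow> int \<Rightarrow> int \<Rightarrow> complex \<Rightarrow> complex" where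
  "mob a b c d z = (jac a b z) / (jac c d z)"

lemma mob_denom_nonzero:
  assumes "a * d - b * c = (1 :: int)" "Im z > 0"
  shows "of_int c * z + of_int d \<noteq> 0"
proof
  assume "of_int c * z + of_int d = 0"
  hence "of_int c * Im z = 0" "of_int c * Re z + of_int d = 0" by (auto simp: complex_eq_iff)
  with assms show False by auto
qed

lemma Im_mob:
  assumes "a * d - b * c = (1 :: int)" "Im z > 0"
  shows "Im (mob a b c d z) = Im z / norm (jac c d z) ^ 2"
proof -
  have "real_of_int (a * d - b * c) = 1" by (simp only: assms(1) of_int_1)
  hence 1: "real_of_int a * real_of_int d - real_of_int b * real_of_int c = 1" by simp
  have "Im (mob a b c d z) = ((real_of_int a * real_of_int d - real_of_int b * real_of_int c) * Im z) / norm (jac c d z) ^ 2"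
    unfolding mob_def Im_divide cmod_power2
    by (simp add: algebra_simps)
  thus ?thesis by (simp only: 1 mult_1)
qed

lemma Im_mob_pos:
  assumes "a * d - b * c = (1 :: int)" "Im z > 0"
  shows "Im (mob a b c d z) > 0"
  using assms mob_denom_nonzero[OF assms] by (auto simp: Im_mob intro!: divide_pos_pos)

lemma mob_cocycle:
  assumes "a' * d' - b' * c' = (1 :: int)" "Im z > 0"
  shows "(of_int c * mob a' b' c' d' z + of_int d) * (jac c' d' z) =
    of_int (c * a' + d * c') * z + of_int (c * b' + d * d')"
  using mob_denom_nonzero[OF assms] by (simp add: mob_def field_simps)

lemma mob_mob:
  assumes "a * d - b * c = (1 :: int)" "a' * d' - b' * c' = (1 :: int)" "Im z > 0"
  shows "mob a b c d (mob a' b' c' d' z) = mob (a * a' + b * c') (a * b' + b * d') (c * a' + d * c') (c * b' + d * d') z"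
proof -
  define j where "j = of_int c' * z + of_int d'"
  have j: "j \<noteq> 0" unfolding j_def by (rule mob_denom_nonzero[OF assms(2,3)])
  have "mob a b c d (mob a' b' c' d' z) =
     ((of_int a * mob a' b' c' d' z + of_int b) * j) / ((of_int c * mob a' b' c' d' z + of_int d) * j)"
    using j by (simp add: mob_def[of a b c d])
  thus ?thesis
    unfolding j_def mob_cocycle[OF assms(2,3)] by (simp add: mob_def)
qed

lemma det_mult:
  assumes "a * d - b * c = (1 :: int)" "a' * d' - b' * c' = (1 :: int)"
  shows "(a * a' + b * c') * (c * b' + d * d') - (a * b' + b * d') * (c * a' + d * c') = 1"
proof -
  have "(a * a' + b * c') * (c * b' + d * d') - (a * b' + b * d') * (c * a' + d * c') =
     (a * d - b * c) * (a' * d' - b' * c')" by algebra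
  thus ?thesis by (simp only: assms mult_1)
qed

lemma mob_has_field_derivative:
  assumes "a * d - b * c = (1 :: int)" "Im z > 0"
  shows "(mob a b c d has_field_derivative 1 / (jac c d z) ^ 2) (at z)"
proof -
  have "complex_of_int (a * d - b * c) = 1" by (simp only: assms(1) of_int_1)
  hence 1: "complex_of_int a * of_int d - of_int b * of_int c = 1" by simp
  have "(mob a b c d has_field_derivative (of_int a * (jac c d z) - (jac a b z) * of_int c) / (jac c d z) ^ 2) (at z)"
    unfolding mob_def [abs_def] using mob_denom_nonzero[OF assms]
    by (auto intro!: derivative_eq_intros simp: power2_eq_square)
  also have "of_int a * (jac c d z) - (jac a b z) * of_int c = 1"
    using 1 by (simp add: algebra_simps)
  finally show ?thesis .
qed

lemma holomorphic_on_mob: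
  assumes "a * d - b * c = (1 :: int)"
  shows "mob a b c d holomorphic_on uhp"
  using mob_has_field_derivative[OF assms] by (rule holomorphic_on_uhpI)

text \<open>The steps are right multiplication by \<open>S = (0 -1; 1 0)\<close> and \<open>T = (1 1; 0 1)\<close>.\<close>
lemma sl2z_induct [consumes 1, case_names one S T]:
  fixes a b c d :: int
  assumes "a * d - b * c = 1"
    and one: "P 1 0 0 1"
    and S: "\<And>a b c d. a * d - b * c = 1 \<Longrightarrow> P a b c d \<Longrightarrow> P b (- a) d (- c)"
    and T: "\<And>a b c d. a * d - b * c = 1 \<Longrightarrow> P a b c d \<Longrightarrow> P a (a + b) c (c + d)"
  shows "P a b c d"
proof -
  have S_iff: "P b (- a) d (- c) \<longleftrightarrow> P a b c d" if "a * d - b * c = 1" for a b c d :: int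
  proof
    assume *: "P b (- a) d (- c)"
    have "P (- a) (- b) (- c) (- d)" using S[OF _ *] that by (simp add: algebra_simps)
    from S[OF _ this] have "P (- b) a (- d) c" using that by simp
    from S[OF _ this] show "P a b c d" using that by (simp add: algebra_simps)
  qed (rule S[OF that])
  \<comment> \<open>The rules only multiply by S and T. The inverse of T is reached through the
    relation T^-1 = S^-1 T S T S.\<close>
  have T_inv: "P a (b - a) c (d - c)" if "a * d - b * c = 1" "P a b c d" for a b c d :: int
  proof -
    have "P (- b) a (- d) c"
      using that S_iff[of "-b" c a "-d"] by (simp add: algebra_simps)
    from T[OF _ this] have "P (- b) (a - b) (- d) (c - d)" using that by (simp add: algebra_simps)
    from S[OF _ this] have "P (a - b) b (c - d) d" using that by (simp add: algebra_simps)
    from T[OF _ this] have "P (a - b) a (c - d) c" using that by (simp add: algebra_simps)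
    from S[OF _ this] show ?thesis using that by (simp add: algebra_simps)
  qed
  have det: "a * (d + j * c) - (b + j * a) * c = 1" if "a * d - b * c = 1" for a b c d j :: int
    using that by (simp add: algebra_simps)
  have T_pow: "P a (b + j * a) c (d + j * c)" if "a * d - b * c = 1" "P a b c d" for a b c d j :: int
  proof (induction j rule: int_induct[where k = 0])
    case base
    show ?case using that by simp
  next
    case (step1 i)
    from T[OF det[OF that(1)] step1(2)] show ?case by (simp add: algebra_simps)
  next
    case (step2 i)
    from T_inv[OF det[OF that(1)] step2(2)] show ?case by (simp add: algebra_simps)
  qed
  have T_iff: "P a (b + j * a) c (d + j * c) \<longleftrightarrow> P a b c d" if "a * d - b * c = 1" for a b c d j :: int
    using T_pow[OF det[OF that, of j], of "- j"] T_pow[OF that, of j] by auto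
  show ?thesis using assms(1)
  proof (induction "nat \<bar>c\<bar>" arbitrary: a b c d rule: less_induct)
    case less
    show ?case
    proof (cases "c = 0")
      case True
      hence ad: "a * d = 1" using less.prems by simp
      have neg: "P (- 1) 0 0 (- 1)" using S[OF _ S[OF _ one]] by simp
      from ad have "a = 1 \<and> d = 1 \<or> a = -1 \<and> d = -1" using zmult_eq_1_iff by blast
      thus ?thesis
        using T_pow[OF _ one, of b] T_pow[OF _ neg, of "- b"] True by auto
    next
      case False
      \<comment> \<open>A Euclidean step: multiplying by T^j reduces d modulo c, and S then moves
        the remainder into the place of c.\<close>
      define j where "j = - (d div c)"
      define d' where "d' = d + j * c"
      have d': "d' = d mod c" unfolding d'_def j_def by (simp add: minus_div_mult_eq_mod [symmetric])
      have "nat \<bar>d'\<bar> < nat \<bar>c\<bar>" using abs_mod_less[of c d] False by (simp add: d')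
      moreover have "(b + j * a) * (- c) - (- a) * d' = 1"
        using det[OF less.prems, of j] by (simp add: d'_def algebra_simps)
      ultimately have "P (b + j * a) (- a) d' (- c)" by (rule less.hyps)
      hence "P a (b + j * a) c d'"
        by (subst (asm) S_iff) (use det[OF less.prems, of j] in \<open>auto simp: d'_def\<close>)
      thus ?thesis unfolding d'_def by (simp only: T_iff[OF less.prems])
    qed
  qed
qed

lemma mob_S: "mob a b c d (- 1 / z) = mob b (- a) d (- c) z" if "a * d - b * c = 1" "Im z > 0"
proof -
  have "- 1 / z = mob 0 (- 1) 1 0 z" by (simp add: mob_def)
  thus ?thesis using mob_mob[OF that(1) _ that(2), of 0 0 "-1" 1] by simp
qed

lemma mob_T: "mob a b c d (z + 1) = mob a (a + b) c (c + d) z"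
  by (simp add: mob_def algebra_simps)

text \<open>The constant 12 / (2 pi i) of quasimodularity. It occurs again in
  \<open>eis4_conv_eis2\<close>, since Ramanujan's operator q d/dq is d/dz divided by 2 pi
  i.\<close>

definition kappa :: complex where "kappa = 6 / (of_real pi * \<i>)"

lemma eis2_mob:
  assumes "a * d - b * c = (1 :: int)" "Im z > 0"
  shows "eis2 (mob a b c d z) = (jac c d z) ^ 2 * eis2 z + kappa * of_int c * (jac c d z)"
  using assms
proof (induction a b c d arbitrary: z rule: sl2z_induct)
  case one
  then show ?case by (simp add: mob_def)
next
  case (S a b c d)
  have z: "z \<noteq> 0" using S.prems by auto
  have "eis2 (mob b (- a) d (- c) z) = eis2 (mob a b c d (- 1 / z))"
    using mob_S[OF S.hyps S.prems] by simp
  also have "\<dots> = (of_int c * (- 1 / z) + of_int d) ^ 2 * eis2 (- 1 / z) + kappa * of_int c * (of_int c * (- 1 / z) + of_int d)"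
    by (rule S.IH[OF Im_minus_inverse_pos[OF S.prems]])
  also have "\<dots> = (of_int d * z + of_int (- c)) ^ 2 * eis2 z + kappa * of_int d * (of_int d * z + of_int (- c))"
    unfolding eis2_inversion[OF S.prems] kappa_def [symmetric] using z
    by (simp add: field_simps power2_eq_square)
  finally show ?case .
next
  case (T a b c d)
  have "eis2 (mob a (a + b) c (c + d) z) = eis2 (mob a b c d (z + 1))"
    by (simp only: mob_T)
  also have "\<dots> = (of_int c * (z + 1) + of_int d) ^ 2 * eis2 (z + 1) + kappa * of_int c * (of_int c * (z + 1) + of_int d)"
    by (rule T.IH) (use T.prems in simp)
  finally show ?case unfolding eis2_plus_1 by (simp add: algebra_simps)
qed

section \<open>The eta function and its multiplier\<close>

definition sigma_fps :: "complex fps" where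
  "sigma_fps = Abs_fps (\<lambda>n. of_nat (sigmak 1 n))"

text \<open>Minus the logarithm of the Euler product of 1 - q^n. The coefficient at 0 is 0 because
  \<open>sigmak 1 0\<close> is 0.\<close>

definition log_eta_fps :: "complex fps" where
  "log_eta_fps = Abs_fps (\<lambda>n. of_nat (sigmak 1 n) / of_nat n)"

lemma fps_conv_radius_ge_1_I:
  fixes F :: "complex fps"
  assumes "\<And>n. norm (fps_nth F n) \<le> C * real n ^ 2"
  shows "fps_conv_radius F \<ge> 1"
  unfolding fps_conv_radius_def
proof (rule conv_radius_geI_ex')
  fix r :: real assume r: "0 < r" "ereal r < 1"
  show "summable (\<lambda>n. fps_nth F n * of_real r ^ n)"
  proof (rule summable_comparison_test)
    show "summable (\<lambda>n. C * (real n ^ 2 * r ^ n))"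
      using summable_square_power[of r] r by (intro summable_mult) auto
    have "norm (fps_nth F n * of_real r ^ n) \<le> C * (real n ^ 2 * r ^ n)" for n
      using mult_right_mono[OF assms[of n], of "r ^ n"] r by (simp add: norm_mult norm_power mult_ac)
    thus "\<exists>N. \<forall>n\<ge>N. norm (fps_nth F n * of_real r ^ n) \<le> C * (real n ^ 2 * r ^ n)" by blast
  qed
qed

lemma fps_conv_radius_sigma_fps: "fps_conv_radius sigma_fps \<ge> 1"
  by (rule fps_conv_radius_ge_1_I[where C = 1])
     (use sigmak_1_le of_nat_mono[OF sigmak_1_le, where 'a = real] in \<open>auto simp: sigma_fps_def\<close>)

lemma fps_conv_radius_log_eta_fps: "fps_conv_radius log_eta_fps \<ge> 1"
proof (rule fps_conv_radius_ge_1_I[where C = 1])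
  fix n
  have "norm (fps_nth log_eta_fps n) = real (sigmak 1 n) / real n"
    by (simp add: log_eta_fps_def norm_divide)
  also have "\<dots> \<le> real (sigmak 1 n)"
    by (cases "n = 0") (auto simp: divide_le_eq mult_le_cancel_left1)
  also have "\<dots> \<le> real n ^ 2" using of_nat_mono[OF sigmak_1_le[of n], where 'a = real] by simp
  finally show "norm (fps_nth log_eta_fps n) \<le> 1 * real n ^ 2" by simp
qed

lemma eval_fps_sigma_fps: "eis2 z = 1 - 24 * eval_fps sigma_fps (qexp z)"
  by (simp add: eis2_def eval_fps_def sigma_fps_def)

lemma qexp_has_field_derivative [derivative_intros]:
  "(f has_field_derivative f') (at z within A) \<Longrightarrow> ((\<lambda>z. qexp (f z)) has_field_derivative 2 * of_real pi * \<i> * f' * qexp (f z)) (at z within A)"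
  unfolding qexp_def by (auto intro!: derivative_eq_intros)

lemma qexp_less_conv_radius: "fps_conv_radius F \<ge> 1 \<Longrightarrow> Im z > 0 \<Longrightarrow> ereal (norm (qexp z)) < fps_conv_radius F"
  using norm_qexp_less_1[of z] by (auto intro: order.strict_trans2[of _ 1])

lemma eval_fps_qexp_has_field_derivative:
  assumes "fps_conv_radius F \<ge> 1" "Im z > 0"
  shows "((\<lambda>z. eval_fps F (qexp z)) has_field_derivative 2 * of_real pi * \<i> * eval_fps (fps_X * fps_deriv F) (qexp z)) (at z)"
proof -
  have r: "norm (qexp z) < fps_conv_radius F" by (rule qexp_less_conv_radius[OF assms])
  have "(eval_fps F has_field_derivative eval_fps (fps_deriv F) (qexp z)) (at (qexp z))"
    by (rule has_field_derivative_eval_fps[OF r])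
  moreover have "(qexp has_field_derivative 2 * of_real pi * \<i> * 1 * qexp z) (at z)"
    by (rule qexp_has_field_derivative) (rule DERIV_ident)
  ultimately have "((\<lambda>z. eval_fps F (qexp z)) has_field_derivative eval_fps (fps_deriv F) (qexp z) * (2 * of_real pi * \<i> * 1 * qexp z)) (at z)"
    by (rule DERIV_chain2)
  moreover have "eval_fps (fps_X * fps_deriv F) (qexp z) = qexp z * eval_fps (fps_deriv F) (qexp z)"
    using order.strict_trans2[OF r fps_conv_radius_deriv] by (subst eval_fps_mult) auto
  ultimately show ?thesis by (simp add: mult_ac)
qed

lemma holomorphic_on_eval_fps_qexp:
  assumes "fps_conv_radius F \<ge> 1"
  shows "(\<lambda>z. eval_fps F (qexp z)) holomorphic_on uhp"
  using eval_fps_qexp_has_field_derivative[OF assms] by (rule holomorphic_on_uhpI)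

text \<open>Defined through the logarithm of the product, which makes it visibly nonzero and gives
  its derivative at once. The agreement with the formal products \<open>eta_prod\<close> is
  established later by comparing logarithmic derivatives.\<close>

definition eta :: "complex \<Rightarrow> complex" where
  "eta z = exp (of_real pi * \<i> * z / 12 - eval_fps log_eta_fps (qexp z))"

lemma eta_nonzero [simp]: "eta z \<noteq> 0"
  by (simp add: eta_def)

lemma fps_X_deriv_log_eta_fps: "fps_X * fps_deriv log_eta_fps = sigma_fps"
proof (rule fps_ext)
  fix n show "fps_nth (fps_X * fps_deriv log_eta_fps) n = fps_nth sigma_fps n"
    by (cases n) (auto simp: log_eta_fps_def sigma_fps_def sigmak_def simp del: of_nat_Suc)
qed

lemma eta_has_field_derivative:
  assumes "Im z > 0"
  shows "(eta has_field_derivative of_real pi * \<i> / 12 * eis2 z * eta z) (at z)"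
proof -
  have "((\<lambda>z. of_real pi * \<i> * z / 12) has_field_derivative of_real pi * \<i> / 12) (at z)"
    by (auto intro!: derivative_eq_intros)
  from DERIV_chain2[OF DERIV_exp DERIV_diff[OF this eval_fps_qexp_has_field_derivative[OF fps_conv_radius_log_eta_fps assms]]]
  show ?thesis
    unfolding eta_def [abs_def] by (simp add: fps_X_deriv_log_eta_fps eval_fps_sigma_fps field_simps)
qed

lemma eta_plus_1: "eta (z + 1) ^ 2 = exp (of_real pi * \<i> / 6) * eta z ^ 2"
  unfolding eta_def qexp_plus_1
  by (simp add: exp_of_nat_mult [symmetric] exp_add [symmetric] algebra_simps add_divide_distrib)

text \<open>Since the logarithmic derivative of eta is a multiple of \<open>eis2\<close>, the
  inversion of \<open>eis2\<close> says that the quotient of the two sides has derivative zero. Its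
  constant value is read off at the fixed point i. The square avoids the branch of the root of z /
  i.\<close>

lemma eta_inversion:
  assumes "Im z > 0"
  shows "eta (- 1 / z) ^ 2 = - \<i> * z * eta z ^ 2"
proof -
  define f where "f = (\<lambda>z. eta (- 1 / z) ^ 2 / (z * eta z ^ 2))"
  have "(f has_field_derivative 0) (at z)" if z: "Im z > 0" for z
  proof -
    have z0: "z \<noteq> 0" using z by auto
    have 1: "((\<lambda>z. - 1 / z) has_field_derivative 1 / z ^ 2) (at z)"
      using z0 by (auto intro!: derivative_eq_intros simp: power2_eq_square)
    have 2: "((\<lambda>z. eta (- 1 / z)) has_field_derivative of_real pi * \<i> / 12 * eis2 (- 1 / z) * eta (- 1 / z) * (1 / z ^ 2)) (at z)"
      by (rule DERIV_chain2[OF eta_has_field_derivative[OF Im_minus_inverse_pos[OF z]] 1])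
    define u where "u = eta (- 1 / z)"
    define v where "v = eta z"
    define N where "N = 2 * u * (of_real pi * \<i> / 12 * eis2 (- 1 / z) * u * (1 / z ^ 2)) * (z * v ^ 2)
        - u ^ 2 * (v ^ 2 + z * (2 * v * (of_real pi * \<i> / 12 * eis2 z * v)))"
    have "(f has_field_derivative N / ((z * v ^ 2) * (z * v ^ 2))) (at z)"
      unfolding f_def
      by (rule derivative_eq_intros 2 eta_has_field_derivative[OF z] refl | simp add: z0)+
         (simp add: N_def u_def v_def)
    moreover have "N = 0"
    proof -
      have eq: "of_real pi * \<i> / 12 * eis2 (- 1 / z) * (1 / z ^ 2) = of_real pi * \<i> / 12 * eis2 z + 1 / (2 * z)"
        unfolding eis2_inversion[OF z] using z0 by (simp add: field_simps power2_eq_square)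
      have "N = 2 * u ^ 2 * (of_real pi * \<i> / 12 * eis2 (- 1 / z) * (1 / z ^ 2)) * (z * v ^ 2)
        - u ^ 2 * (v ^ 2 + z * (2 * v * (of_real pi * \<i> / 12 * eis2 z * v)))"
        unfolding N_def by (simp add: power2_eq_square mult_ac)
      also have "\<dots> = 2 * u ^ 2 * (of_real pi * \<i> / 12 * eis2 z + 1 / (2 * z)) * (z * v ^ 2)
        - u ^ 2 * (v ^ 2 + z * (2 * v * (of_real pi * \<i> / 12 * eis2 z * v)))"
        by (simp only: eq)
      also have "\<dots> = 0" using z0 by (simp add: field_simps power2_eq_square)
      finally show ?thesis .
    qed
    ultimately show ?thesis by simp
  qed
  hence "\<And>z. z \<in> uhp \<Longrightarrow> (f has_field_derivative 0) (at z within uhp)"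
    by (auto intro: DERIV_subset)
  from has_field_derivative_zero_constant[OF convex_uhp this]
  obtain C where C: "\<And>z. z \<in> uhp \<Longrightarrow> f z = C" by blast
  have "f \<i> = - \<i>" by (simp add: f_def)
  with C[of \<i>] C[of z] assms have "f z = - \<i>" by simp
  moreover have "z \<noteq> 0" using assms by auto
  ultimately show ?thesis by (simp add: f_def divide_eq_eq)
qed

text \<open>The exponent of the multiplier of \<open>\<eta>\<^sup>2\<close>: modulo 12 it is additive on the modular group.\<close>
definition eta_char :: "int \<Rightarrow> int \<Rightarrow> int \<Rightarrow> int \<Rightarrow> int" where
  "eta_char a b c d = (1 - c ^ 2) * (b * d + 3 * (c - 1) * d + c + 3) + c * (a + d - 3)"

definition root12 :: "int \<Rightarrow> complex" where
  "root12 k = exp (of_real pi * \<i> / 6 * of_int k)"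

lemma root12_add: "root12 (j + k) = root12 j * root12 k"
  by (simp only: root12_def of_int_add distrib_left exp_add)

lemma root12_12: "root12 (12 * k) = 1"
  using exp_integer_2pi[of "of_int k"] by (simp add: root12_def mult_ac)

lemma root12_cong:
  assumes "12 dvd j - k"
  shows "root12 j = root12 k"
proof -
  from assms obtain i where "j = 12 * i + k" by (metis dvdE diff_add_cancel)
  thus ?thesis by (simp add: root12_add root12_12)
qed

lemma root12_0 [simp]: "root12 0 = 1" by (simp add: root12_def)

lemma norm_root12 [simp]: "norm (root12 k) = 1" by (simp add: root12_def)

lemma root12_power_int: "root12 k powi m = root12 (k * m)"
  unfolding root12_def exp_power_int by (simp add: mult_ac)

lemma root12_9: "root12 9 = - \<i>"
proof -
  have "of_real pi * \<i> / 6 * of_int 9 = of_real pi * \<i> + \<i> * of_real (pi / 2)" by (simp add: field_simps)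
  hence "root12 9 = exp (of_real pi * \<i>) * exp (\<i> * of_real (pi / 2))" by (simp only: root12_def exp_add)
  also have "exp (\<i> * of_real (pi / 2)) = \<i>" using cis_conv_exp[of "pi / 2"] by (simp add: cis_pi_half)
  finally show ?thesis by (simp add: mult.commute)
qed

lemma cong_eta_char:
  "[eta_char a b c d = eta_char (a mod m) (b mod m) (c mod m) (d mod m)] (mod m)"
  unfolding eta_char_def
  by (intro cong_add cong_mult cong_diff cong_pow cong_refl) auto

text \<open>The step by S multiplies the square of eta by -i, which is \<open>root12 9\<close>, and
  the step by T by \<open>root12 1\<close>. That the polynomial \<open>eta_char\<close> follows both
  steps is decided by residues, separately modulo 3 and modulo 4.\<close>

lemma eta_char_S_aux:
  "\<forall>a\<in>set [0..m-1]. \<forall>b\<in>set [0..m-1]. \<forall>c\<in>set [0..m-1]. \<forall>d\<in>set [0..m-1]. (a * d - b * c) mod m = 1 \<longrightarrow>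
     (eta_char b ((- a) mod m) d ((- c) mod m) - eta_char a b c d - 9) mod m = 0 \<and>
     (eta_char a ((a + b) mod m) c ((c + d) mod m) - eta_char a b c d - 1) mod m = 0"
  if "m = 3 \<or> m = 4" for m :: int
  using that by (elim disjE; hypsubst; code_simp)

lemma eta_char_step:
  assumes "a * d - b * c = 1"
  shows "12 dvd eta_char b (- a) d (- c) - (eta_char a b c d + 9)"
    and "12 dvd eta_char a (a + b) c (c + d) - (eta_char a b c d + 1)"
proof -
  have key: "m dvd eta_char b (- a) d (- c) - (eta_char a b c d + 9) \<and> m dvd eta_char a (a + b) c (c + d) - (eta_char a b c d + 1)"
    if m: "m = 3 \<or> m = 4" for m
  proof -
    define a' b' c' d' where "a' = a mod m" "b' = b mod m" "c' = c mod m" "d' = d mod m"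
    note defs = this
    have mem: "a' \<in> set [0..m-1]" "b' \<in> set [0..m-1]" "c' \<in> set [0..m-1]" "d' \<in> set [0..m-1]"
      using m by (auto simp: defs)
    have "(a' * d' - b' * c') mod m = (a * d - b * c) mod m"
      unfolding defs by (intro mod_diff_cong mod_mult_cong mod_mod_trivial)
    also have "\<dots> = 1" using assms m by auto
    finally have *: "(eta_char b' ((- a') mod m) d' ((- c') mod m) - eta_char a' b' c' d' - 9) mod m = 0"
      "(eta_char a' ((a' + b') mod m) c' ((c' + d') mod m) - eta_char a' b' c' d' - 1) mod m = 0"
      using eta_char_S_aux[OF m] mem by blast+
    have e: "(- a') mod m = (- a) mod m" "(- c') mod m = (- c) mod m" "(a' + b') mod m = (a + b) mod m" "(c' + d') mod m = (c + d) mod m"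
      unfolding defs by (simp_all add: mod_simps)
    have "[eta_char b (- a) d (- c) - eta_char a b c d - 9 = eta_char b' ((- a') mod m) d' ((- c') mod m) - eta_char a' b' c' d' - 9] (mod m)"
      unfolding e unfolding defs by (intro cong_diff cong_eta_char cong_refl)
    moreover have "[eta_char a (a + b) c (c + d) - eta_char a b c d - 1 = eta_char a' ((a' + b') mod m) c' ((c' + d') mod m) - eta_char a' b' c' d' - 1] (mod m)"
      unfolding e unfolding defs by (intro cong_diff cong_eta_char cong_refl)
    ultimately show ?thesis using * cong_dvd_iff by (auto simp: mod_eq_0_iff_dvd diff_diff_eq)
  qed
  have "12 dvd x" if "3 dvd x" "4 dvd x" for x :: int using that by presburger
  thus "12 dvd eta_char b (- a) d (- c) - (eta_char a b c d + 9)"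
    "12 dvd eta_char a (a + b) c (c + d) - (eta_char a b c d + 1)"
    using key[of 3] key[of 4] by auto
qed

lemma eta_mob:
  assumes "a * d - b * c = (1 :: int)" "Im z > 0"
  shows "eta (mob a b c d z) ^ 2 = root12 (eta_char a b c d) * (jac c d z) * eta z ^ 2"
  using assms
proof (induction a b c d arbitrary: z rule: sl2z_induct)
  case one
  then show ?case by (simp add: mob_def eta_char_def)
next
  case (S a b c d)
  have z: "z \<noteq> 0" using S.prems by auto
  have "eta (mob b (- a) d (- c) z) ^ 2 = eta (mob a b c d (- 1 / z)) ^ 2"
    using mob_S[OF S.hyps S.prems] by simp
  also have "\<dots> = root12 (eta_char a b c d) * (of_int c * (- 1 / z) + of_int d) * eta (- 1 / z) ^ 2"
    by (rule S.IH[OF Im_minus_inverse_pos[OF S.prems]])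
  also have "\<dots> = root12 (eta_char a b c d) * root12 9 * ((of_int c * (- 1 / z) + of_int d) * z) * eta z ^ 2"
    unfolding eta_inversion[OF S.prems] root12_9 by (simp add: mult_ac)
  also have "(of_int c * (- 1 / z) + of_int d) * z = of_int d * z + of_int (- c)"
    using z by (simp add: field_simps)
  also have "root12 (eta_char a b c d) * root12 9 = root12 (eta_char b (- a) d (- c))"
    unfolding root12_add [symmetric] by (rule root12_cong [symmetric], rule eta_char_step[OF S.hyps])
  finally show ?case .
next
  case (T a b c d)
  have "eta (mob a (a + b) c (c + d) z) ^ 2 = eta (mob a b c d (z + 1)) ^ 2"
    by (simp only: mob_T)
  also have "\<dots> = root12 (eta_char a b c d) * (of_int c * (z + 1) + of_int d) * eta (z + 1) ^ 2"
    by (rule T.IH) (use T.prems in simp)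
  also have "\<dots> = root12 (eta_char a b c d) * root12 1 * (of_int c * z + of_int (c + d)) * eta z ^ 2"
    unfolding eta_plus_1 by (simp add: root12_def algebra_simps)
  also have "root12 (eta_char a b c d) * root12 1 = root12 (eta_char a (a + b) c (c + d))"
    unfolding root12_add [symmetric] by (rule root12_cong [symmetric], rule eta_char_step[OF T.hyps])
  finally show ?case .
qed

section \<open>Modular forms of level N\<close>

text \<open>The last clause is holomorphy at all cusps: every conjugate under the full modular group
  is bounded near infinity. Keeping the automorphy factor on the right avoids quotients, so the
  clause passes easily to sums and products.\<close>

definition modform :: "nat \<Rightarrow> nat \<Rightarrow> (complex \<Rightarrow> complex) \<Rightarrow> bool" where
  "modform N k f \<longleftrightarrow> f holomorphic_on uhp \<and>
     (\<forall>a b c d z. a * d - b * c = 1 \<longrightarrow> int N dvd c \<longrightarrow> Im z > 0 \<longrightarrow>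
        f (mob a b c d z) = (jac c d z) ^ k * f z) \<and>
     (\<forall>a b c d. a * d - b * c = 1 \<longrightarrow> (\<exists>B Y. Y > 0 \<and> (\<forall>z. Im z \<ge> Y \<longrightarrow>
        norm (f (mob a b c d z)) \<le> B * norm (jac c d z) ^ k)))"

lemma modformI:
  assumes "f holomorphic_on uhp"
    and "\<And>a b c d z. a * d - b * c = 1 \<Longrightarrow> int N dvd c \<Longrightarrow> Im z > 0 \<Longrightarrow>
        f (mob a b c d z) = (jac c d z) ^ k * f z"
    and "\<And>a b c d. a * d - b * c = 1 \<Longrightarrow> \<exists>B Y. Y > 0 \<and> (\<forall>z. Im z \<ge> Y \<longrightarrow>
        norm (f (mob a b c d z)) \<le> B * norm (jac c d z) ^ k)"
  shows "modform N k f"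
  using assms unfolding modform_def by blast

lemma modform_add:
  assumes "modform N k f" "modform N k g"
  shows "modform N k (\<lambda>z. f z + g z)"
proof (rule modformI, goal_cases)
  case 1
  show ?case using assms by (auto simp: modform_def intro!: holomorphic_intros)
next
  case (2 a b c d z)
  thus ?case using assms by (auto simp: modform_def algebra_simps)
next
  case (3 a b c d)
  from 3 assms obtain B Y B' Y' where *: "Y > 0" "\<And>z. Im z \<ge> Y \<Longrightarrow> norm (f (mob a b c d z)) \<le> B * norm (jac c d z) ^ k"
     "Y' > 0" "\<And>z. Im z \<ge> Y' \<Longrightarrow> norm (g (mob a b c d z)) \<le> B' * norm (jac c d z) ^ k"
    unfolding modform_def by metis
  show ?case
  proof (intro exI conjI allI impI)
    fix z assume "Im z \<ge> max Y Y'"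
    thus "norm (f (mob a b c d z) + g (mob a b c d z)) \<le> (B + B') * norm (jac c d z) ^ k"
      using *(2,4)[of z] norm_triangle_ineq[of "f (mob a b c d z)" "g (mob a b c d z)"]
      by (simp add: algebra_simps)
  qed (use * in auto)
qed

lemma modform_mult:
  assumes "modform N k f" "modform N l g"
  shows "modform N (k + l) (\<lambda>z. f z * g z)"
proof (rule modformI, goal_cases)
  case 1
  show ?case using assms by (auto simp: modform_def intro!: holomorphic_intros)
next
  case (2 a b c d z)
  thus ?case using assms by (auto simp: modform_def power_add algebra_simps)
next
  case (3 a b c d)
  from 3 assms obtain B Y B' Y' where *: "Y > 0" "\<And>z. Im z \<ge> Y \<Longrightarrow> norm (f (mob a b c d z)) \<le> B * norm (jac c d z) ^ k"
     "Y' > 0" "\<And>z. Im z \<ge> Y' \<Longrightarrow> norm (g (mob a b c d z)) \<le> B' * norm (jac c d z) ^ l"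
    unfolding modform_def by metis
  show ?case
  proof (intro exI conjI allI impI)
    fix z assume "Im z \<ge> max Y Y'"
    hence "norm (f (mob a b c d z)) * norm (g (mob a b c d z)) \<le>
        (B * norm (jac c d z) ^ k) * (B' * norm (jac c d z) ^ l)"
      using *(2,4)[of z] by (intro mult_mono) (auto intro: order.trans[OF norm_ge_zero])
    thus "norm (f (mob a b c d z) * g (mob a b c d z)) \<le> (B * B') * norm (jac c d z) ^ (k + l)"
      by (simp add: norm_mult power_add mult_ac)
  qed (use * in auto)
qed

lemma modform_const: "modform N 0 (\<lambda>_. x)"
proof (rule modformI)
  show "\<exists>B Y. Y > 0 \<and> (\<forall>z. Im z \<ge> Y \<longrightarrow> norm x \<le> B * norm (jac c d z) ^ 0)" for c d :: int
    by (rule exI[of _ "norm x"], rule exI[of _ 1]) simp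
qed auto

lemma modform_cmult: "modform N k f \<Longrightarrow> modform N k (\<lambda>z. x * f z)"
  using modform_mult[OF modform_const[of N x], of k f] by simp

lemma modform_diff:
  assumes "modform N k f" "modform N k g"
  shows "modform N k (\<lambda>z. f z - g z)"
  using modform_add[OF assms(1) modform_cmult[OF assms(2), of "-1"]] by simp

lemma modform_power: "modform N k f \<Longrightarrow> modform N (n * k) (\<lambda>z. f z ^ n)"
proof (induction n)
  case 0
  show ?case using modform_const[of N 1] by simp
next
  case (Suc n)
  from modform_mult[OF Suc.prems Suc.IH[OF Suc.prems]] show ?case by simp
qed

text \<open>The Hermite normal form of \<open>diag(n, 1) (a b; c e)\<close>.\<close>
lemma mob_dilate:
  fixes a b c e :: int and n :: nat
  assumes det: "a * e - b * c = 1" and n: "n > 0"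
  obtains a' b' c' d' A B D where "a' * d' - b' * c' = 1" "A = gcd c (int n)" "A > 0" "D > 0" "A * D = int n" "c' * A = c"
    "\<And>z. Im z > 0 \<Longrightarrow> of_nat n * mob a b c e z = mob a' b' c' d' ((of_int A * z + of_int B) / of_int D)"
    "\<And>z. Im z > 0 \<Longrightarrow> of_int c' * ((of_int A * z + of_int B) / of_int D) + of_int d' = (jac c e z) / of_int D"
proof -
  define \<delta> where "\<delta> = int n"
  have \<delta>: "\<delta> > 0" using n by (simp add: \<delta>_def)
  define A where "A = gcd c \<delta>"
  define c' where "c' = c div A"
  define D where "D = \<delta> div A"
  define a' where "a' = a * D"
  have A: "A > 0" using \<delta> by (simp add: A_def)
  have c: "c' * A = c" by (simp add: c'_def A_def)
  have AD: "A * D = \<delta>" by (simp add: D_def A_def)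
  have D: "D > 0" using A AD \<delta> by (metis zero_less_mult_pos)
  have cop: "coprime c' D" using \<delta> by (simp add: c'_def D_def A_def div_gcd_coprime)
  have "coprime a c" using det by (intro coprimeI) (metis dvd_diff dvd_mult dvd_mult2 dvd_mult_right dvd_refl dvd_triv_left)
  hence "coprime a c'" using c by (metis coprime_mult_right_iff)
  with cop have "coprime a' c'" by (simp add: a'_def coprime_commute)
  hence "gcd a' c' = 1" by simp
  then obtain u v where uv: "u * a' + v * c' = 1" using bezout_int[of a' c'] by auto
  define d' where "d' = u"
  define b' where "b' = - v"
  have det': "a' * d' - b' * c' = 1" using uv by (simp add: d'_def b'_def algebra_simps)
  \<comment> \<open>The upper right entry of the inverse of (a' b'; c' d') times diag(n, 1) (a b; c
    e).\<close>
  define B where "B = b * \<delta> * d' - b' * e"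
  have D_eq: "a' * e - c' * b * A * D = D"
  proof -
    have "a' * e - c' * b * A * D = D * (a * e - b * (c' * A))" by (simp add: a'_def algebra_simps)
    thus ?thesis by (simp add: c det)
  qed
  have e1: "a' * A = a * \<delta>" by (simp add: a'_def AD [symmetric])
  have e2: "a' * B + b' * D = b * \<delta>"
  proof -
    have "a' * B + b' * D = a' * (b * \<delta> * d' - b' * e) + b' * (a' * e - c' * b * A * D)"
      by (simp add: B_def D_eq)
    also have "\<dots> = b * \<delta> * (a' * d' - b' * c')" by (simp add: AD [symmetric] algebra_simps)
    finally show ?thesis by (simp add: det')
  qed
  have e3: "c' * B + d' * D = e"
  proof -
    have "c' * B + d' * D = c' * (b * \<delta> * d' - b' * e) + d' * (a' * e - c' * b * A * D)"
      by (simp add: B_def D_eq)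
    also have "\<dots> = e * (a' * d' - b' * c')" by (simp add: AD [symmetric] algebra_simps)
    finally show ?thesis by (simp add: det')
  qed
  have den: "of_int c' * ((of_int A * z + of_int B) / of_int D) + of_int d' = (jac c e z) / of_int D" for z :: complex
  proof -
    have "of_int c' * ((of_int A * z + of_int B) / of_int D) + of_int d' =
       (of_int (c' * A) * z + of_int (c' * B + d' * D)) / of_int D"
      using D by (simp add: field_simps)
    thus ?thesis by (simp only: c e3)
  qed
  have num: "of_int a' * ((of_int A * z + of_int B) / of_int D) + of_int b' = of_int \<delta> * (jac a b z) / of_int D" for z :: complex
  proof -
    have "of_int a' * ((of_int A * z + of_int B) / of_int D) + of_int b' =
       (of_int (a' * A) * z + of_int (a' * B + b' * D)) / of_int D"
      using D by (simp add: field_simps)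
    thus ?thesis unfolding e1 e2 by (simp add: algebra_simps)
  qed
  show ?thesis
  proof (rule that[OF det' A_def[unfolded \<delta>_def] A D AD[unfolded \<delta>_def] c])
    fix z assume z: "Im z > 0"
    have "of_int \<delta> * mob a b c e z = mob a' b' c' d' ((of_int A * z + of_int B) / of_int D)"
      unfolding mob_def num den using D mob_denom_nonzero[OF det z] by simp
    thus "of_nat n * mob a b c e z = mob a' b' c' d' ((of_int A * z + of_int B) / of_int D)"
      by (simp add: \<delta>_def)
    show "of_int c' * ((of_int A * z + of_int B) / of_int D) + of_int d' = (jac c e z) / of_int D"
      by (rule den)
  qed
qed

lemma mob_dilate_dvd:
  fixes a b c e :: int and \<delta> :: nat
  assumes "a * e - b * c = 1" "\<delta> > 0" "int \<delta> dvd c" "Im z > 0"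
  shows "of_nat \<delta> * mob a b c e z = mob a (b * int \<delta>) (c div int \<delta>) e (of_nat \<delta> * z)"
    and "a * e - (b * int \<delta>) * (c div int \<delta>) = 1"
    and "of_int (c div int \<delta>) * (of_nat \<delta> * z) + of_int e = of_int c * z + of_int e"
  using assms by (auto simp: mob_def field_simps elim!: dvdE)

section \<open>Growth of Eisenstein series at the cusps\<close>

lemma eval_fps_qexp_bounded:
  fixes F :: "complex fps"
  assumes "fps_conv_radius F \<ge> 1" "Y > 0"
  obtains B where "B > 0" "\<And>z. Im z \<ge> Y \<Longrightarrow> norm (eval_fps F (qexp z)) \<le> B"
proof -
  define r where "r = exp (- 2 * pi * Y)"
  have r: "r < 1" using assms by (simp add: r_def)
  have "cball (0 :: complex) r \<subseteq> eball 0 (fps_conv_radius F)"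
  proof (rule subsetI)
    fix x :: complex assume "x \<in> cball 0 r"
    hence "ereal (norm x) < 1" using r by simp
    from order.strict_trans2[OF this assms(1)] show "x \<in> eball 0 (fps_conv_radius F)" by (simp add: in_eball_iff)
  qed
  hence "continuous_on (cball 0 r) (eval_fps F)"
    by (rule continuous_on_subset[OF continuous_on_eval_fps])
  hence "compact (eval_fps F ` cball 0 r)" by (intro compact_continuous_image) auto
  hence "bounded (eval_fps F ` cball 0 r)" by (rule compact_imp_bounded)
  then obtain B where B: "B > 0" "\<And>x. x \<in> cball 0 r \<Longrightarrow> norm (eval_fps F x) \<le> B"
    unfolding bounded_pos by blast
  show ?thesis
  proof (rule that[OF B(1)])
    fix z assume "Im z \<ge> Y"
    thus "norm (eval_fps F (qexp z)) \<le> B" by (intro B(2)) (auto simp: norm_qexp r_def)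
  qed
qed

lemma Im_linear: "Im ((of_int A * z + of_int B) / of_int D) = of_int A * Im z / of_int D"
  by simp

lemma Im_linear_ge:
  assumes "A > (0::int)" "D > (0::int)" "Im z \<ge> of_int D"
  shows "Im ((of_int A * z + of_int B) / of_int D) \<ge> 1"
proof -
  have "real_of_int D \<le> of_int A * Im z"
    using assms mult_mono[of 1 "real_of_int A" "of_int D" "Im z"] by auto
  thus ?thesis using assms by (simp add: Im_linear)
qed

lemma Im_of_nat_mult_pos: "\<delta> > 0 \<Longrightarrow> Im z > 0 \<Longrightarrow> Im (of_nat \<delta> * z) > 0"
  by simp

lemma holomorphic_on_dilate:
  assumes "f holomorphic_on uhp" "\<delta> > 0"
  shows "(\<lambda>z. f (of_nat \<delta> * z)) holomorphic_on uhp"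
proof -
  have "(f \<circ> (\<lambda>z. of_nat \<delta> * z)) holomorphic_on uhp"
    by (rule holomorphic_on_compose_gen[OF _ assms(1)]) (use assms(2) in \<open>auto intro!: holomorphic_intros\<close>)
  thus ?thesis by (simp add: o_def)
qed

lemma holomorphic_on_eis2: "eis2 holomorphic_on uhp"
  unfolding eval_fps_sigma_fps [abs_def]
  by (intro holomorphic_intros holomorphic_on_eval_fps_qexp fps_conv_radius_sigma_fps)

lemma holomorphic_on_eta: "eta holomorphic_on uhp"
  using eta_has_field_derivative by (rule holomorphic_on_uhpI)

lemma eis2_bounded:
  obtains B where "B > 0" "\<And>z. Im z \<ge> 1 \<Longrightarrow> norm (eis2 z) \<le> B"
proof -
  obtain B where B: "B > 0" "\<And>z. Im z \<ge> 1 \<Longrightarrow> norm (eval_fps sigma_fps (qexp z)) \<le> B"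
    using eval_fps_qexp_bounded[OF fps_conv_radius_sigma_fps, of 1] by auto
  show ?thesis
  proof (rule that[of "1 + 24 * B"])
    fix z assume "Im z \<ge> 1"
    from B(2)[OF this] show "norm (eis2 z) \<le> 1 + 24 * B"
      using norm_triangle_ineq4[of 1 "24 * eval_fps sigma_fps (qexp z)"]
      by (simp add: eval_fps_sigma_fps norm_mult)
  qed (use B in simp)
qed

text \<open>The inhomogeneous term subtracted here does not depend on \<delta>: its factor is
  \<delta> c' / D, which equals c because A D = \<delta> and c' A = c. Hence it cancels in the
  difference treated by \<open>modform_eis2_diff\<close>.\<close>

lemma eis2_dilate_slash_bounded:
  fixes a b c e :: int and \<delta> :: nat
  assumes det: "a * e - b * c = 1" and \<delta>: "\<delta> > 0"
  obtains B Y where "Y > 0" "\<And>z. Im z \<ge> Y \<Longrightarrow>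
     norm (of_nat \<delta> * eis2 (of_nat \<delta> * mob a b c e z) - kappa * of_int c * (jac c e z))
       \<le> B * norm (jac c e z) ^ 2"
proof -
  obtain a' b' c' d' A B D where h: "a' * d' - b' * c' = 1" "A > 0" "D > 0" "A * D = int \<delta>" "c' * A = c"
    "\<And>z. Im z > 0 \<Longrightarrow> of_nat \<delta> * mob a b c e z = mob a' b' c' d' ((of_int A * z + of_int B) / of_int D)"
    "\<And>z. Im z > 0 \<Longrightarrow> of_int c' * ((of_int A * z + of_int B) / of_int D) + of_int d' = (jac c e z) / of_int D"
    by (rule mob_dilate[OF det \<delta>]) blast
  obtain K where K: "K > 0" "\<And>z. Im z \<ge> 1 \<Longrightarrow> norm (eis2 z) \<le> K" using eis2_bounded by blast
  show ?thesis
  proof (rule that[of "of_int D" "of_nat \<delta> * K / of_int D ^ 2"])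
    show "0 < real_of_int D" using h by simp
    fix z assume z: "Im z \<ge> real_of_int D"
    define w where "w = (of_int A * z + of_int B) / of_int D"
    have zpos: "Im z > 0" using z h(3) by linarith
    have w: "Im w \<ge> 1" unfolding w_def by (rule Im_linear_ge[OF h(2,3) z])
    have "of_nat \<delta> * eis2 (of_nat \<delta> * mob a b c e z) =
        of_nat \<delta> * (((jac c e z) / of_int D) ^ 2 * eis2 w + kappa * of_int c' * ((jac c e z) / of_int D))"
      unfolding h(6)[OF zpos] w_def [symmetric] using eis2_mob[OF h(1), of w] w
      by (simp add: h(7)[OF zpos, folded w_def])
    also have "\<dots> = of_nat \<delta> / of_int D ^ 2 * ((jac c e z) ^ 2 * eis2 w)
        + kappa * (of_int c' * of_nat \<delta> / of_int D) * (jac c e z)"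
      by (simp add: field_simps power_divide)
    also have "of_int c' * of_nat \<delta> / of_int D = (of_int c :: complex)"
    proof -
      have "complex_of_nat \<delta> = of_int (A * D)" by (simp only: h(4) of_int_of_nat_eq)
      thus ?thesis using h(3) by (simp add: h(5)[symmetric])
    qed
    finally have "norm (of_nat \<delta> * eis2 (of_nat \<delta> * mob a b c e z) - kappa * of_int c * (jac c e z))
      = of_nat \<delta> / of_int D ^ 2 * (norm (jac c e z) ^ 2 * norm (eis2 w))"
      by (simp add: norm_mult norm_divide norm_power)
    also have "\<dots> \<le> of_nat \<delta> / of_int D ^ 2 * (norm (jac c e z) ^ 2 * K)"
      using K(2)[OF w] by (intro mult_left_mono) auto
    finally show "norm (of_nat \<delta> * eis2 (of_nat \<delta> * mob a b c e z) - kappa * of_int c * (jac c e z))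
      \<le> of_nat \<delta> * K / of_int D ^ 2 * norm (jac c e z) ^ 2"
      by (simp add: mult_ac)
  qed
qed

lemma modform_eis2_diff:
  assumes "N > 0" "\<delta> dvd N"
  shows "modform N 2 (\<lambda>z. eis2 z - of_nat \<delta> * eis2 (of_nat \<delta> * z))"
proof (rule modformI, goal_cases)
  have \<delta>: "\<delta> > 0" using assms by (auto intro: Nat.gr0I)
  case 1
  show ?case
    by (intro holomorphic_intros holomorphic_on_eis2 holomorphic_on_dilate \<delta>)
next
  have \<delta>: "\<delta> > 0" using assms by (auto intro: Nat.gr0I)
  case (2 a b c d z)
  have dvd: "int \<delta> dvd c" using assms(2) 2(2) by (meson dvd_trans of_nat_dvd_iff)
  note m = mob_dilate_dvd[OF 2(1) \<delta> dvd 2(3)]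
  have "of_nat \<delta> * (of_int (c div int \<delta>) :: complex) = of_int (int \<delta> * (c div int \<delta>))" by simp
  also have "int \<delta> * (c div int \<delta>) = c" using dvd by simp
  finally have c: "of_nat \<delta> * (of_int (c div int \<delta>) :: complex) = of_int c" .
  have "of_nat \<delta> * eis2 (of_nat \<delta> * mob a b c d z) = (jac c d z) ^ 2 * (of_nat \<delta> * eis2 (of_nat \<delta> * z))
      + kappa * (of_nat \<delta> * of_int (c div int \<delta>)) * (jac c d z)"
    unfolding m(1) eis2_mob[OF m(2) Im_of_nat_mult_pos[OF \<delta> 2(3)]] m(3) by (simp add: algebra_simps)
  thus ?case unfolding c by (simp add: eis2_mob[OF 2(1,3)] algebra_simps)
next
  have \<delta>: "\<delta> > 0" using assms by (auto intro: Nat.gr0I)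
  case (3 a b c d)
  define r where "r = (\<lambda>z. kappa * of_int c * (jac c d z))"
  obtain B Y where 1: "Y > 0" "\<And>z. Im z \<ge> Y \<Longrightarrow> norm (eis2 (mob a b c d z) - r z)
       \<le> B * norm (jac c d z) ^ 2"
    using eis2_dilate_slash_bounded[OF 3, of 1] unfolding r_def by simp blast
  obtain B' Y' where 2: "Y' > 0" "\<And>z. Im z \<ge> Y' \<Longrightarrow> norm (of_nat \<delta> * eis2 (of_nat \<delta> * mob a b c d z) - r z)
       \<le> B' * norm (jac c d z) ^ 2"
    using eis2_dilate_slash_bounded[OF 3 \<delta>] unfolding r_def by blast
  show ?case
  proof (intro exI conjI allI impI)
    fix z assume "Im z \<ge> max Y Y'"
    hence "norm (eis2 (mob a b c d z) - r z) \<le> B * norm (jac c d z) ^ 2"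
        "norm (of_nat \<delta> * eis2 (of_nat \<delta> * mob a b c d z) - r z) \<le> B' * norm (jac c d z) ^ 2"
      using 1(2) 2(2) by auto
    moreover have "norm (eis2 (mob a b c d z) - of_nat \<delta> * eis2 (of_nat \<delta> * mob a b c d z))
       \<le> norm (eis2 (mob a b c d z) - r z) + norm (of_nat \<delta> * eis2 (of_nat \<delta> * mob a b c d z) - r z)"
      using norm_triangle_ineq4[of "eis2 (mob a b c d z) - r z" "of_nat \<delta> * eis2 (of_nat \<delta> * mob a b c d z) - r z"] by simp
    ultimately show "norm (eis2 (mob a b c d z) - of_nat \<delta> * eis2 (of_nat \<delta> * mob a b c d z))
       \<le> (B + B') * norm (jac c d z) ^ 2"
      by (simp add: algebra_simps)
  qed (use 1 2 in auto)
qed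

section \<open>The Eisenstein series of weight four\<close>

definition eis4_fps :: "complex fps" where
  "eis4_fps = Abs_fps (\<lambda>n. if n = 0 then 1 else 240 * of_nat (sigmak 3 n))"

definition eis4 :: "complex \<Rightarrow> complex" where
  "eis4 z = eval_fps eis4_fps (qexp z)"

text \<open>Ramanujan's equation, M = L^2 - 12 q dL/dq with L = 1 - 24 S, in coefficients; for n > 0
  this is \<open>sigma_convolution\<close>.\<close>

lemma eis4_fps_eq: "eis4_fps = (1 - 24 * sigma_fps) ^ 2 + 288 * (fps_X * fps_deriv sigma_fps)"
proof (rule fps_ext)
  fix n
  show "fps_nth eis4_fps n = fps_nth ((1 - 24 * sigma_fps) ^ 2 + 288 * (fps_X * fps_deriv sigma_fps)) n"
  proof (cases "n = 0")
    case True
    thus ?thesis by (simp add: eis4_fps_def sigma_fps_def sigmak_def fps_mult_nth power2_eq_square numeral_fps_const)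
  next
    case False
    have sq: "(1 - 24 * sigma_fps) ^ 2 = 1 - 48 * sigma_fps + 576 * (sigma_fps * sigma_fps)"
      by (simp add: power2_eq_square algebra_simps)
    have conv: "12 * fps_nth (sigma_fps * sigma_fps) n = 5 * of_nat (sigmak 3 n) + (1 - 6 * of_nat n) * of_nat (sigmak 1 n)"
    proof -
      have "12 * fps_nth (sigma_fps * sigma_fps) n =
         of_real (12 * (\<Sum>k\<le>n. real (sigmak 1 k) * real (sigmak 1 (n - k))))"
        by (simp add: fps_mult_nth sigma_fps_def atMost_atLeast0)
      also have "\<dots> = 5 * of_nat (sigmak 3 n) + (1 - 6 * of_nat n) * of_nat (sigmak 1 n)"
        using False by (subst sigma_convolution) auto
      finally show ?thesis .
    qed
    define D where "D = fps_X * fps_deriv sigma_fps"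
    have X: "fps_nth D n = of_nat n * of_nat (sigmak 1 n)"
      using False by (cases n) (auto simp: D_def sigma_fps_def simp del: of_nat_Suc)
    have "fps_nth ((1 - 24 * sigma_fps) ^ 2 + 288 * D) n =
       - 48 * fps_nth sigma_fps n + 48 * (12 * fps_nth (sigma_fps * sigma_fps) n) + 288 * fps_nth D n"
      using False unfolding sq by (simp add: fps_mult_numeral_left)
    also have "\<dots> = 240 * of_nat (sigmak 3 n)"
      unfolding conv X by (simp add: sigma_fps_def algebra_simps)
    finally show ?thesis using False by (simp add: eis4_fps_def D_def)
  qed
qed

lemma fps_conv_radius_X_deriv_sigma: "fps_conv_radius (fps_X * fps_deriv sigma_fps) \<ge> 1"
  using order.trans[OF fps_conv_radius_sigma_fps fps_conv_radius_deriv]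
  by (intro order.trans[OF _ fps_conv_radius_mult]) auto

lemma fps_conv_radius_eis2_fps: "fps_conv_radius (1 - 24 * sigma_fps) \<ge> 1"
  using fps_conv_radius_sigma_fps
  by (intro order.trans[OF _ fps_conv_radius_diff] min.boundedI order.trans[OF _ fps_conv_radius_mult]) auto

lemma fps_conv_radius_numeral_mult:
  "fps_conv_radius F \<ge> (1 :: ereal) \<Longrightarrow> fps_conv_radius (numeral n * F :: complex fps) \<ge> 1"
  by (rule order.trans[OF _ fps_conv_radius_mult]) auto

lemma fps_conv_radius_eis4_fps: "fps_conv_radius eis4_fps \<ge> 1"
proof -
  have "fps_conv_radius ((1 - 24 * sigma_fps) ^ 2) \<ge> 1"
    by (rule order.trans[OF fps_conv_radius_eis2_fps fps_conv_radius_power])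
  moreover have "fps_conv_radius (288 * (fps_X * fps_deriv sigma_fps)) \<ge> 1"
    by (rule fps_conv_radius_numeral_mult[OF fps_conv_radius_X_deriv_sigma])
  ultimately show ?thesis
    unfolding eis4_fps_eq by (intro order.trans[OF _ fps_conv_radius_add]) simp
qed

lemma eval_eis2_fps:
  assumes "Im z > 0"
  shows "eval_fps (1 - 24 * sigma_fps) (qexp z) = eis2 z"
proof -
  have r: "ereal (norm (qexp z)) < fps_conv_radius sigma_fps"
    by (rule qexp_less_conv_radius[OF fps_conv_radius_sigma_fps assms])
  have "fps_conv_radius (24 * sigma_fps) \<ge> fps_conv_radius sigma_fps"
    by (intro order.trans[OF _ fps_conv_radius_mult]) auto
  hence r2: "ereal (norm (qexp z)) < fps_conv_radius (24 * sigma_fps)" using r by (rule order.strict_trans2[rotated])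
  have "eval_fps (1 - 24 * sigma_fps) (qexp z) = 1 - eval_fps (24 * sigma_fps) (qexp z)"
    using r2 by (subst eval_fps_diff) auto
  also have "eval_fps (24 * sigma_fps) (qexp z) = 24 * eval_fps sigma_fps (qexp z)"
    using r by (subst eval_fps_mult) auto
  finally show ?thesis by (simp add: eval_fps_sigma_fps)
qed

definition eis2_deriv :: "complex \<Rightarrow> complex" where
  "eis2_deriv z = 2 * of_real pi * \<i> * (- 24 * eval_fps (fps_X * fps_deriv sigma_fps) (qexp z))"

lemma eis2_has_field_derivative:
  assumes "Im z > 0"
  shows "(eis2 has_field_derivative eis2_deriv z) (at z)"
proof -
  have "((\<lambda>z. 1 - 24 * eval_fps sigma_fps (qexp z)) has_field_derivative
     0 - 24 * (2 * of_real pi * \<i> * eval_fps (fps_X * fps_deriv sigma_fps) (qexp z))) (at z)"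
    by (intro DERIV_diff DERIV_const DERIV_cmult eval_fps_qexp_has_field_derivative fps_conv_radius_sigma_fps assms)
  thus ?thesis by (simp add: eval_fps_sigma_fps [abs_def] eis2_deriv_def algebra_simps)
qed

lemma eis4_conv_eis2:
  assumes "Im z > 0"
  shows "eis4 z = eis2 z ^ 2 - kappa * eis2_deriv z"
proof -
  have r1: "ereal (norm (qexp z)) < fps_conv_radius (1 - 24 * sigma_fps)"
    by (rule qexp_less_conv_radius[OF fps_conv_radius_eis2_fps assms])
  have r2: "ereal (norm (qexp z)) < fps_conv_radius (fps_X * fps_deriv sigma_fps)"
    by (rule qexp_less_conv_radius[OF fps_conv_radius_X_deriv_sigma assms])
  have r3: "ereal (norm (qexp z)) < fps_conv_radius ((1 - 24 * sigma_fps) ^ 2)"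
    by (rule order.strict_trans2[OF r1 fps_conv_radius_power])
  have "fps_conv_radius (288 * (fps_X * fps_deriv sigma_fps)) \<ge> fps_conv_radius (fps_X * fps_deriv sigma_fps)"
    by (intro order.trans[OF _ fps_conv_radius_mult]) auto
  hence r4: "ereal (norm (qexp z)) < fps_conv_radius (288 * (fps_X * fps_deriv sigma_fps))"
    using r2 by (rule order.strict_trans2[rotated])
  have "eis4 z = eval_fps ((1 - 24 * sigma_fps) ^ 2) (qexp z) + eval_fps (288 * (fps_X * fps_deriv sigma_fps)) (qexp z)"
    unfolding eis4_def eis4_fps_eq by (rule eval_fps_add[OF r3 r4])
  also have "eval_fps ((1 - 24 * sigma_fps) ^ 2) (qexp z) = eis2 z ^ 2"
    using r1 by (simp add: eval_fps_power eval_eis2_fps[OF assms])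
  also have "eval_fps (288 * (fps_X * fps_deriv sigma_fps)) (qexp z) = 288 * eval_fps (fps_X * fps_deriv sigma_fps) (qexp z)"
    using r2 by (subst eval_fps_mult) auto
  also have "\<dots> = - kappa * eis2_deriv z"
    by (simp add: kappa_def eis2_deriv_def)
  finally show ?thesis by simp
qed

text \<open>Differentiating \<open>eis2_mob\<close> gives the law for the derivative. In
  \<open>eis2^2 - kappa * eis2_deriv\<close> the terms in c and c^2 then cancel, and only the factor
  of weight four is left.\<close>

lemma eis4_mob:
  assumes det: "a * d - b * c = (1 :: int)" and z: "Im z > 0"
  shows "eis4 (mob a b c d z) = (jac c d z) ^ 4 * eis4 z"
proof -
  define u where "u = of_int c * z + of_int d"
  have u: "u \<noteq> 0" unfolding u_def by (rule mob_denom_nonzero[OF assms])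
  have "((\<lambda>z. eis2 (mob a b c d z)) has_field_derivative eis2_deriv (mob a b c d z) * (1 / u ^ 2)) (at z)"
    unfolding u_def by (rule DERIV_chain2[OF eis2_has_field_derivative[OF Im_mob_pos[OF assms]] mob_has_field_derivative[OF assms]])
  moreover have "((\<lambda>z. eis2 (mob a b c d z)) has_field_derivative
      2 * u * of_int c * eis2 z + u ^ 2 * eis2_deriv z + kappa * of_int c * of_int c) (at z)"
  proof (rule has_field_derivative_transform_within_open)
    show "((\<lambda>z. (jac c d z) ^ 2 * eis2 z + kappa * of_int c * (jac c d z)) has_field_derivative
      2 * u * of_int c * eis2 z + u ^ 2 * eis2_deriv z + kappa * of_int c * of_int c) (at z)"
      by (rule derivative_eq_intros eis2_has_field_derivative[OF z] refl | simp)+ (simp add: u_def algebra_simps power2_eq_square)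
    show "open uhp" by simp
    show "z \<in> uhp" using z by simp
    show "(jac c d x) ^ 2 * eis2 x + kappa * of_int c * (jac c d x) = eis2 (mob a b c d x)"
      if "x \<in> uhp" for x
      using eis2_mob[OF det, of x] that by simp
  qed
  ultimately have "eis2_deriv (mob a b c d z) * (1 / u ^ 2) = 2 * u * of_int c * eis2 z + u ^ 2 * eis2_deriv z + kappa * of_int c * of_int c"
    by (rule DERIV_unique)
  hence D: "eis2_deriv (mob a b c d z) = u ^ 2 * (2 * u * of_int c * eis2 z + u ^ 2 * eis2_deriv z + kappa * of_int c * of_int c)"
    using u by (simp add: field_simps)
  show ?thesis
    unfolding eis4_conv_eis2[OF Im_mob_pos[OF assms]] eis4_conv_eis2[OF z] D eis2_mob[OF assms] u_def [symmetric]
    by (simp add: algebra_simps power2_eq_square power4_eq_xxxx)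
qed

lemma modform_eis4:
  assumes "N > 0" "\<delta> dvd N"
  shows "modform N 4 (\<lambda>z. eis4 (of_nat \<delta> * z))"
proof (rule modformI, goal_cases)
  have \<delta>: "\<delta> > 0" using assms by (auto intro: Nat.gr0I)
  case 1
  show ?case
    unfolding eis4_def by (intro holomorphic_on_dilate holomorphic_on_eval_fps_qexp fps_conv_radius_eis4_fps \<delta>)
next
  have \<delta>: "\<delta> > 0" using assms by (auto intro: Nat.gr0I)
  case (2 a b c d z)
  have dvd: "int \<delta> dvd c" using assms(2) 2(2) by (meson dvd_trans of_nat_dvd_iff)
  note m = mob_dilate_dvd[OF 2(1) \<delta> dvd 2(3)]
  show ?case unfolding m(1) eis4_mob[OF m(2) Im_of_nat_mult_pos[OF \<delta> 2(3)]] m(3) ..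
next
  have \<delta>: "\<delta> > 0" using assms by (auto intro: Nat.gr0I)
  case (3 a b c e)
  obtain a' b' c' d' A B D where h: "a' * d' - b' * c' = 1" "A > 0" "D > 0" 
    "\<And>z. Im z > 0 \<Longrightarrow> of_nat \<delta> * mob a b c e z = mob a' b' c' d' ((of_int A * z + of_int B) / of_int D)"
    "\<And>z. Im z > 0 \<Longrightarrow> of_int c' * ((of_int A * z + of_int B) / of_int D) + of_int d' = (jac c e z) / of_int D"
    by (rule mob_dilate[OF 3 \<delta>]) blast
  obtain K where K: "K > 0" "\<And>z. Im z \<ge> 1 \<Longrightarrow> norm (eis4 z) \<le> K"
    using eval_fps_qexp_bounded[OF fps_conv_radius_eis4_fps, of 1] unfolding eis4_def by auto
  show ?case
  proof (intro exI conjI allI impI)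
    show "0 < real_of_int D" using h by simp
    fix z assume z: "Im z \<ge> real_of_int D"
    define w where "w = (of_int A * z + of_int B) / of_int D"
    have zpos: "Im z > 0" using z h(3) by linarith
    have w: "Im w \<ge> 1" unfolding w_def by (rule Im_linear_ge[OF h(2,3) z])
    have "eis4 (of_nat \<delta> * mob a b c e z) = ((jac c e z) / of_int D) ^ 4 * eis4 w"
      unfolding h(4)[OF zpos] w_def [symmetric] using eis4_mob[OF h(1), of w] w
      by (simp add: h(5)[OF zpos, folded w_def])
    hence "norm (eis4 (of_nat \<delta> * mob a b c e z)) = norm (jac c e z) ^ 4 * (norm (eis4 w) / of_int D ^ 4)"
      using h(3) by (simp add: norm_mult norm_divide norm_power power_divide)
    also have "\<dots> \<le> norm (jac c e z) ^ 4 * (K / of_int D ^ 4)"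
      using K(2)[OF w] h(3) by (intro mult_left_mono divide_right_mono) auto
    finally show "norm (eis4 (of_nat \<delta> * mob a b c e z)) \<le> K / of_int D ^ 4 * norm (jac c e z) ^ 4"
      by (simp add: mult_ac)
  qed
qed

section \<open>Eta quotients\<close>

definition eta_quot :: "nat set \<Rightarrow> (nat \<Rightarrow> int) \<Rightarrow> complex \<Rightarrow> complex" where
  "eta_quot D s z = (\<Prod>\<delta>\<in>D. (eta (of_nat \<delta> * z) ^ 2) powi s \<delta>)"

lemma prod_powi_eq_powi_sum:
  fixes x :: "'a :: field"
  assumes "x \<noteq> 0"
  shows "(\<Prod>i\<in>D. x powi f i) = x powi (\<Sum>i\<in>D. f i)"
  using assms by (induction D rule: infinite_finite_induct) (auto simp: power_int_add)

lemma prod_root12: "(\<Prod>i\<in>D. root12 (f i)) = root12 (\<Sum>i\<in>D. f i)"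
  by (induction D rule: infinite_finite_induct) (auto simp: root12_add)

lemma holomorphic_on_eta_quot:
  assumes "\<And>\<delta>. \<delta> \<in> D \<Longrightarrow> \<delta> > 0"
  shows "eta_quot D s holomorphic_on uhp"
  unfolding eta_quot_def [abs_def]
  by (intro holomorphic_on_prod holomorphic_on_power_int holomorphic_on_power holomorphic_on_dilate holomorphic_on_eta)
     (use assms in auto)

lemma norm_eta_squared:
  "norm (eta z ^ 2) = exp (- (pi / 6) * Im z) * exp (- 2 * Re (eval_fps log_eta_fps (qexp z)))"
  by (simp add: eta_def norm_power exp_of_nat_mult [symmetric] exp_add [symmetric] Re_divide_numeral algebra_simps)

text \<open>The sum of both end values bounds the power for either sign of the exponent.\<close>

lemma powi_bound:
  fixes R :: real
  assumes "0 < K1" "K1 \<le> R" "R \<le> K2"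
  shows "R powi m \<le> K1 powi m + K2 powi m"
proof (cases "m \<ge> 0")
  case True
  hence "R powi m \<le> K2 powi m" using assms by (auto simp: power_int_def intro: power_mono)
  thus ?thesis using assms by (intro add_increasing) auto
next
  case False
  hence "R powi m \<le> K1 powi m"
    using assms by (auto simp: power_int_def intro!: power_mono le_imp_inverse_le)
  thus ?thesis using assms by (intro add_increasing2) auto
qed

text \<open>By \<open>mob_dilate\<close> the argument reduces to w = (A z + B) / D with A = gcd(c,
  \<delta>) and A D = \<delta>, so Im w is Im z times gcd(c, \<delta>)^2 / \<delta>. The exponential
  factor is the leading power of q at the cusp; the rest of the product is bounded above and away
  from zero.\<close>

lemma eta_dilate_powi_bounded:
  fixes a b c e m :: int and \<delta> :: nat
  assumes det: "a * e - b * c = 1" and \<delta>: "\<delta> > 0"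
  shows "\<exists>K Y. Y > 0 \<and> (\<forall>z. Im z \<ge> Y \<longrightarrow>
     norm ((eta (of_nat \<delta> * mob a b c e z) ^ 2) powi m) \<le>
     K * (norm (jac c e z) powi m * exp (- (pi / 6) * Im z * (of_int m * of_int (gcd c (int \<delta>)) ^ 2 / of_nat \<delta>))))"
proof -
  obtain a' b' c' d' A B D where h: "a' * d' - b' * c' = 1" "A = gcd c (int \<delta>)" "A > 0" "D > 0" "A * D = int \<delta>" 
    "\<And>z. Im z > 0 \<Longrightarrow> of_nat \<delta> * mob a b c e z = mob a' b' c' d' ((of_int A * z + of_int B) / of_int D)"
    "\<And>z. Im z > 0 \<Longrightarrow> of_int c' * ((of_int A * z + of_int B) / of_int D) + of_int d' = (jac c e z) / of_int D"
    by (rule mob_dilate[OF det \<delta>]) blast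
  obtain L where L: "L > 0" "\<And>z. Im z \<ge> 1 \<Longrightarrow> norm (eval_fps log_eta_fps (qexp z)) \<le> L"
    using eval_fps_qexp_bounded[OF fps_conv_radius_log_eta_fps, of 1] by auto
  define K1 where "K1 = exp (- 2 * L) / of_int D"
  define K2 where "K2 = exp (2 * L) / of_int D"
  show ?thesis
  proof (intro exI conjI allI impI)
    show "0 < real_of_int D" using h by simp
    fix z assume z: "Im z \<ge> real_of_int D"
    define w where "w = (of_int A * z + of_int B) / of_int D"
    define R where "R = exp (- 2 * Re (eval_fps log_eta_fps (qexp w))) / of_int D"
    define E where "E = exp (- (pi / 6) * Im z * (of_int (gcd c (int \<delta>)) ^ 2 / of_nat \<delta>))"
    define j where "j = of_int c * z + of_int e"
    have zpos: "Im z > 0" using z h(4) by linarith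
    have w: "Im w \<ge> 1" unfolding w_def by (rule Im_linear_ge[OF h(3,4) z])
    have "\<bar>Re (eval_fps log_eta_fps (qexp w))\<bar> \<le> L"
      using L(2)[OF w] abs_Re_le_cmod order.trans by blast
    hence R: "K1 \<le> R" "R \<le> K2"
      unfolding K1_def K2_def R_def using h(4) by (auto intro!: divide_right_mono)
    have "real_of_int (A * D) = real \<delta>" by (simp only: h(5) of_int_of_nat_eq)
    hence AD: "real \<delta> = of_int A * of_int D" by simp
    have "Im w = Im z * (of_int (gcd c (int \<delta>)) ^ 2 / of_nat \<delta>)"
      unfolding w_def Im_linear AD h(2)[symmetric] using h(3,4) by (simp add: power2_eq_square)
    hence E: "exp (- (pi / 6) * Im w) = E" by (simp add: E_def)
    have "eta (of_nat \<delta> * mob a b c e z) ^ 2 = root12 (eta_char a' b' c' d') * (j / of_int D) * eta w ^ 2"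
      unfolding h(6)[OF zpos] w_def [symmetric] j_def h(7)[OF zpos, folded w_def, symmetric]
      by (rule eta_mob[OF h(1)]) (use w in simp)
    hence "norm (eta (of_nat \<delta> * mob a b c e z) ^ 2) = norm (j / of_int D) * norm (eta w ^ 2)"
      by (simp only: norm_mult norm_root12 mult_1)
    also have "\<dots> = R * (norm j * E)"
      unfolding norm_eta_squared E using h(4) by (simp add: R_def norm_divide)
    finally have "norm ((eta (of_nat \<delta> * mob a b c e z) ^ 2) powi m) = R powi m * (norm j powi m * E powi m)"
      by (simp add: norm_power_int power_int_mult_distrib)
    also have "\<dots> \<le> (K1 powi m + K2 powi m) * (norm j powi m * E powi m)"
      using R h(4) by (intro mult_right_mono powi_bound) (auto simp: K1_def E_def)
    also have "E powi m = exp (- (pi / 6) * Im z * (of_int m * of_int (gcd c (int \<delta>)) ^ 2 / of_nat \<delta>))"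
      unfolding E_def exp_power_int by (simp add: mult_ac)
    finally show "norm ((eta (of_nat \<delta> * mob a b c e z) ^ 2) powi m) \<le> (K1 powi m + K2 powi m) *
       (norm (jac c e z) powi m * exp (- (pi / 6) * Im z * (of_int m * of_int (gcd c (int \<delta>)) ^ 2 / of_nat \<delta>)))"
      unfolding j_def .
  qed
qed

text \<open>The hypothesis \<open>char\<close> says that the multipliers of the factors cancel on
  the congruence subgroup. The sum in \<open>order\<close> is, up to a positive factor, Ligozat's
  formula for the order at a cusp with denominator c, so its sign decides whether the quotient is
  bounded there.\<close>

lemma modform_eta_quot:
  assumes N: "N > 0" and D: "finite D" "\<And>\<delta>. \<delta> \<in> D \<Longrightarrow> \<delta> dvd N" and k: "(\<Sum>\<delta>\<in>D. s \<delta>) = int k"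
    and char: "\<And>a b c e. a * e - b * c = 1 \<Longrightarrow> int N dvd c \<Longrightarrow>
       12 dvd (\<Sum>\<delta>\<in>D. eta_char a (b * int \<delta>) (c div int \<delta>) e * s \<delta>)"
    and order: "\<And>c. (\<Sum>\<delta>\<in>D. of_int (s \<delta>) * of_int (gcd c (int \<delta>)) ^ 2 / of_nat \<delta>) \<ge> (0 :: real)"
  shows "modform N k (eta_quot D s)"
proof (rule modformI, goal_cases)
  have pos: "\<delta> > 0" if "\<delta> \<in> D" for \<delta> using N D(2)[OF that] by (auto intro: Nat.gr0I)
  case 1
  show ?case using pos by (rule holomorphic_on_eta_quot)
next
  have pos: "\<delta> > 0" if "\<delta> \<in> D" for \<delta> using N D(2)[OF that] by (auto intro: Nat.gr0I)
  case (2 a b c e z)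
  define j where "j = of_int c * z + of_int e"
  have j: "j \<noteq> 0" unfolding j_def by (rule mob_denom_nonzero[OF 2(1,3)])
  have "(eta (of_nat \<delta> * mob a b c e z) ^ 2) powi s \<delta> =
     root12 (eta_char a (b * int \<delta>) (c div int \<delta>) e * s \<delta>) * (j powi s \<delta> * (eta (of_nat \<delta> * z) ^ 2) powi s \<delta>)"
    if "\<delta> \<in> D" for \<delta>
  proof -
    have dvd: "int \<delta> dvd c" using D(2)[OF that] 2(2) by (meson dvd_trans of_nat_dvd_iff)
    note m = mob_dilate_dvd[OF 2(1) pos[OF that] dvd 2(3)]
    have "eta (of_nat \<delta> * mob a b c e z) ^ 2 = root12 (eta_char a (b * int \<delta>) (c div int \<delta>) e) * j * eta (of_nat \<delta> * z) ^ 2"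
      unfolding m(1) eta_mob[OF m(2) Im_of_nat_mult_pos[OF pos[OF that] 2(3)]] m(3) j_def ..
    thus ?thesis by (simp only: power_int_mult_distrib root12_power_int mult.assoc)
  qed
  hence "eta_quot D s (mob a b c e z) =
     (\<Prod>\<delta>\<in>D. root12 (eta_char a (b * int \<delta>) (c div int \<delta>) e * s \<delta>)) * ((\<Prod>\<delta>\<in>D. j powi s \<delta>) * eta_quot D s z)"
    unfolding eta_quot_def prod.distrib [symmetric] by (intro prod.cong) auto
  also have "(\<Prod>\<delta>\<in>D. root12 (eta_char a (b * int \<delta>) (c div int \<delta>) e * s \<delta>)) = 1"
    unfolding prod_root12 using root12_cong[of _ 0] char[OF 2(1,2)] by simp
  also have "(\<Prod>\<delta>\<in>D. j powi s \<delta>) = j ^ k"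
    unfolding prod_powi_eq_powi_sum[OF j] k by simp
  finally show ?case by (simp add: j_def)
next
  have pos: "\<delta> > 0" if "\<delta> \<in> D" for \<delta> using N D(2)[OF that] by (auto intro: Nat.gr0I)
  case (3 a b c e)
  define G where "G = (\<lambda>\<delta>. real_of_int (s \<delta>) * of_int (gcd c (int \<delta>)) ^ 2 / of_nat \<delta>)"
  have "\<forall>\<delta>\<in>D. \<exists>K Y. Y > 0 \<and> (\<forall>z. Im z \<ge> Y \<longrightarrow> norm ((eta (of_nat \<delta> * mob a b c e z) ^ 2) powi s \<delta>) \<le>
     K * (norm (jac c e z) powi s \<delta> * exp (- (pi / 6) * Im z * G \<delta>)))"
    unfolding G_def using eta_dilate_powi_bounded[OF 3] pos by blast
  then obtain K Y where KY: "\<And>\<delta>. \<delta> \<in> D \<Longrightarrow> Y \<delta> > 0" "\<And>\<delta> z. \<delta> \<in> D \<Longrightarrow> Im z \<ge> Y \<delta> \<Longrightarrow> norm ((eta (of_nat \<delta> * mob a b c e z) ^ 2) powi s \<delta>) \<le>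
     K \<delta> * (norm (jac c e z) powi s \<delta> * exp (- (pi / 6) * Im z * G \<delta>))"
    by metis
  define M where "M = 1 + (\<Sum>\<delta>\<in>D. Y \<delta>)"
  have M: "Y \<delta> \<le> M" if "\<delta> \<in> D" for \<delta>
    unfolding M_def using member_le_sum[OF that, of Y] D(1) KY(1) by force
  have M1: "M \<ge> 1" unfolding M_def using KY(1) by (simp add: sum_nonneg less_imp_le)
  show ?case
  proof (intro exI conjI allI impI)
    show "0 < M" using M1 by simp
    fix z assume z: "Im z \<ge> M"
    have zpos: "Im z > 0" using z M1 by linarith
    define j where "j = norm (jac c e z)"
    have j: "j > 0" unfolding j_def using mob_denom_nonzero[OF 3 zpos] by simp
    have "norm (eta_quot D s (mob a b c e z)) = (\<Prod>\<delta>\<in>D. norm ((eta (of_nat \<delta> * mob a b c e z) ^ 2) powi s \<delta>))"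
      unfolding eta_quot_def by (rule prod_norm [symmetric])
    also have "\<dots> \<le> (\<Prod>\<delta>\<in>D. K \<delta> * (j powi s \<delta> * exp (- (pi / 6) * Im z * G \<delta>)))"
      unfolding j_def using KY(2) M z by (intro prod_mono) force
    also have "\<dots> = prod K D * (j ^ k * exp (\<Sum>\<delta>\<in>D. - (pi / 6) * Im z * G \<delta>))"
      using D(1) j by (simp add: prod.distrib prod_powi_eq_powi_sum k exp_sum)
    also have "(\<Sum>\<delta>\<in>D. - (pi / 6) * Im z * G \<delta>) = - (pi / 6) * Im z * (\<Sum>\<delta>\<in>D. G \<delta>)"
      by (rule sum_distrib_left [symmetric])
    finally have 1: "norm (eta_quot D s (mob a b c e z)) \<le> prod K D * (j ^ k * exp (- (pi / 6) * Im z * (\<Sum>\<delta>\<in>D. G \<delta>)))" .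
    have "exp (- (pi / 6) * Im z * (\<Sum>\<delta>\<in>D. G \<delta>)) \<le> 1"
      using order[of c] zpos unfolding G_def by simp
    hence 2: "j ^ k * exp (- (pi / 6) * Im z * (\<Sum>\<delta>\<in>D. G \<delta>)) \<le> j ^ k * 1"
      using j by (intro mult_left_mono) auto
    have "prod K D * (j ^ k * exp (- (pi / 6) * Im z * (\<Sum>\<delta>\<in>D. G \<delta>))) \<le> \<bar>prod K D\<bar> * (j ^ k * 1)"
      using 2 j by (intro mult_mono) auto
    with 1 show "norm (eta_quot D s (mob a b c e z)) \<le> \<bar>prod K D\<bar> * norm (jac c e z) ^ k"
      by (simp add: j_def)
  qed
qed

section \<open>A vanishing criterion at level 22\<close>

lemma invariant_mob:
  assumes T: "\<And>z. Im z > 0 \<Longrightarrow> F (z + 1) = F z" and S: "\<And>z. Im z > 0 \<Longrightarrow> F (- 1 / z) = F z"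
    and "a * d - b * c = (1 :: int)" "Im z > 0"
  shows "F (mob a b c d z) = F z"
  using assms(3,4)
proof (induction a b c d arbitrary: z rule: sl2z_induct)
  case one
  thus ?case by (simp add: mob_def)
next
  case (S a b c d)
  thus ?case using mob_S[of a d b c z] S.IH[of "- 1 / z"] Im_minus_inverse_pos[of z] assms(2) by simp
next
  case (T a b c d)
  thus ?case using T.IH[of "z + 1"] assms(1)[of z] by (simp add: mob_T)
qed

text \<open>Choosing the bottom row \<open>(c, d)\<close> with \<open>|c z + d|\<close> minimal maximises the imaginary part in the orbit.\<close>
lemma fundamental_domain_rep:
  assumes z: "Im z > 0"
  obtains a b c d :: int where "a * d - b * c = 1"
    "\<bar>Re (mob a b c d z)\<bar> \<le> 1/2" "Im (mob a b c d z) \<ge> 1/2"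
proof -
  obtain C where C: "C > 0" "\<And>m r :: real. norm (of_real m * z + of_real r) \<ge> C * (\<bar>m\<bar> + \<bar>r\<bar>)"
    using norm_lattice_lower_bound[OF z] by blast
  \<comment> \<open>The bound 1 makes the set finite, and (0, 1) belongs to it, so that the minimum
    over \<open>V\<close> is the minimum over all bottom rows.\<close>
  define V where "V = {(c :: int, d :: int). (\<exists>a b. a * d - b * c = 1) \<and> norm (jac c d z) \<le> 1}"
  have "V \<subseteq> {- \<lceil>1 / C\<rceil>..\<lceil>1 / C\<rceil>} \<times> {- \<lceil>1 / C\<rceil>..\<lceil>1 / C\<rceil>}"
  proof (safe)
    fix c d assume "(c, d) \<in> V"
    hence "C * (\<bar>of_int c\<bar> + \<bar>of_int d\<bar>) \<le> 1"
      using C(2)[of "of_int c" "of_int d"] by (auto simp: V_def)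
    hence "\<bar>real_of_int c\<bar> + \<bar>real_of_int d\<bar> \<le> 1 / C" using C(1) by (simp add: field_simps)
    hence "\<bar>real_of_int c\<bar> \<le> 1 / C" "\<bar>real_of_int d\<bar> \<le> 1 / C" by linarith+
    thus "c \<in> {- \<lceil>1 / C\<rceil>..\<lceil>1 / C\<rceil>}" "d \<in> {- \<lceil>1 / C\<rceil>..\<lceil>1 / C\<rceil>}"
      by (auto; linarith)+
  qed
  hence finV: "finite V" by (rule finite_subset) auto
  have "(0, 1) \<in> V" unfolding V_def by (auto intro: exI[of _ 1])
  define h where "h = (\<lambda>(c :: int, d :: int). norm (jac c d z))"
  have min: "arg_min_on h V \<in> V" "\<not> (\<exists>x\<in>V. h x < h (arg_min_on h V))"
    using arg_min_if_finite[OF finV, of h] \<open>(0, 1) \<in> V\<close> by auto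
  obtain c d where cd': "arg_min_on h V = (c, d)" by (cases "arg_min_on h V")
  have cd: "(c, d) \<in> V" "\<And>c' d'. (c', d') \<in> V \<Longrightarrow> norm (jac c d z) \<le> norm (jac c' d' z)"
    using min unfolding cd' by (force simp: h_def not_less)+
  then obtain a b where ab: "a * d - b * c = 1" unfolding V_def by auto
  define n where "n = round (Re (mob a b c d z))"
  define a' where "a' = a - n * c"
  define b' where "b' = b - n * d"
  have det: "a' * d - b' * c = 1" using ab by (simp add: a'_def b'_def algebra_simps)
  have nz: "of_int c * z + of_int d \<noteq> 0" by (rule mob_denom_nonzero[OF ab z])
  have "mob a' b' c d z = mob a b c d z - of_int n"
    using nz by (simp add: mob_def a'_def b'_def field_simps)
  hence re: "\<bar>Re (mob a' b' c d z)\<bar> \<le> 1/2"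
    using of_int_round_abs_le[of "Re (mob a b c d z)"] by (simp add: n_def abs_minus_commute)
  \<comment> \<open>Up to sign (a', b') is the bottom row after a further inversion. Minimality
    therefore puts the translated point outside the open unit disc.\<close>
  have "norm (jac c d z) \<le> norm (jac a' b' z)"
  proof (cases "norm (jac a' b' z) \<le> 1")
    case True
    have "(- c) * b' - (- d) * a' = 1" using det by (simp add: algebra_simps)
    hence "(a', b') \<in> V" using True unfolding V_def by blast
    thus ?thesis by (rule cd(2))
  next
    case False
    thus ?thesis using cd(1) by (auto simp: V_def)
  qed
  hence "norm (mob a' b' c d z) \<ge> 1" using nz by (simp add: mob_def norm_divide)
  hence "1 \<le> norm (mob a' b' c d z) ^ 2" by simp
  hence "1 \<le> Re (mob a' b' c d z) ^ 2 + Im (mob a' b' c d z) ^ 2" by (simp add: cmod_power2)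
  moreover have "Re (mob a' b' c d z) ^ 2 \<le> (1/2) ^ 2"
    using re by (metis abs_ge_zero power2_abs power_mono)
  ultimately have "(1/2) ^ 2 \<le> Im (mob a' b' c d z) ^ 2" by (simp add: power2_eq_square)
  hence "Im (mob a' b' c d z) \<ge> 1/2"
    using Im_mob_pos[OF det z] by (intro power2_le_imp_le[of "1/2"]) auto
  with det re show ?thesis by (rule that)
qed

text \<open>An invariant function that tends to 0 at infinity attains the maximum of its norm on a
  compact piece of a domain meeting every orbit. By the maximum modulus principle it is constant,
  and the limit makes the constant 0.\<close>

lemma level_one_zero:
  assumes hol: "F holomorphic_on uhp"
    and T: "\<And>z. Im z > 0 \<Longrightarrow> F (z + 1) = F z" and S: "\<And>z. Im z > 0 \<Longrightarrow> F (- 1 / z) = F z"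
    and lim: "\<And>\<epsilon>. \<epsilon> > 0 \<Longrightarrow> \<exists>Y. \<forall>z. Im z \<ge> Y \<longrightarrow> norm (F z) < \<epsilon>"
    and z0: "Im z0 > 0"
  shows "F z0 = 0"
proof (rule ccontr)
  assume nz: "F z0 \<noteq> 0"
  define \<epsilon> where "\<epsilon> = norm (F z0)"
  have \<epsilon>: "\<epsilon> > 0" using nz by (simp add: \<epsilon>_def)
  obtain Y where Y: "\<And>z. Im z \<ge> Y \<Longrightarrow> norm (F z) < \<epsilon>" using lim[OF \<epsilon>] by blast
  define K where "K = cbox (Complex (- 1/2) (1/2)) (Complex (1/2) (max Y 1))"
  have K_mem: "w \<in> K \<longleftrightarrow> \<bar>Re w\<bar> \<le> 1/2 \<and> 1/2 \<le> Im w \<and> Im w \<le> max Y 1" for w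
    by (auto simp: K_def in_cbox_complex_iff abs_le_iff)
  have rep: "\<exists>w. F w = F z \<and> (w \<in> K \<or> norm (F w) < \<epsilon>)" if z: "Im z > 0" for z
  proof -
    obtain a b c d where M: "a * d - b * c = 1" "\<bar>Re (mob a b c d z)\<bar> \<le> 1/2" "Im (mob a b c d z) \<ge> 1/2"
      by (rule fundamental_domain_rep[OF z])
    have "F (mob a b c d z) = F z" by (rule invariant_mob[OF T S M(1) z])
    moreover have "mob a b c d z \<in> K \<or> norm (F (mob a b c d z)) < \<epsilon>"
      using Y[of "mob a b c d z"] M(2,3) unfolding K_mem by (cases "Im (mob a b c d z) \<ge> Y") auto
    ultimately show ?thesis by blast
  qed
  have KU: "K \<subseteq> uhp" by (auto simp: K_mem)
  have "compact K" by (simp add: K_def)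
  \<comment> \<open>A point with the same value as z0 cannot have norm below \<epsilon>, so the
    representative of z0 lies in \<open>K\<close>.\<close>
  moreover have "K \<noteq> {}" using rep[OF z0] unfolding \<epsilon>_def by force
  moreover have "continuous_on K (\<lambda>w. norm (F w))"
    by (intro continuous_on_norm continuous_on_subset[OF holomorphic_on_imp_continuous_on[OF hol] KU])
  ultimately obtain m where m: "m \<in> K" "\<And>w. w \<in> K \<Longrightarrow> norm (F w) \<le> norm (F m)"
    using continuous_attains_sup[of K "\<lambda>w. norm (F w)"] by blast
  have "\<epsilon> \<le> norm (F m)"
  proof -
    obtain w where "F w = F z0" "w \<in> K \<or> norm (F w) < \<epsilon>" using rep[OF z0] by blast
    thus ?thesis using m(2)[of w] by (auto simp: \<epsilon>_def)
  qed
  have max: "norm (F z) \<le> norm (F m)" if z: "z \<in> uhp" for z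
  proof -
    have "\<exists>w. F w = F z \<and> (w \<in> K \<or> norm (F w) < \<epsilon>)" using z by (intro rep) simp
    then obtain w where "F w = F z" "w \<in> K \<or> norm (F w) < \<epsilon>" by blast
    thus ?thesis using m(2)[of w] \<open>\<epsilon> \<le> norm (F m)\<close> by auto
  qed
  have "F constant_on uhp"
    by (rule maximum_modulus_principle[where U = uhp, OF hol _ _ _ _ _ max])
       (use m KU convex_connected[OF convex_uhp] in auto)
  then obtain v where v: "\<And>z. z \<in> uhp \<Longrightarrow> F z = v" unfolding constant_on_def by blast
  have "norm (F (Complex 0 (max Y 1))) < \<epsilon>" by (rule Y) simp
  moreover have "F (Complex 0 (max Y 1)) = F z0" using v[of z0] v[of "Complex 0 (max Y 1)"] z0 by auto
  ultimately show False by (simp add: \<epsilon>_def)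
qed

section \<open>Conjugates of a form under the full modular group\<close>

definition slash :: "nat \<Rightarrow> int \<Rightarrow> int \<Rightarrow> int \<Rightarrow> int \<Rightarrow> (complex \<Rightarrow> complex) \<Rightarrow> complex \<Rightarrow> complex" where
  "slash k a b c d f z = (if Im z > 0 then f (mob a b c d z) / (jac c d z) ^ k else 0)"

lemma slash_slash:
  assumes "a * d - b * c = 1" "a' * d' - b' * c' = 1"
  shows "slash k a' b' c' d' (slash k a b c d f) =
    slash k (a * a' + b * c') (a * b' + b * d') (c * a' + d * c') (c * b' + d * d') f"
proof
  fix z
  show "slash k a' b' c' d' (slash k a b c d f) z =
    slash k (a * a' + b * c') (a * b' + b * d') (c * a' + d * c') (c * b' + d * d') f z"
  proof (cases "Im z > 0")
    case True
    show ?thesis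
      using True Im_mob_pos[OF assms(2) True]
      unfolding slash_def mob_cocycle[OF assms(2) True, symmetric] mob_mob[OF assms True, symmetric]
      by (simp add: power_mult_distrib)
  qed (simp add: slash_def)
qed

text \<open>A set of functions, so coinciding conjugates are counted once. This works because
  \<open>slash\<close> is 0 off the half-plane: conjugates that agree on the half-plane are
  equal.\<close>

definition orbit :: "nat \<Rightarrow> (complex \<Rightarrow> complex) \<Rightarrow> (complex \<Rightarrow> complex) set" where
  "orbit k f = {slash k a b c d f | a b c d. a * d - b * c = 1}"

lemma orbitI: "a * d - b * c = 1 \<Longrightarrow> slash k a b c d f \<in> orbit k f"
  by (auto simp: orbit_def)

lemma slash_orbit:
  assumes "finite (orbit k f)" "a * d - b * c = 1"
  shows "bij_betw (slash k a b c d) (orbit k f) (orbit k f)"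
proof -
  have sub: "slash k a b c d g \<in> orbit k f" if "g \<in> orbit k f" "a * d - b * c = 1" for g a b c d
  proof -
    from that(1) obtain a' b' c' d' where g: "g = slash k a' b' c' d' f" "a' * d' - b' * c' = 1"
      unfolding orbit_def by blast
    show ?thesis unfolding g(1) slash_slash[OF g(2) that(2)]
      by (rule orbitI[OF det_mult[OF g(2) that(2)]])
  qed
  have inv: "slash k d (- b) (- c) a (slash k a b c d g) = g" if "g \<in> orbit k f" for g
  proof -
    from that obtain a' b' c' d' where g: "g = slash k a' b' c' d' f" unfolding orbit_def by blast
    have "slash k d (- b) (- c) a (slash k a b c d g) = slash k 1 0 0 1 g"
      using assms(2) by (subst slash_slash) (auto simp: mult.commute)
    also have "\<dots> = g" by (auto simp: slash_def g mob_def fun_eq_iff)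
    finally show ?thesis .
  qed
  have inj: "inj_on (slash k a b c d) (orbit k f)" by (rule inj_on_inverseI[where g = "slash k d (- b) (- c) a"]) (rule inv)
  moreover have "slash k a b c d ` orbit k f = orbit k f"
    using sub[OF _ assms(2)] assms(1) inj by (intro endo_inj_surj) auto
  ultimately show ?thesis by (simp add: bij_betw_def)
qed

text \<open>Coset representatives grouped by the cusps \<open>\<infinity>, 0, 1/2, 1/11\<close> of widths 1, 22, 11, 2.\<close>
definition reps22 :: "(int \<times> int \<times> int \<times> int) list" where
  "reps22 = (1, 0, 0, 1) # map (\<lambda>j. (0, -1, 1, j)) [0..21] @
     map (\<lambda>j. (1, j, 2, 2 * j + 1)) [0..10] @ map (\<lambda>j. (1, j, 11, 11 * j + 1)) [0..1]"

lemma length_reps22: "length reps22 = 36"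
  by (simp add: reps22_def)

lemma reps22_det: "(a, b, c, d) \<in> set reps22 \<Longrightarrow> a * d - b * c = 1"
  by (auto simp: reps22_def)

text \<open>The divisibility says that the matrix times the inverse of the representative lies in
  the congruence subgroup, since c d' - d c' is its lower left entry. The four cases are the values
  of gcd(c, 22), that is the four cusps, and in each the translation parameter solves a linear
  congruence modulo the width.\<close>

lemma reps22_cover:
  assumes det: "a * d - b * c = (1 :: int)"
  obtains a' b' c' d' where "(a', b', c', d') \<in> set reps22" "22 dvd c * d' - d * c'"
proof -
  have ex: "\<exists>j\<in>{0..m - 1}. m dvd c * j - x" if m: "m > 0" "coprime c m" for m x :: int
  proof -
    obtain y where y: "[c * y = 1] (mod m)" using cong_solve_coprime_int[OF m(2)] by blast
    have "[c * ((x * y) mod m) = c * (x * y)] (mod m)" by (intro cong_mult cong_refl) auto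
    also have "c * (x * y) = x * (c * y)" by (simp add: mult_ac)
    also have "[x * (c * y) = x * 1] (mod m)" by (intro cong_mult cong_refl y)
    finally have "m dvd c * ((x * y) mod m) - x" by (simp add: cong_iff_dvd_diff)
    thus ?thesis using m by (intro bexI[of _ "(x * y) mod m"]) auto
  qed
  have prime: "prime (11 :: int)" by (simp add: prime_int_iff') code_simp
  have cop: "coprime c 11" if "\<not> 11 dvd c"
    using prime_imp_coprime[OF prime that] by (simp add: coprime_commute)
  have "22 dvd c" if "even c" "11 dvd c"
    using that by presburger
  then consider "22 dvd c" | "odd c" "\<not> 11 dvd c" | "even c" "\<not> 11 dvd c" | "odd c" "11 dvd c"
    by blast
  thus ?thesis
  proof cases
    case 1
    thus ?thesis by (intro that[of 1 0 0 1]) (auto simp: reps22_def)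
  next
    case 2
    have "coprime c (2 * 11)"
      unfolding coprime_mult_right_iff using 2 cop by auto
    then obtain j where "j \<in> {0..21}" "22 dvd c * j - d" using ex[of 22 d] by auto
    thus ?thesis by (intro that[of 0 "-1" 1 j]) (auto simp: reps22_def)
  next
    case 3
    from 3 obtain c1 where c1: "c = 2 * c1" by auto
    have "coprime c 11" using 3 cop by auto
    then obtain j where j: "j \<in> {0..10}" "11 dvd c * j - (d - c1)" using ex[of 11 "d - c1"] by auto
    have "2 * 11 dvd 2 * (c * j - (d - c1))" using j(2) by (rule mult_dvd_mono[OF dvd_refl])
    hence "22 dvd c * (2 * j + 1) - d * 2" by (simp add: c1 algebra_simps)
    thus ?thesis using j(1) by (intro that[of 1 j 2 "2 * j + 1"]) (auto simp: reps22_def)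
  next
    case 4
    from 4 obtain c1 where c1: "c = 11 * c1" by auto
    \<comment> \<open>Both c1 and 11 are odd, so c1 (11 j + 1) - d is even exactly when j + 1 and d
      have the same parity.\<close>
    define j where "j = (d + 1) mod 2"
    have j: "j \<in> {0..1}" by (auto simp: j_def)
    have "odd c1" using 4 c1 by auto
    hence "2 dvd c1 * (11 * j + 1) - d" by (auto simp: j_def)
    hence "11 * 2 dvd 11 * (c1 * (11 * j + 1) - d)" by (rule mult_dvd_mono[OF dvd_refl])
    hence "22 dvd c * (11 * j + 1) - d * 11" by (simp add: c1 algebra_simps)
    thus ?thesis using j by (intro that[of 1 j 11 "11 * j + 1"]) (auto simp: reps22_def)
  qed
qed

text \<open>Each matrix is an element (p q; r' s) of the congruence subgroup times a listed
  representative, and the first factor fixes f.\<close>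

lemma orbit22:
  assumes "modform 22 k f"
  shows "finite (orbit k f)" "card (orbit k f) \<le> 36"
proof -
  have sub: "orbit k f \<subseteq> (\<lambda>(a, b, c, d). slash k a b c d f) ` set reps22"
  proof
    fix g assume "g \<in> orbit k f"
    then obtain a b c d where g: "g = slash k a b c d f" "a * d - b * c = 1" unfolding orbit_def by blast
    obtain a' b' c' d' where r: "(a', b', c', d') \<in> set reps22" "22 dvd c * d' - d * c'"
      using reps22_cover[OF g(2)] by blast
    note det' = reps22_det[OF r(1)]
    define p where "p = a * d' - b * c'"
    define q where "q = - a * b' + b * a'"
    define r' where "r' = c * d' - d * c'"
    define s where "s = - c * b' + d * a'"
    have det: "p * s - q * r' = 1"
    proof -
      have "p * s - q * r' = (a * d - b * c) * (a' * d' - b' * c')" unfolding p_def q_def r'_def s_def by algebra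
      thus ?thesis by (simp add: g(2) det')
    qed
    have prod: "p * a' + q * c' = a" "p * b' + q * d' = b" "r' * a' + s * c' = c" "r' * b' + s * d' = d"
    proof -
      have "p * a' + q * c' = a * (a' * d' - b' * c')" "p * b' + q * d' = b * (a' * d' - b' * c')"
        "r' * a' + s * c' = c * (a' * d' - b' * c')" "r' * b' + s * d' = d * (a' * d' - b' * c')"
        unfolding p_def q_def r'_def s_def by algebra+
      thus "p * a' + q * c' = a" "p * b' + q * d' = b" "r' * a' + s * c' = c" "r' * b' + s * d' = d"
        by (simp_all add: det')
    qed
    have eq: "slash k p q r' s f z = f z" if "Im z > 0" for z
    proof -
      have "f (mob p q r' s z) = (jac r' s z) ^ k * f z"
        using assms det r(2) that unfolding modform_def r'_def by simp
      thus ?thesis using mob_denom_nonzero[OF det that] that by (simp add: slash_def)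
    qed
    have "g = slash k a' b' c' d' (slash k p q r' s f)"
      unfolding slash_slash[OF det det'] prod g(1) ..
    also have "\<dots> = slash k a' b' c' d' f"
      using eq Im_mob_pos[OF det'] by (auto simp: slash_def[of k a'] fun_eq_iff)
    finally show "g \<in> (\<lambda>(a, b, c, d). slash k a b c d f) ` set reps22" using r(1) by force
  qed
  show "finite (orbit k f)" by (rule finite_subset[OF sub]) auto
  have "card (orbit k f) \<le> card ((\<lambda>(a, b, c, d). slash k a b c d f) ` set reps22)"
    by (rule card_mono[OF _ sub]) auto
  also have "\<dots> \<le> card (set reps22)" by (rule card_image_le) auto
  also have "\<dots> \<le> 36" using card_length[of reps22] by (simp add: length_reps22)
  finally show "card (orbit k f) \<le> 36" .
qed

lemma holomorphic_on_slash:
  assumes "f holomorphic_on uhp" "a * d - b * c = 1"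
  shows "slash k a b c d f holomorphic_on uhp"
proof -
  have "(\<lambda>z. (f \<circ> mob a b c d) z / (jac c d z) ^ k) holomorphic_on uhp"
    using mob_denom_nonzero[OF assms(2)] Im_mob_pos[OF assms(2)]
    by (intro holomorphic_on_divide holomorphic_on_compose_gen[OF holomorphic_on_mob[OF assms(2)] assms(1)] holomorphic_intros) auto
  also have "?this \<longleftrightarrow> ?thesis"
    by (rule holomorphic_cong) (auto simp: slash_def)
  finally show ?thesis .
qed

text \<open>Where one factor is nonzero, on a nonempty open set, the product of the others vanishes,
  hence everywhere by analytic continuation.\<close>

lemma holomorphic_prod_eq_0:
  assumes "finite S" "\<And>g. g \<in> S \<Longrightarrow> g holomorphic_on uhp" "\<And>z. z \<in> uhp \<Longrightarrow> (\<Prod>g\<in>S. g z) = 0"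
  shows "\<exists>g\<in>S. \<forall>z\<in>uhp. g z = 0"
  using assms
proof (induction S rule: finite_induct)
  case empty
  from empty.prems(2)[of \<i>] show ?case by simp
next
  case (insert h S)
  show ?case
  proof (cases "\<forall>z\<in>uhp. h z = 0")
    case False
    then obtain z1 where z1: "z1 \<in> uhp" "h z1 \<noteq> 0" by blast
    define P where "P = (\<lambda>z. \<Prod>g\<in>S. g z)"
    have holP: "P holomorphic_on uhp" unfolding P_def using insert.prems(1) by (intro holomorphic_on_prod) auto
    have holh: "h holomorphic_on uhp" using insert.prems(1) by auto
    have "open (uhp \<inter> h -` (- {0}))"
      by (rule continuous_open_preimage[OF holomorphic_on_imp_continuous_on[OF holh]]) auto
    moreover have "P z = 0" if "z \<in> uhp \<inter> h -` (- {0})" for z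
      using insert.prems(2)[of z] insert.hyps that by (auto simp: P_def)
    ultimately have "P z = 0" if "z \<in> uhp" for z
      using z1 that analytic_continuation_open[of "uhp \<inter> h -` (- {0})" uhp P "\<lambda>_. 0" z] holP convex_connected[OF convex_uhp]
      by auto
    thus ?thesis using insert.IH insert.prems(1) unfolding P_def by blast
  qed auto
qed

lemma eta_power_24:
  assumes "Im z > 0"
  shows "eta (z + 1) ^ 24 = eta z ^ 24" "eta (- 1 / z) ^ 24 = z ^ 12 * eta z ^ 24"
proof -
  have sq: "x ^ 24 = (x ^ 2) ^ 12" for x :: complex by (simp flip: power_mult)
  have "exp (of_real pi * \<i> / 6) = root12 1" by (simp add: root12_def)
  moreover have "root12 1 ^ 12 = root12 12"
    using root12_power_int[of 1 12] by simp
  ultimately have "exp (of_real pi * \<i> / 6) ^ 12 = 1" using root12_12[of 1] by simp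
  thus "eta (z + 1) ^ 24 = eta z ^ 24"
    unfolding sq eta_plus_1 by (simp add: power_mult_distrib)
  have "(- \<i>) ^ 12 = ((- \<i>) ^ 4) ^ 3" by (simp flip: power_mult)
  also have "\<dots> = 1" by simp
  finally show "eta (- 1 / z) ^ 24 = z ^ 12 * eta z ^ 24"
    unfolding sq eta_inversion[OF assms] by (simp only: power_mult_distrib mult_1)
qed

lemma eta_24_lower_bound:
  obtains c where "c > 0" "\<And>z. Im z \<ge> 1 \<Longrightarrow> norm (eta z ^ 24) \<ge> c * exp (- 2 * pi * Im z)"
proof -
  obtain L where L: "L > 0" "\<And>z. Im z \<ge> 1 \<Longrightarrow> norm (eval_fps log_eta_fps (qexp z)) \<le> L"
    using eval_fps_qexp_bounded[OF fps_conv_radius_log_eta_fps, of 1] by auto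
  show ?thesis
  proof (rule that[of "exp (- 24 * L)"])
    fix z assume z: "Im z \<ge> 1"
    define R where "R = Re (eval_fps log_eta_fps (qexp z))"
    have R: "R \<le> L" using L(2)[OF z] abs_Re_le_cmod[of "eval_fps log_eta_fps (qexp z)"] by (simp add: R_def)
    have "norm (eta z ^ 24) = norm (eta z ^ 2) ^ 12" by (simp add: norm_power flip: power_mult)
    also have "\<dots> = exp (- 24 * R) * exp (- 2 * pi * Im z)"
      unfolding norm_eta_squared by (simp add: R_def power_mult_distrib exp_of_nat_mult [symmetric])
    also have "\<dots> \<ge> exp (- 24 * L) * exp (- 2 * pi * Im z)"
      using R by (intro mult_right_mono) auto
    finally show "norm (eta z ^ 24) \<ge> exp (- 24 * L) * exp (- 2 * pi * Im z)" .
  qed simp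
qed

text \<open>The product of \<open>f\<close> over its orbit is a form of level one; dividing a power of it by a power
  of the discriminant leaves an invariant function that vanishes at infinity.\<close>
theorem modform22_vanishing:
  assumes f: "modform 22 k f"
    and F: "fps_conv_radius F \<ge> 1" "\<And>z. Im z > 0 \<Longrightarrow> f z = qexp z ^ M * eval_fps F (qexp z)"
    and M: "3 * k < M"
    and z: "Im z > 0"
  shows "f z = 0"
proof -
  define S where "S = orbit k f"
  define s where "s = card S"
  have S: "finite S" "s \<le> 36" using orbit22[OF f] by (auto simp: S_def s_def)
  have S_elem: "\<exists>a b c d. a * d - b * c = 1 \<and> g = slash k a b c d f" if "g \<in> S" for g
    using that by (auto simp: S_def orbit_def)
  have hol: "g holomorphic_on uhp" if "g \<in> S" for g
    using S_elem[OF that] f by (auto simp: modform_def intro: holomorphic_on_slash)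
  define P where "P = (\<lambda>z. \<Prod>g\<in>S. g z)"
  have holP: "P holomorphic_on uhp" unfolding P_def using hol by (intro holomorphic_on_prod)
  have P_T: "P (z + 1) = P z" if "Im z > 0" for z
  proof -
    have "P (z + 1) = (\<Prod>g\<in>S. slash k 1 1 0 1 g z)"
      unfolding P_def using that by (intro prod.cong) (auto simp: slash_def mob_def)
    also have "\<dots> = P z"
      unfolding P_def by (rule prod.reindex_bij_betw) (use slash_orbit[of k f 1 1 1 0] S in \<open>auto simp: S_def\<close>)
    finally show ?thesis .
  qed
  have P_S: "P (- 1 / z) = z ^ (k * s) * P z" if "Im z > 0" for z
  proof -
    have "z \<noteq> 0" using that by auto
    hence "P (- 1 / z) = (\<Prod>g\<in>S. z ^ k * slash k 0 (-1) 1 0 g z)"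
      unfolding P_def using that by (intro prod.cong) (auto simp: slash_def mob_def)
    also have "\<dots> = z ^ (k * s) * (\<Prod>g\<in>S. slash k 0 (-1) 1 0 g z)"
      by (simp add: prod.distrib s_def power_mult)
    also have "(\<Prod>g\<in>S. slash k 0 (-1) 1 0 g z) = P z"
      unfolding P_def by (rule prod.reindex_bij_betw) (use slash_orbit[of k f 0 0 "-1" 1] S in \<open>auto simp: S_def\<close>)
    finally show ?thesis .
  qed
  \<comment> \<open>The product has weight k s; its twelfth power and the power k s of the
    discriminant both have weight 12 k s.\<close>
  define G where "G = (\<lambda>z. P z ^ 12 / (eta z ^ 24) ^ (k * s))"
  have G0: "G w = 0" if w: "Im w > 0" for w
  proof (rule level_one_zero[OF _ _ _ _ w])
    show "G holomorphic_on uhp"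
      unfolding G_def using holP holomorphic_on_eta by (intro holomorphic_intros) auto
    show "G (z + 1) = G z" if "Im z > 0" for z
      unfolding G_def P_T[OF that] eta_power_24(1)[OF that] ..
    show "G (- 1 / z) = G z" if "Im z > 0" for z
    proof -
      have "z \<noteq> 0" using that by auto
      have "(z ^ (k * s)) ^ 12 = (z ^ 12) ^ (k * s)" by (simp add: mult.commute flip: power_mult)
      thus ?thesis
        unfolding G_def P_S[OF that] eta_power_24(2)[OF that] power_mult_distrib using \<open>z \<noteq> 0\<close> by simp
    qed
  next
    fix \<epsilon> :: real assume \<epsilon>: "\<epsilon> > 0"
    have bdd: "\<forall>g\<in>S. \<exists>B Y. B > 0 \<and> Y > 0 \<and> (\<forall>z. Im z \<ge> Y \<longrightarrow> norm (g z) \<le> B)"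
    proof
      fix g assume "g \<in> S"
      then obtain a b c d where g: "a * d - b * c = 1" "g = slash k a b c d f" using S_elem by blast
      obtain B Y where BY: "Y > 0" "\<And>z. Im z \<ge> Y \<Longrightarrow> norm (f (mob a b c d z)) \<le> B * norm (jac c d z) ^ k"
        using f g(1) unfolding modform_def by blast
      have "norm (g z) \<le> \<bar>B\<bar> + 1" if "Im z \<ge> Y" for z
      proof -
        have z: "Im z > 0" using that BY(1) by linarith
        have "norm (f (mob a b c d z)) / norm (jac c d z) ^ k \<le> B"
          using BY(2)[OF that] mob_denom_nonzero[OF g(1) z] by (simp add: divide_le_eq)
        thus ?thesis using z by (simp add: g(2) slash_def norm_divide norm_power)
      qed
      moreover have "\<bar>B\<bar> + 1 > 0" by linarith
      ultimately show "\<exists>B Y. B > 0 \<and> Y > 0 \<and> (\<forall>z. Im z \<ge> Y \<longrightarrow> norm (g z) \<le> B)"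
        using BY(1) by blast
    qed
    then obtain B Y where BY: "\<And>g. g \<in> S \<Longrightarrow> B g > 0" "\<And>g. g \<in> S \<Longrightarrow> Y g > 0"
      "\<And>g z. g \<in> S \<Longrightarrow> Im z \<ge> Y g \<Longrightarrow> norm (g z) \<le> B g" by metis
    obtain C where C: "C > 0" "\<And>z. Im z \<ge> 1 \<Longrightarrow> norm (eval_fps F (qexp z)) \<le> C"
      using eval_fps_qexp_bounded[OF F(1), of 1] by auto
    obtain c where c: "c > 0" "\<And>z. Im z \<ge> 1 \<Longrightarrow> norm (eta z ^ 24) \<ge> c * exp (- 2 * pi * Im z)"
      using eta_24_lower_bound by blast
    \<comment> \<open>The conjugate by the identity stands in for f, whose values off the half-plane
      are arbitrary. It alone supplies the zero of order \<open>M\<close>; all other factors are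
      merely bounded.\<close>
    define f0 where "f0 = slash k 1 0 0 1 f"
    have f0: "f0 \<in> S" unfolding f0_def S_def by (rule orbitI) simp
    define Y0 where "Y0 = 1 + sum Y S"
    have Y0: "Y g \<le> Y0" if "g \<in> S" for g
      unfolding Y0_def using member_le_sum[OF that, of Y] S(1) BY(2) by force
    have Y01: "Y0 \<ge> 1" unfolding Y0_def using BY(2) by (simp add: sum_nonneg less_imp_le)
    define K where "K = (C * prod B (S - {f0})) ^ 12 / c ^ (k * s)"
    have bound: "norm (G z) \<le> K * exp (- 2 * pi * Im z)" if z: "Im z \<ge> Y0" for z
    proof -
      have z1: "Im z \<ge> 1" and z0: "Im z > 0" using z Y01 by linarith+
      define E where "E = exp (- 2 * pi * Im z)"
      have E: "0 < E" "E < 1" using z0 by (auto simp: E_def)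
      have "P z = f0 z * (\<Prod>g\<in>S - {f0}. g z)" unfolding P_def using S(1) f0 by (rule prod.remove)
      hence "norm (P z) = norm (f0 z) * (\<Prod>g\<in>S - {f0}. norm (g z))" by (simp add: norm_mult prod_norm)
      also have "norm (f0 z) = E ^ M * norm (eval_fps F (qexp z))"
        using z0 F(2)[OF z0] by (simp add: f0_def slash_def mob_def norm_mult norm_power norm_qexp E_def)
      also have "E ^ M * norm (eval_fps F (qexp z)) * (\<Prod>g\<in>S - {f0}. norm (g z)) \<le> E ^ M * C * prod B (S - {f0})"
      proof (intro mult_mono prod_mono)
        show "norm (eval_fps F (qexp z)) \<le> C" by (rule C(2)[OF z1])
        show "0 \<le> norm (g z) \<and> norm (g z) \<le> B g" if "g \<in> S - {f0}" for g
          using BY(3)[of g z] Y0[of g] that z by auto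
      qed (use E C in \<open>auto intro: prod_nonneg\<close>)
      finally have "norm (P z) ^ 12 \<le> (E ^ M * C * prod B (S - {f0})) ^ 12" by (intro power_mono) auto
      also have "\<dots> = E ^ (12 * M) * (C * prod B (S - {f0})) ^ 12"
        by (simp add: power_mult_distrib mult.commute[of 12 M] power_mult)
      finally have num: "norm (P z) ^ 12 \<le> E ^ (12 * M) * (C * prod B (S - {f0})) ^ 12" .
      have den: "(c * E) ^ (k * s) \<le> norm (eta z ^ 24) ^ (k * s)"
        using c(2)[OF z1] c(1) E by (intro power_mono) (auto simp: E_def)
      have "norm (G z) = norm (P z) ^ 12 / norm (eta z ^ 24) ^ (k * s)"
        by (simp add: G_def norm_divide norm_power)
      also have "\<dots> \<le> (E ^ (12 * M) * (C * prod B (S - {f0})) ^ 12) / (c * E) ^ (k * s)"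
        using num den c(1) E by (intro frac_le) auto
      also have "\<dots> = K * (E ^ (12 * M) / E ^ (k * s))"
        by (simp add: K_def power_mult_distrib)
      also have "E ^ (12 * M) / E ^ (k * s) \<le> E"
      proof -
        \<comment> \<open>From s at most 36 and 3 k < M: the numerator has at least one factor
          \<open>E\<close> to spare.\<close>
        have "k * s + 1 \<le> 12 * M" using M S(2) mult_le_mono2[OF S(2), of k] by linarith
        hence "E ^ (12 * M) \<le> E ^ (k * s + 1)" using E by (intro power_decreasing) auto
        thus ?thesis using E by (simp add: divide_le_eq mult.commute)
      qed
      hence "K * (E ^ (12 * M) / E ^ (k * s)) \<le> K * E"
        using C(1) c(1) by (intro mult_left_mono) (auto simp: K_def)
      finally show ?thesis by (simp add: E_def)
    qed
    have "((\<lambda>y. K * exp (- 2 * pi * y)) \<longlongrightarrow> K * 0) at_top"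
      by (intro tendsto_mult tendsto_const) real_asymp
    hence "eventually (\<lambda>y. K * exp (- 2 * pi * y) < \<epsilon>) at_top"
      using \<epsilon> by (intro order_tendstoD) auto
    then obtain Y1 where Y1: "\<And>y. y \<ge> Y1 \<Longrightarrow> K * exp (- 2 * pi * y) < \<epsilon>"
      unfolding eventually_at_top_linorder by blast
    show "\<exists>Y. \<forall>z. Im z \<ge> Y \<longrightarrow> norm (G z) < \<epsilon>"
    proof (intro exI allI impI)
      fix z assume "Im z \<ge> max Y0 Y1"
      thus "norm (G z) < \<epsilon>" using bound[of z] Y1[of "Im z"] by auto
    qed
  qed
  have "(\<Prod>g\<in>S. g w) = 0" if "w \<in> uhp" for w
    using G0[of w] that by (simp add: G_def P_def)
  then obtain g where g: "g \<in> S" "\<And>w. w \<in> uhp \<Longrightarrow> g w = 0"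
    using holomorphic_prod_eq_0[OF S(1) hol] by blast
  \<comment> \<open>The conjugate that vanishes need not belong to the identity; the inverse matrix
    carries its zeros back to f at z.\<close>
  obtain a b c d where M: "a * d - b * c = 1" "g = slash k a b c d f" using S_elem[OF g(1)] by blast
  have M': "d * a - (- b) * (- c) = 1" using M(1) by (simp add: mult.commute)
  define w where "w = mob d (- b) (- c) a z"
  have w: "Im w > 0" unfolding w_def by (rule Im_mob_pos[OF M' z])
  have "mob a b c d w = z"
    unfolding w_def mob_mob[OF M(1) M' z] using M(1) by (simp add: mob_def mult.commute flip: of_int_mult)
  moreover have "f (mob a b c d w) = 0"
    using g(2)[of w] w mob_denom_nonzero[OF M(1) w] by (simp add: M(2) slash_def)
  ultimately show ?thesis by simp
qed

section \<open>Expansions at infinity\<close>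

definition dilate :: "nat \<Rightarrow> 'a :: zero fps \<Rightarrow> 'a fps" where
  "dilate d F = Abs_fps (\<lambda>n. if d dvd n then fps_nth F (n div d) else 0)"

lemma dilate_conv_compose:
  fixes F :: "'a :: idom fps"
  assumes "d > 0"
  shows "dilate d F = fps_compose F (fps_X ^ d)"
proof (rule fps_ext)
  fix n
  have "fps_nth (fps_compose F (fps_X ^ d)) n = (\<Sum>i=0..n. fps_nth F i * (if n = d * i then 1 else 0))"
    unfolding fps_compose_nth by (simp add: fps_X_power_nth flip: power_mult)
  also have "\<dots> = fps_nth (dilate d F) n"
  proof (cases "d dvd n")
    case True
    then obtain m where m: "n = d * m" by auto
    have "(\<Sum>i=0..n. fps_nth F i * (if n = d * i then 1 else 0)) = (\<Sum>i=0..n. if i = m then fps_nth F i else 0)"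
      using assms by (intro sum.cong) (auto simp: m)
    also have "\<dots> = fps_nth F m" using assms by (simp add: m)
    finally show ?thesis using assms by (simp add: dilate_def m)
  next
    case False
    thus ?thesis by (auto simp: dilate_def intro!: sum.neutral)
  qed
  finally show "fps_nth (dilate d F) n = fps_nth (fps_compose F (fps_X ^ d)) n" ..
qed

lemma dilate_mult:
  fixes F G :: "'a :: idom fps"
  assumes "d > 0"
  shows "dilate d (F * G) = dilate d F * dilate d G"
  using assms by (simp add: dilate_conv_compose fps_compose_mult_distrib fps_X_power_nth)

lemma fps_conv_radius_dilate:
  fixes F :: "complex fps"
  assumes F: "fps_conv_radius F \<ge> 1" and d: "d > 0"
  shows "fps_conv_radius (dilate d F) \<ge> 1"
    and "norm q < 1 \<Longrightarrow> eval_fps (dilate d F) q = eval_fps F (q ^ d)"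
proof -
  have sums: "(\<lambda>n. fps_nth (dilate d F) n * q ^ n) sums eval_fps F (q ^ d)" if q: "norm q < 1" for q
  proof -
    have "norm (q ^ d) < 1" using q d by (simp add: norm_power power_less_one_iff)
    hence "ereal (norm (q ^ d)) < fps_conv_radius F" using F by (auto intro: order.strict_trans2[of _ 1])
    hence "(\<lambda>n. fps_nth F n * (q ^ d) ^ n) sums eval_fps F (q ^ d)" by (rule sums_eval_fps)
    also have "(\<lambda>n. fps_nth F n * (q ^ d) ^ n) = (\<lambda>n. (\<lambda>m. fps_nth (dilate d F) m * q ^ m) (d * n))"
      using d by (simp add: dilate_def power_mult)
    finally show ?thesis
      using d by (subst (asm) sums_mono_reindex) (auto simp: strict_mono_def dilate_def elim!: dvdE)
  qed
  show "fps_conv_radius (dilate d F) \<ge> 1"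
    unfolding fps_conv_radius_def
  proof (rule conv_radius_geI_ex')
    fix r :: real assume "0 < r" "ereal r < 1"
    thus "summable (\<lambda>n. fps_nth (dilate d F) n * of_real r ^ n)"
      using sums[of "of_real r"] by (auto simp: sums_iff)
  qed
  show "eval_fps (dilate d F) q = eval_fps F (q ^ d)" if "norm q < 1"
    using sums[OF that] by (simp add: eval_fps_def sums_iff)
qed

definition cplx :: "real fps \<Rightarrow> complex fps" where
  "cplx F = Abs_fps (\<lambda>n. of_real (fps_nth F n))"

lemma cplx_nth [simp]: "fps_nth (cplx F) n = of_real (fps_nth F n)"
  by (simp add: cplx_def)

lemma cplx_add: "cplx (F + G) = cplx F + cplx G" by (rule fps_ext) simp
lemma cplx_diff: "cplx (F - G) = cplx F - cplx G" by (rule fps_ext) simp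
lemma cplx_mult: "cplx (F * G) = cplx F * cplx G" by (rule fps_ext) (simp add: fps_mult_nth)
lemma cplx_const: "cplx (fps_const c) = fps_const (of_real c)" by (rule fps_ext) simp
lemma cplx_1: "cplx 1 = 1" by (rule fps_ext) simp
lemma cplx_power: "cplx (F ^ n) = cplx F ^ n"
  by (induction n) (auto simp: cplx_mult cplx_1)
lemma cplx_X: "cplx fps_X = fps_X" by (rule fps_ext) (simp add: fps_X_def)
lemma cplx_deriv: "cplx (fps_deriv F) = fps_deriv (cplx F)" by (rule fps_ext) simp
lemma cplx_dilate: "cplx (dilate d F) = dilate d (cplx F)" by (rule fps_ext) (simp add: dilate_def)
text \<open>The coefficients are real, as in the formal eta products, while convergence and
  evaluation concern the complexified series on the unit disc.\<close>

definition q_expansion :: "real fps \<Rightarrow> (complex \<Rightarrow> complex) \<Rightarrow> bool" where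
  "q_expansion F f \<longleftrightarrow> fps_conv_radius (cplx F) \<ge> 1 \<and> (\<forall>z. Im z > 0 \<longrightarrow> f z = eval_fps (cplx F) (qexp z))"

lemma q_expansion_add:
  assumes "q_expansion F f" "q_expansion G g"
  shows "q_expansion (F + G) (\<lambda>z. f z + g z)"
proof -
  have r: "fps_conv_radius (cplx F) \<ge> 1" "fps_conv_radius (cplx G) \<ge> 1" using assms by (auto simp: q_expansion_def)
  have "fps_conv_radius (cplx (F + G)) \<ge> 1"
    unfolding cplx_add using r by (intro order.trans[OF _ fps_conv_radius_add]) simp
  with assms show ?thesis
    by (auto simp: q_expansion_def cplx_add eval_fps_add qexp_less_conv_radius)
qed

lemma q_expansion_diff:
  assumes "q_expansion F f" "q_expansion G g"
  shows "q_expansion (F - G) (\<lambda>z. f z - g z)"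
proof -
  have r: "fps_conv_radius (cplx F) \<ge> 1" "fps_conv_radius (cplx G) \<ge> 1" using assms by (auto simp: q_expansion_def)
  have "fps_conv_radius (cplx (F - G)) \<ge> 1"
    unfolding cplx_diff using r by (intro order.trans[OF _ fps_conv_radius_diff]) simp
  with assms show ?thesis
    by (auto simp: q_expansion_def cplx_diff eval_fps_diff qexp_less_conv_radius)
qed

lemma q_expansion_mult:
  assumes "q_expansion F f" "q_expansion G g"
  shows "q_expansion (F * G) (\<lambda>z. f z * g z)"
proof -
  have r: "fps_conv_radius (cplx F) \<ge> 1" "fps_conv_radius (cplx G) \<ge> 1" using assms by (auto simp: q_expansion_def)
  have "fps_conv_radius (cplx (F * G)) \<ge> 1"
    unfolding cplx_mult using r by (intro order.trans[OF _ fps_conv_radius_mult]) simp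
  with assms show ?thesis
    by (auto simp: q_expansion_def cplx_mult eval_fps_mult qexp_less_conv_radius)
qed

lemma q_expansion_const: "q_expansion (fps_const c) (\<lambda>_. of_real c)"
  by (simp add: q_expansion_def cplx_const)

lemma q_expansion_cmult: "q_expansion F f \<Longrightarrow> q_expansion (fps_const c * F) (\<lambda>z. of_real c * f z)"
  using q_expansion_mult[OF q_expansion_const] by blast

lemma q_expansion_power: "q_expansion F f \<Longrightarrow> q_expansion (F ^ n) (\<lambda>z. f z ^ n)"
proof (induction n)
  case 0
  show ?case using q_expansion_const[of 1] by simp
next
  case (Suc n)
  from q_expansion_mult[OF Suc.prems Suc.IH[OF Suc.prems]] show ?case by simp
qed

lemma q_expansion_dilate:
  assumes "q_expansion F f" "d > 0"
  shows "q_expansion (dilate d F) (\<lambda>z. f (of_nat d * z))"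
  using assms fps_conv_radius_dilate[of "cplx F" d]
  by (auto simp: q_expansion_def cplx_dilate qexp_of_nat_mult norm_qexp_less_1)

lemma q_expansion_cong:
  "q_expansion F f \<Longrightarrow> (\<And>z. Im z > 0 \<Longrightarrow> g z = f z) \<Longrightarrow> q_expansion F g"
  by (auto simp: q_expansion_def)

definition eis2_rfps :: "real fps" where
  "eis2_rfps = Abs_fps (\<lambda>n. if n = 0 then 1 else - 24 * real (sigmak 1 n))"

definition eis4_rfps :: "real fps" where
  "eis4_rfps = Abs_fps (\<lambda>n. if n = 0 then 1 else 240 * real (sigmak 3 n))"

lemma q_expansion_eis2: "q_expansion eis2_rfps eis2"
proof -
  have "cplx eis2_rfps = 1 - 24 * sigma_fps"
    by (rule fps_ext) (auto simp: eis2_rfps_def sigma_fps_def sigmak_def numeral_fps_const)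
  thus ?thesis using fps_conv_radius_eis2_fps eval_eis2_fps by (simp add: q_expansion_def)
qed

lemma q_expansion_eis4: "q_expansion eis4_rfps eis4"
proof -
  have "cplx eis4_rfps = eis4_fps"
    by (rule fps_ext) (auto simp: eis4_rfps_def eis4_fps_def)
  thus ?thesis using fps_conv_radius_eis4_fps by (simp add: q_expansion_def eis4_def)
qed

lemma eis2_rfps_square: "fps_nth (eis2_rfps * eis2_rfps) n =
   (if n = 0 then 1 else 240 * real (sigmak 3 n) - 288 * (real n * real (sigmak 1 n)))"
proof -
  define C where "C = cplx (eis2_rfps * eis2_rfps)"
  have e: "cplx eis2_rfps = 1 - 24 * sigma_fps"
    by (rule fps_ext) (auto simp: eis2_rfps_def sigma_fps_def sigmak_def numeral_fps_const)
  define D where "D = fps_X * fps_deriv sigma_fps"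
  have "C = eis4_fps - 288 * D"
    by (simp add: C_def cplx_mult e eis4_fps_eq power2_eq_square D_def)
  moreover have "fps_nth D n = of_nat n * of_nat (sigmak 1 n)"
    by (cases n) (auto simp: D_def sigma_fps_def simp del: of_nat_Suc)
  ultimately have "fps_nth C n = of_real (if n = 0 then 1 else 240 * real (sigmak 3 n) - 288 * (real n * real (sigmak 1 n)))"
    by (simp add: eis4_fps_def numeral_fps_const)
  thus ?thesis unfolding C_def cplx_nth of_real_eq_iff .
qed

section \<open>Logarithmic derivatives of formal Euler products\<close>

definition divisor_fps :: "nat \<Rightarrow> real fps" where
  "divisor_fps d = Abs_fps (\<lambda>n. if d dvd n then real d * real (sigmak 1 (n div d)) else 0)"

definition multiples_fps :: "nat \<Rightarrow> real fps" where
  "multiples_fps j = Abs_fps (\<lambda>n. if n > 0 \<and> j dvd n then 1 else 0)"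

lemma multiples_fps_eq:
  assumes "j > 0"
  shows "(1 - fps_X ^ j) * multiples_fps j = fps_X ^ j"
proof (rule fps_ext)
  fix n
  have "fps_nth ((1 - fps_X ^ j) * multiples_fps j) n =
    fps_nth (multiples_fps j) n - (if n < j then 0 else fps_nth (multiples_fps j) (n - j))"
    by (simp add: left_diff_distrib fps_X_power_mult_nth)
  also have "\<dots> = fps_nth (fps_X ^ j) n"
    using assms by (auto simp: multiples_fps_def fps_X_power_nth dvd_minus_self not_less dest: dvd_imp_le)
  finally show "fps_nth ((1 - fps_X ^ j) * multiples_fps j) n = fps_nth (fps_X ^ j) n" .
qed

definition log_deriv :: "'a :: field fps \<Rightarrow> 'a fps \<Rightarrow> bool" where
  "log_deriv F L \<longleftrightarrow> fps_X * fps_deriv F = F * L"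

lemma log_deriv_mult: "log_deriv F K \<Longrightarrow> log_deriv G L \<Longrightarrow> log_deriv (F * G) (K + L)"
proof -
  assume "log_deriv F K" "log_deriv G L"
  hence *: "fps_X * fps_deriv F = F * K" "fps_X * fps_deriv G = G * L" by (auto simp: log_deriv_def)
  have "fps_X * fps_deriv (F * G) = F * (fps_X * fps_deriv G) + (fps_X * fps_deriv F) * G"
    by (simp add: algebra_simps)
  also have "\<dots> = F * G * (K + L)" unfolding * by (simp add: algebra_simps)
  finally show ?thesis by (simp add: log_deriv_def)
qed

lemma log_deriv_1: "log_deriv 1 0" by (simp add: log_deriv_def)

lemma log_deriv_power: "log_deriv F L \<Longrightarrow> log_deriv (F ^ n) (of_nat n * L)"
proof (induction n)
  case (Suc n)
  from log_deriv_mult[OF Suc.prems Suc.IH[OF Suc.prems]] show ?case by (simp add: algebra_simps)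
qed (simp add: log_deriv_1)

lemma log_deriv_inverse:
  assumes "log_deriv F L" "fps_nth F 0 \<noteq> 0"
  shows "log_deriv (inverse F) (- L)"
proof -
  have "inverse F * F = 1" using assms(2) by (rule inverse_mult_eq_1)
  have "fps_X * fps_deriv (inverse F) = - (fps_X * fps_deriv F) * inverse F ^ 2"
    using assms(2) by (simp add: fps_inverse_deriv)
  also have "\<dots> = - (inverse F * F) * L * inverse F"
    using assms(1) by (simp add: log_deriv_def power2_eq_square algebra_simps)
  also have "\<dots> = inverse F * (- L)" using \<open>inverse F * F = 1\<close> by simp
  finally show ?thesis by (simp add: log_deriv_def)
qed

text \<open>Comparing coefficients of q F' = F L, with L lacking a constant term, determines n times
  the n-th coefficient of F from the earlier ones. The lemma identifies the analytic eta quotients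
  with the formal ones, and the same recursion certifies the coefficient tables.\<close>

lemma log_deriv_unique:
  fixes F G :: "'a :: field_char_0 fps"
  assumes "log_deriv F L" "log_deriv G L" "fps_nth F 0 = fps_nth G 0" "fps_nth L 0 = 0"
  shows "F = G"
proof (rule fps_ext)
  have rec: "of_nat n * fps_nth H n = (\<Sum>i<n. fps_nth H i * fps_nth L (n - i))" if "log_deriv H L" for H n
  proof -
    have "of_nat n * fps_nth H n = fps_nth (fps_X * fps_deriv H) n"
      by (cases n) (simp_all del: of_nat_Suc)
    also have "\<dots> = (\<Sum>i\<in>{0..n}. fps_nth H i * fps_nth L (n - i))"
      using that by (simp add: log_deriv_def fps_mult_nth)
    also have "\<dots> = (\<Sum>i<n. fps_nth H i * fps_nth L (n - i))"
      using assms(4) by (intro sum.mono_neutral_right) (auto simp: le_less)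
    finally show ?thesis .
  qed
  fix n show "fps_nth F n = fps_nth G n"
  proof (induction n rule: less_induct)
    case (less n)
    show ?case
    proof (cases "n = 0")
      case False
      have "of_nat n * fps_nth F n = of_nat n * fps_nth G n"
        unfolding rec[OF assms(1)] rec[OF assms(2)] using less by (intro sum.cong) auto
      thus ?thesis using False by simp
    qed (use assms(3) in simp)
  qed
qed

lemma fps_X_mult_deriv_nth: "fps_nth (fps_X * fps_deriv F) n = of_nat n * fps_nth (F :: 'a :: comm_ring_1 fps) n"
  by (cases n) (simp_all del: of_nat_Suc)

lemma log_deriv_euler_factor:
  assumes "j > 0"
  shows "log_deriv (1 - fps_X ^ j :: real fps) (- (of_nat j * multiples_fps j))"
proof -
  have "fps_X * fps_deriv (1 - fps_X ^ j :: real fps) = - (of_nat j * fps_X ^ j)"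
  proof (rule fps_ext)
    fix n show "fps_nth (fps_X * fps_deriv (1 - fps_X ^ j :: real fps)) n = fps_nth (- (of_nat j * fps_X ^ j)) n"
      unfolding fps_X_mult_deriv_nth by (simp add: fps_X_power_nth fps_of_nat [symmetric])
  qed
  also have "\<dots> = - (of_nat j * ((1 - fps_X ^ j) * multiples_fps j))"
    by (simp only: multiples_fps_eq[OF assms])
  also have "\<dots> = (1 - fps_X ^ j) * (- (of_nat j * multiples_fps j))"
    by (simp only: mult_minus_right mult.left_commute)
  finally show ?thesis unfolding log_deriv_def .
qed

lemma log_deriv_prod:
  assumes "finite S" "\<And>i. i \<in> S \<Longrightarrow> log_deriv (F i) (L i)"
  shows "log_deriv (\<Prod>i\<in>S. F i) (\<Sum>i\<in>S. L i)"
  using assms by (induction S rule: finite_induct) (auto intro: log_deriv_mult log_deriv_1)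

lemma eta_prod_nth:
  assumes "d > 0" "n \<le> N"
  shows "fps_nth (eta_prod d) n = fps_nth (\<Prod>k\<in>{1..N}. 1 - fps_X ^ (d * k)) n"
  using assms(2)
proof (induction N rule: dec_induct)
  case base
  show ?case by (simp add: eta_prod_def)
next
  case (step N)
  have "{1..Suc N} = insert (Suc N) {1..N}" by auto
  hence "(\<Prod>k\<in>{1..Suc N}. 1 - fps_X ^ (d * k) :: real fps) = (\<Prod>k\<in>{1..N}. 1 - fps_X ^ (d * k)) - fps_X ^ (d * Suc N) * (\<Prod>k\<in>{1..N}. 1 - fps_X ^ (d * k))"
    by (simp add: algebra_simps)
  moreover have "n < d * Suc N" using step assms(1) by (cases d) auto
  ultimately show ?case using step.IH by (simp add: fps_X_power_mult_nth del: mult_Suc_right)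
qed

text \<open>A factor 1 - q^j has logarithmic derivative - j q^j / (1 - q^j); summing over the
  multiples j of d collects d times the divisor sum of n / d. The identity is checked one
  coefficient at a time, where the product may be cut off at n factors.\<close>

lemma log_deriv_eta_prod:
  assumes d: "d > 0"
  shows "log_deriv (eta_prod d) (- divisor_fps d)"
  unfolding log_deriv_def
proof (rule fps_ext)
  fix n
  define P where "P = (\<Prod>k\<in>{1..n}. 1 - fps_X ^ (d * k) :: real fps)"
  define L where "L = (\<Sum>k\<in>{1..n}. - (of_nat (d * k) * multiples_fps (d * k)))"
  have P: "fps_nth (eta_prod d) i = fps_nth P i" if "i \<le> n" for i
    unfolding P_def by (rule eta_prod_nth[OF d that])
  have LP: "log_deriv P L"
    unfolding P_def L_def using d by (intro log_deriv_prod log_deriv_euler_factor) auto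
  have L: "fps_nth L i = - fps_nth (divisor_fps d) i" if i: "i \<le> n" for i
  proof (cases "i > 0 \<and> d dvd i")
    case True
    then obtain m where m: "i = d * m" "m > 0" by auto
    have mn: "m \<le> n" using m i d by (cases d) auto
    have "fps_nth L i = - (\<Sum>k\<in>{1..n}. if k dvd m then real (d * k) else 0)"
      unfolding L_def using d m
      by (simp add: fps_sum_nth fps_of_nat[symmetric] multiples_fps_def sum_negf[symmetric] if_distrib cong: if_cong)
    also have "(\<Sum>k\<in>{1..n}. if k dvd m then real (d * k) else 0) = (\<Sum>k | k dvd m. real (d * k))"
    proof (rule sum.mono_neutral_cong_right)
      have "k \<in> {1..n}" if "k dvd m" for k
        using dvd_imp_le[OF that m(2)] dvd_pos_nat[OF m(2) that] mn by auto
      thus "{k. k dvd m} \<subseteq> {1..n}" by blast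
    qed auto
    finally show ?thesis using m d by (simp add: divisor_fps_def sigmak_def sum_distrib_left)
  next
    case False
    hence "\<not> (i > 0 \<and> d * k dvd i)" for k by (meson dvd_mult_left)
    hence "fps_nth L i = 0"
      unfolding L_def by (auto simp: fps_sum_nth fps_of_nat[symmetric] multiples_fps_def intro!: sum.neutral)
    thus ?thesis using False by (auto simp: divisor_fps_def sigmak_def)
  qed
  have "fps_nth (fps_X * fps_deriv (eta_prod d)) n = fps_nth (fps_X * fps_deriv P) n"
    unfolding fps_X_mult_deriv_nth using P[of n] by simp
  also have "\<dots> = fps_nth (P * L) n" using LP by (simp add: log_deriv_def)
  also have "\<dots> = fps_nth (eta_prod d * (- divisor_fps d)) n"
    unfolding fps_mult_nth using P L by (intro sum.cong) auto
  finally show "fps_nth (fps_X * fps_deriv (eta_prod d)) n = fps_nth (eta_prod d * - divisor_fps d) n" .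
qed

lemma eta_prod_nth_0: "fps_nth (eta_prod d) 0 = 1"
  by (simp add: eta_prod_def)

lemma eta_pow_nth_0: "fps_nth (eta_pow d r) 0 = 1"
  by (simp add: eta_pow_def eta_prod_nth_0 fps_nth_power_0)

lemma log_deriv_eta_pow:
  assumes "d > 0"
  shows "log_deriv (eta_pow d r) (- (of_int r * divisor_fps d))"
proof (cases "r \<ge> 0")
  case True
  then obtain n where "r = int n" using zero_le_imp_eq_int by auto
  thus ?thesis using log_deriv_power[OF log_deriv_eta_prod[OF assms], of n] by (simp add: eta_pow_def)
next
  case False
  define n where "n = nat (- r)"
  have r: "r = - int n" using False by (simp add: n_def)
  from False show ?thesis
    unfolding r using log_deriv_inverse[OF log_deriv_power[OF log_deriv_eta_prod[OF assms], of n]]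
    by (simp add: eta_pow_def eta_prod_nth_0 fps_nth_power_0)
qed

definition eta_fps :: "nat set \<Rightarrow> (nat \<Rightarrow> int) \<Rightarrow> real fps" where
  "eta_fps D r = (\<Prod>d\<in>D. eta_pow d (r d))"

definition eta_powi_quot :: "nat set \<Rightarrow> (nat \<Rightarrow> int) \<Rightarrow> complex \<Rightarrow> complex" where
  "eta_powi_quot D r z = (\<Prod>d\<in>D. eta (of_nat d * z) powi r d)"

lemma log_deriv_eta_fps:
  assumes "finite D" "\<And>d. d \<in> D \<Longrightarrow> d > 0"
  shows "log_deriv (eta_fps D r) (\<Sum>d\<in>D. - (of_int (r d) * divisor_fps d))"
  unfolding eta_fps_def using assms by (intro log_deriv_prod log_deriv_eta_pow) auto

lemma eta_fps_nth_0: "finite D \<Longrightarrow> fps_nth (eta_fps D r) 0 = 1"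
  unfolding eta_fps_def by (induction D rule: finite_induct) (auto simp: eta_pow_nth_0)

lemma log_deriv_cplx: "log_deriv F L \<Longrightarrow> log_deriv (cplx F) (cplx L)"
  unfolding log_deriv_def by (simp flip: cplx_deriv cplx_X cplx_mult)

text \<open>Turns the exponential in the definition of \<open>eta\<close> into a power series with
  known logarithmic derivative, so that it can be matched with a formal product.\<close>

lemma log_deriv_fps_expansion_exp:
  fixes F :: "complex fps"
  assumes F: "fps_conv_radius F \<ge> 1" "fps_nth F 0 = 0"
  obtains G where "fps_conv_radius G \<ge> 1" "fps_nth G 0 = 1" "log_deriv G (fps_X * fps_deriv F)"
    "\<And>q. norm q < 1 \<Longrightarrow> eval_fps G q = exp (eval_fps F q)"
proof -
  define g where "g = (\<lambda>q. exp (eval_fps F q))"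
  define G where "G = fps_expansion g 0"
  have sub: "eball 0 1 \<subseteq> eball (0 :: complex) (fps_conv_radius F)" by (rule eball_mono[OF F(1)])
  have hol: "g holomorphic_on eball 0 1"
    unfolding g_def by (intro holomorphic_intros sub)
  have G: "fps_conv_radius G \<ge> 1" unfolding G_def by (rule conv_radius_fps_expansion[OF hol])
  have eval: "eval_fps G q = g q" if "norm q < 1" for q
    unfolding G_def using that by (subst eval_fps_expansion'[OF hol]) auto
  have r: "ereal (norm q) < fps_conv_radius H" if "norm q < 1" "fps_conv_radius H \<ge> 1" for q :: complex and H :: "complex fps"
    using that by (auto intro: order.strict_trans2[of _ 1])
  have "fps_deriv G = G * fps_deriv F"
  proof (rule eval_fps_eqD)
    have 1: "fps_conv_radius (fps_deriv G) \<ge> 1" "fps_conv_radius (fps_deriv F) \<ge> 1"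
      using order.trans[OF G fps_conv_radius_deriv] order.trans[OF F(1) fps_conv_radius_deriv] by auto
    show "0 < fps_conv_radius (fps_deriv G)" using 1 by (auto intro: order.strict_trans2[of _ 1])
    have 2: "fps_conv_radius (G * fps_deriv F) \<ge> 1"
      using G 1 by (intro order.trans[OF _ fps_conv_radius_mult]) auto
    show "0 < fps_conv_radius (G * fps_deriv F)" using 2 by (auto intro: order.strict_trans2[of _ 1])
    have "eval_fps (fps_deriv G) q = eval_fps (G * fps_deriv F) q" if q: "q \<in> ball 0 1" for q
    proof -
      have qn: "norm q < 1" using q by simp
      have "(eval_fps G has_field_derivative eval_fps (fps_deriv G) q) (at q)"
        by (rule has_field_derivative_eval_fps[OF r[OF qn G]])
      moreover have "(eval_fps G has_field_derivative exp (eval_fps F q) * eval_fps (fps_deriv F) q) (at q)"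
      proof (rule has_field_derivative_transform_within_open)
        show "(g has_field_derivative exp (eval_fps F q) * eval_fps (fps_deriv F) q) (at q)"
          unfolding g_def by (rule DERIV_chain2[OF DERIV_exp has_field_derivative_eval_fps[OF r[OF qn F(1)]]])
        show "open (ball (0 :: complex) 1)" by simp
        show "q \<in> ball 0 1" by (rule q)
        show "g x = eval_fps G x" if "x \<in> ball 0 1" for x using eval[of x] that by simp
      qed
      ultimately have "eval_fps (fps_deriv G) q = exp (eval_fps F q) * eval_fps (fps_deriv F) q"
        by (rule DERIV_unique)
      also have "\<dots> = eval_fps (G * fps_deriv F) q"
        using r[OF qn G] r[OF qn 1(2)] by (simp add: eval_fps_mult eval[OF qn] g_def)
      finally show ?thesis .
    qed
    thus "eventually (\<lambda>q. eval_fps (fps_deriv G) q = eval_fps (G * fps_deriv F) q) (nhds 0)"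
      by (intro eventually_nhds_in_open[of "ball 0 1", THEN eventually_mono]) auto
  qed
  hence "log_deriv G (fps_X * fps_deriv F)"
    by (simp add: log_deriv_def mult.left_commute)
  moreover have "fps_nth G 0 = 1"
    using eval[of 0] F(2) by (simp add: eval_fps_at_0 g_def)
  ultimately show ?thesis using that G eval by (auto simp: g_def)
qed

text \<open>The condition on s merges the prefactors exp (2 pi i d z / 24) into the integral power
  q^s. The remaining factor agrees with the formal product because both have constant term 1 and the
  same logarithmic derivative.\<close>

lemma q_expansion_eta_quotient:
  assumes D: "finite D" "\<And>d. d \<in> D \<Longrightarrow> d > 0" and s: "(\<Sum>d\<in>D. int d * r d) = 24 * int s"
  shows "q_expansion (fps_X ^ s * eta_fps D r) (eta_powi_quot D r)"
proof -
  define F where "F = (\<Sum>d\<in>D. - (of_int (r d) * dilate d log_eta_fps))"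
  have "fps_conv_radius F \<ge> 1 \<and> (\<forall>q. norm q < 1 \<longrightarrow> eval_fps F q = (\<Sum>d\<in>D. - (of_int (r d) * eval_fps log_eta_fps (q ^ d))))"
    unfolding F_def using D
  proof (induction D rule: finite_induct)
    case empty
    show ?case by simp
  next
    case (insert d D)
    define H where "H = dilate d log_eta_fps"
    define K where "K = (\<Sum>d\<in>D. - (of_int (r d) * dilate d log_eta_fps))"
    have H: "fps_conv_radius H \<ge> 1" "\<And>q. norm q < 1 \<Longrightarrow> eval_fps H q = eval_fps log_eta_fps (q ^ d)"
      unfolding H_def using fps_conv_radius_dilate[OF fps_conv_radius_log_eta_fps, of d] insert.prems by auto
    have K: "fps_conv_radius K \<ge> 1" "\<And>q. norm q < 1 \<Longrightarrow> eval_fps K q = (\<Sum>d\<in>D. - (of_int (r d) * eval_fps log_eta_fps (q ^ d)))"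
      unfolding K_def using insert by auto
    have c: "- (of_int (r d) * H) = fps_const (- of_int (r d)) * H"
      by (simp only: fps_of_int [symmetric] fps_const_neg [symmetric] mult_minus_left)
    have H': "fps_conv_radius (fps_const (- of_int (r d)) * H) \<ge> 1"
      by (rule order.trans[OF _ fps_conv_radius_mult]) (simp add: H(1))
    have sum: "(\<Sum>d\<in>insert d D. - (of_int (r d) * dilate d log_eta_fps)) = fps_const (- of_int (r d)) * H + K"
      using insert.hyps by (simp add: H_def [symmetric] K_def [symmetric] c del: fps_const_neg)
    have lt: "ereal (norm q) < R" if "norm q < 1" "R \<ge> 1" for q :: complex and R
      using that by (auto intro: order.strict_trans2[of _ 1])
    have "eval_fps (fps_const (- of_int (r d)) * H + K) q = (\<Sum>d\<in>insert d D. - (of_int (r d) * eval_fps log_eta_fps (q ^ d)))"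
      if "norm q < 1" for q
      using that insert.hyps H(2) K(2) lt[OF that H(1)] lt[OF that K(1)] lt[OF that H']
      by (subst eval_fps_add, simp, simp, subst eval_fps_mult) auto
    moreover have "fps_conv_radius (fps_const (- of_int (r d)) * H + K) \<ge> 1"
      using H' K(1) by (intro order.trans[OF _ fps_conv_radius_add]) simp
    ultimately show ?case unfolding sum by blast
  qed
  hence F: "fps_conv_radius F \<ge> 1" "\<And>q. norm q < 1 \<Longrightarrow> eval_fps F q = (\<Sum>d\<in>D. - (of_int (r d) * eval_fps log_eta_fps (q ^ d)))"
    by auto
  have nth_int: "fps_nth (of_int k * H) n = of_int k * fps_nth H n" for k n and H :: "'a :: comm_ring_1 fps"
    by (simp add: fps_of_int [symmetric])
  have F0: "fps_nth F 0 = 0"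
    unfolding F_def by (simp add: fps_sum_nth nth_int dilate_def log_eta_fps_def)
  obtain G where G: "fps_conv_radius G \<ge> 1" "fps_nth G 0 = 1" "log_deriv G (fps_X * fps_deriv F)"
    "\<And>q. norm q < 1 \<Longrightarrow> eval_fps G q = exp (eval_fps F q)"
    using log_deriv_fps_expansion_exp[OF F(1) F0] by blast
  have L: "fps_X * fps_deriv F = cplx (\<Sum>d\<in>D. - (of_int (r d) * divisor_fps d))"
  proof (rule fps_ext)
    fix n
    have "of_nat n * (if d dvd n then of_nat (sigmak 1 (n div d)) / of_nat (n div d) else 0)
       = (if d dvd n then of_nat d * of_nat (sigmak 1 (n div d)) else 0 :: complex)" if "d \<in> D" for d
      using D(2)[OF that] by (auto elim!: dvdE simp: sigmak_def)
    hence "(\<Sum>d\<in>D. of_nat n * (of_int (r d) * (if d dvd n then of_nat (sigmak 1 (n div d)) / of_nat (n div d) else 0 :: complex)))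
      = (\<Sum>d\<in>D. of_int (r d) * (if d dvd n then of_nat d * of_nat (sigmak 1 (n div d)) else 0))"
      by (intro sum.cong) (auto simp: mult.left_commute)
    thus "fps_nth (fps_X * fps_deriv F) n = fps_nth (cplx (\<Sum>d\<in>D. - (of_int (r d) * divisor_fps d))) n"
      unfolding fps_X_mult_deriv_nth F_def
      by (simp add: fps_sum_nth nth_int dilate_def log_eta_fps_def divisor_fps_def sum_distrib_left sum_negf if_distrib cong: if_cong)
  qed
  have "G = cplx (eta_fps D r)"
  proof (rule log_deriv_unique[OF G(3)])
    show "log_deriv (cplx (eta_fps D r)) (fps_X * fps_deriv F)"
      unfolding L by (intro log_deriv_cplx log_deriv_eta_fps D)
  qed (auto simp: G(2) eta_fps_nth_0 D(1))
  hence cG: "cplx (fps_X ^ s * eta_fps D r) = fps_X ^ s * G" by (simp add: cplx_mult cplx_power cplx_X)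
  show ?thesis
    unfolding q_expansion_def cG
  proof (intro conjI allI impI)
    show "fps_conv_radius (fps_X ^ s * G) \<ge> 1"
      using G(1) by (intro order.trans[OF _ fps_conv_radius_mult]) auto
    fix z assume z: "Im z > 0"
    have q: "norm (qexp z) < 1" by (rule norm_qexp_less_1[OF z])
    have "eta (of_nat d * z) powi r d = exp (of_int (r d) * (of_real pi * \<i> * (of_nat d * z) / 12) - of_int (r d) * eval_fps log_eta_fps (qexp z ^ d))" for d
      unfolding eta_def exp_power_int qexp_of_nat_mult by (simp add: right_diff_distrib)
    hence "eta_powi_quot D r z = exp (\<Sum>d\<in>D. of_int (r d) * (of_real pi * \<i> * (of_nat d * z) / 12) - of_int (r d) * eval_fps log_eta_fps (qexp z ^ d))"
      unfolding eta_powi_quot_def using D(1) by (simp add: exp_sum)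
    also have "(\<Sum>d\<in>D. of_int (r d) * (of_real pi * \<i> * (of_nat d * z) / 12) - of_int (r d) * eval_fps log_eta_fps (qexp z ^ d))
       = (\<Sum>d\<in>D. of_int (r d) * (of_real pi * \<i> * (of_nat d * z) / 12)) + eval_fps F (qexp z)"
      unfolding F(2)[OF q] by (simp add: sum_subtractf sum_negf)
    also have "(\<Sum>d\<in>D. of_int (r d) * (of_real pi * \<i> * (of_nat d * z) / 12)) = of_real pi * \<i> * z / 12 * of_int (\<Sum>d\<in>D. int d * r d)"
      by (simp add: sum_distrib_left mult_ac)
    also have "\<dots> = of_nat s * (2 * of_real pi * \<i> * z)" unfolding s by simp
    also have "exp (of_nat s * (2 * of_real pi * \<i> * z) + eval_fps F (qexp z)) = qexp z ^ s * eval_fps G (qexp z)"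
      unfolding G(4)[OF q] exp_add by (simp add: qexp_def exp_of_nat_mult)
    also have "\<dots> = eval_fps (fps_X ^ s * G) (qexp z)"
      using qexp_less_conv_radius[OF G(1) z] by (subst eval_fps_mult) auto
    finally show "eta_powi_quot D r z = eval_fps (fps_X ^ s * G) (qexp z)" .
  qed
qed

lemma eta_powi_quot_mult:
  "eta_powi_quot D r z * eta_powi_quot D r' z = eta_powi_quot D (\<lambda>d. r d + r' d) z"
  by (simp add: eta_powi_quot_def power_int_add flip: prod.distrib)

lemma eta_powi_quot_even: "eta_powi_quot D (\<lambda>d. 2 * r d) = eta_quot D r"
  by (simp add: eta_powi_quot_def eta_quot_def power_int_mult fun_eq_iff)

section \<open>The eta quotients of level 22\<close>

abbreviation D22 :: "nat set" where "D22 \<equiv> {1, 2, 11, 22}"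

definition exps22 :: "int \<Rightarrow> int \<Rightarrow> int \<Rightarrow> int \<Rightarrow> nat \<Rightarrow> int" where
  "exps22 r1 r2 r11 r22 d = (if d = 1 then r1 else if d = 2 then r2 else if d = 11 then r11 else r22)"

lemma sum_D22: "(\<Sum>d\<in>D22. f d) = f 1 + f 2 + f 11 + (f 22 :: 'a :: comm_monoid_add)"
  by (simp add: add.assoc)

lemma prod_D22: "(\<Prod>d\<in>D22. f d) = f 1 * f 2 * f 11 * (f 22 :: 'a :: comm_monoid_mult)"
  by (simp add: mult.assoc)

lemma exps22_double: "exps22 (2 * r1) (2 * r2) (2 * r11) (2 * r22) = (\<lambda>d. 2 * exps22 r1 r2 r11 r22 d)"
  by (auto simp: exps22_def)

lemma exps22_add:
  "(\<lambda>d. exps22 r1 r2 r11 r22 d + exps22 s1 s2 s11 s22 d) = exps22 (r1 + s1) (r2 + s2) (r11 + s11) (r22 + s22)"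
  by (auto simp: exps22_def)

lemma eta_fps_exps22:
  "eta_fps D22 (exps22 r1 r2 r11 r22) = eta_pow 1 r1 * eta_pow 2 r2 * eta_pow 11 r11 * eta_pow 22 r22"
  unfolding eta_fps_def prod_D22 by (simp add: exps22_def)

lemma eta_pow_0: "eta_pow d 0 = 1"
  by (simp add: eta_pow_def)

lemma B_conv_eta_fps:
  "B1 = fps_X ^ 1 * eta_fps D22 (exps22 6 (-2) 6 (-2))"
  "B2 = fps_X ^ 2 * eta_fps D22 (exps22 4 0 4 0)"
  "B3 = fps_X ^ 3 * eta_fps D22 (exps22 2 2 2 2)"
  "B4 = fps_X ^ 4 * eta_fps D22 (exps22 0 4 0 4)"
  "B5 = fps_X ^ 5 * eta_fps D22 (exps22 (-2) 6 (-2) 6)"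
  "B6 = fps_X ^ 6 * eta_fps D22 (exps22 (-1) 1 3 5)"
  "B7 = fps_X ^ 1 * eta_fps D22 (exps22 (-5) 9 7 (-3))"
  unfolding B1_def B2_def B3_def B4_def B5_def B6_def B7_def eta_fps_exps22
  by (simp_all only: eta_pow_0 mult_1_left mult_1_right mult_ac)

text \<open>The four possibilities correspond to the four cusps, so the order condition for an eta
  quotient amounts to four inequalities.\<close>

lemma gcd_level_22:
  fixes c :: int
  shows "(gcd c 2, gcd c 11, gcd c 22) \<in> {(1, 1, 1), (2, 1, 2), (1, 11, 11), (2, 11, 22)}"
proof -
  have *: "gcd c 2 = gcd (c mod 22) 2" "gcd c 11 = gcd (c mod 22) 11" "gcd c 22 = gcd (c mod 22) 22"
    using gcd_add_mult[of 2 "11 * (c div 22)" "c mod 22"] gcd_add_mult[of 11 "2 * (c div 22)" "c mod 22"]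
      gcd_add_mult[of 22 "c div 22" "c mod 22"]
    by (simp_all add: gcd.commute mult.commute)
  have "\<forall>r\<in>set [0..21 :: int]. (gcd r 2, gcd r 11, gcd r 22) \<in> {(1, 1, 1), (2, 1, 2), (1, 11, 11), (2, 11, 22)}"
    by code_simp
  moreover have "c mod 22 \<in> set [0..21]" by auto
  ultimately have "(gcd (c mod 22) 2, gcd (c mod 22) 11, gcd (c mod 22) 22) \<in> {(1, 1, 1), (2, 1, 2), (1, 11, 11), (2, 11, 22)}"
    by (rule bspec)
  thus ?thesis by (simp only: *)
qed

text \<open>The entry c of a matrix in the subgroup is 22 k, so the quotients c / \<delta> become 22
  k, 11 k, 2 k and k, and the expression depends only on residues of a, b, k and e.\<close>

definition eta_char_sum :: "int \<Rightarrow> int \<Rightarrow> int \<Rightarrow> int \<Rightarrow> int \<Rightarrow> int \<Rightarrow> int \<Rightarrow> int \<Rightarrow> int" where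
  "eta_char_sum s1 s2 s11 s22 a b k e = eta_char a b (22 * k) e * s1 + eta_char a (b * 2) (11 * k) e * s2
     + eta_char a (b * 11) (2 * k) e * s11 + eta_char a (b * 22) k e * s22"

lemma cong_eta_char': "[a = a'] (mod m) \<Longrightarrow> [b = b'] (mod m) \<Longrightarrow> [c = c'] (mod m) \<Longrightarrow> [d = d'] (mod m) \<Longrightarrow>
  [eta_char a b c d = eta_char a' b' c' d'] (mod m)"
  unfolding eta_char_def by (intro cong_add cong_mult cong_diff cong_pow cong_refl)

lemma cong_eta_char_sum:
  "[eta_char_sum s1 s2 s11 s22 a b k e = eta_char_sum s1 s2 s11 s22 (a mod m) (b mod m) (k mod m) (e mod m)] (mod m)"
  unfolding eta_char_sum_def
  by (intro cong_add cong_mult cong_eta_char' cong_refl) auto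

text \<open>Exponents of \<open>\<eta>(d z)\<^sup>2\<close> for \<open>d = 1, 2, 11, 22\<close> in \<open>B1, \<dots>, B5, B6\<^sup>2, B6 B7, B7\<^sup>2\<close>.\<close>
definition weights22 :: "(int \<times> int \<times> int \<times> int) list" where
  "weights22 = [(3, -1, 3, -1), (2, 0, 2, 0), (1, 1, 1, 1), (0, 2, 0, 2), (-1, 3, -1, 3),
     (-1, 1, 3, 5), (-3, 5, 5, 1), (-5, 9, 7, -3)]"

lemma eta_char_sum_check:
  "\<forall>m\<in>set [3, 4]. \<forall>a\<in>set [0..m-1]. \<forall>b\<in>set [0..m-1]. \<forall>k\<in>set [0..m-1]. \<forall>e\<in>set [0..m-1].
     (a * e - b * (22 * k)) mod m = 1 \<longrightarrow>
     (\<forall>(s1, s2, s11, s22)\<in>set weights22. eta_char_sum s1 s2 s11 s22 a b k e mod m = 0)"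
  by code_simp

lemma eta_char_sum_dvd:
  assumes s: "(s1, s2, s11, s22) \<in> set weights22" and det: "a * e - b * (22 * k) = 1"
  shows "12 dvd eta_char_sum s1 s2 s11 s22 a b k e"
proof -
  have key: "m dvd eta_char_sum s1 s2 s11 s22 a b k e" if m: "m \<in> set [3, 4]" for m
  proof -
    have m1: "m > 1" using m by auto
    have "((a mod m) * (e mod m) - (b mod m) * (22 * (k mod m))) mod m = (a * e - b * (22 * k)) mod m"
      by (intro mod_diff_cong mod_mult_cong mod_mod_trivial refl)
    hence h: "((a mod m) * (e mod m) - (b mod m) * (22 * (k mod m))) mod m = 1"
      using m1 by (simp only: det) simp
    have mem: "x mod m \<in> set [0..m-1]" for x using m1 by simp
    from eta_char_sum_check[THEN bspec, OF m, THEN bspec, OF mem[of a], THEN bspec, OF mem[of b],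
        THEN bspec, OF mem[of k], THEN bspec, OF mem[of e]] h
    have "\<forall>(s1, s2, s11, s22)\<in>set weights22. eta_char_sum s1 s2 s11 s22 (a mod m) (b mod m) (k mod m) (e mod m) mod m = 0"
      by (rule mp)
    hence "m dvd eta_char_sum s1 s2 s11 s22 (a mod m) (b mod m) (k mod m) (e mod m)"
      using s by (auto simp: mod_eq_0_iff_dvd)
    thus ?thesis using cong_dvd_iff[OF cong_eta_char_sum] by blast
  qed
  have "12 dvd x" if "3 dvd x" "4 dvd x" for x :: int using that by presburger
  thus ?thesis using key[of 3] key[of 4] by simp
qed

lemma modform_eta_quot22:
  assumes s: "(s1, s2, s11, s22) \<in> set weights22" and k: "s1 + s2 + s11 + s22 = int k"
  shows "modform 22 k (eta_quot D22 (exps22 s1 s2 s11 s22))"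
proof (rule modform_eta_quot)
  show "\<delta> dvd 22" if "\<delta> \<in> D22" for \<delta> using that by auto
  show "(\<Sum>\<delta>\<in>D22. exps22 s1 s2 s11 s22 \<delta>) = int k" unfolding sum_D22 k[symmetric] by (simp add: exps22_def)
  show "12 dvd (\<Sum>\<delta>\<in>D22. eta_char a (b * int \<delta>) (c div int \<delta>) e * exps22 s1 s2 s11 s22 \<delta>)"
    if det: "a * e - b * c = 1" and c: "int 22 dvd c" for a b c e
  proof -
    from c obtain k where c: "c = 22 * k" by auto
    have "12 dvd eta_char_sum s1 s2 s11 s22 a b k e"
      by (rule eta_char_sum_dvd[OF s]) (use det c in simp)
    moreover have "(22 * k) div 2 = 11 * k" "(22 * k) div 11 = 2 * k" "(22 * k) div 22 = k" by simp_all
    ultimately show ?thesis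
      unfolding sum_D22 c by (simp add: exps22_def eta_char_sum_def)
  qed
  show "0 \<le> (\<Sum>\<delta>\<in>D22. real_of_int (exps22 s1 s2 s11 s22 \<delta>) * (real_of_int (gcd c (int \<delta>)))\<^sup>2 / real \<delta>)" for c
    using gcd_level_22[of c] s unfolding sum_D22
    by (auto simp: exps22_def weights22_def)
qed auto

section \<open>Computation of the first 25 coefficients\<close>

definition sigma_list :: "nat \<Rightarrow> nat \<Rightarrow> int" where
  "sigma_list k n = sum_list (map (\<lambda>d. d ^ k) (filter (\<lambda>d. int n mod d = 0) [1..int n]))"

lemma sigmak_conv_list: "int (sigmak k n) = sigma_list k n"
proof (cases "n = 0")
  case False
  have "sigma_list k n = (\<Sum>d\<in>{d. 1 \<le> d \<and> d \<le> int n \<and> int n mod d = 0}. d ^ k)"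
    unfolding sigma_list_def by (subst sum_list_distinct_conv_sum_set) (auto intro!: sum.cong)
  also have "\<dots> = (\<Sum>d | d dvd n. int d ^ k)"
  proof (rule sum.reindex_bij_witness[where i = int and j = nat], goal_cases)
    case (2 d)
    hence "int (nat d) dvd int n" by (auto simp: mod_eq_0_iff_dvd)
    thus ?case by (simp only: of_nat_dvd_iff mem_Collect_eq)
  next
    case (4 d)
    hence "d > 0" "d \<le> n" using False by (auto intro: Nat.gr0I dvd_imp_le)
    thus ?case using 4 by (auto simp: zmod_int [symmetric])
  qed auto
  finally show ?thesis using False by (simp add: sigmak_def)
qed (simp add: sigmak_def sigma_list_def)

text \<open>The coefficients of the logarithmic derivative of an eta quotient of level 22, read from
  a table of divisor sums.\<close>

definition log_coeff :: "int list \<Rightarrow> int \<Rightarrow> int \<Rightarrow> int \<Rightarrow> int \<Rightarrow> nat \<Rightarrow> int" where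
  "log_coeff sg r1 r2 r11 r22 m = - (r1 * sg ! m + r2 * (if 2 dvd m then 2 * sg ! (m div 2) else 0)
     + r11 * (if 11 dvd m then 11 * sg ! (m div 11) else 0) + r22 * (if 22 dvd m then 22 * sg ! (m div 22) else 0))"

definition sigma_table :: "int list" where
  "sigma_table = [0, 1, 3, 4, 7, 6, 12, 8, 15, 13, 18, 12, 28, 14, 24, 24, 31, 18, 39, 20, 42, 32, 36, 24, 60]"

lemma sigma_table_check: "\<forall>n\<in>set [0..<25]. sigma_list 1 n = sigma_table ! n"
  by code_simp

lemma sigma_table: "n < 25 \<Longrightarrow> real (sigmak 1 n) = of_int (sigma_table ! n)"
  using sigma_table_check sigmak_conv_list[of 1 n] by (metis atLeast0LessThan lessThan_iff of_int_of_nat_eq set_upt)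

text \<open>Certifies a given list against the recursion coming from the logarithmic derivative, so
  that no power series has to be multiplied or inverted.\<close>

definition eta_coeff_check :: "int list \<Rightarrow> int \<Rightarrow> int \<Rightarrow> int \<Rightarrow> int \<Rightarrow> bool" where
  "eta_coeff_check qs r1 r2 r11 r22 \<longleftrightarrow> qs ! 0 = 1 \<and> (\<forall>n\<in>set [1..<25]. int n * qs ! n =
     sum_list (map (\<lambda>j. qs ! j * log_coeff sigma_table r1 r2 r11 r22 (n - j)) [0..<n]))"

lemma eta_fps_nth_list:
  assumes "eta_coeff_check qs r1 r2 r11 r22" "n < 25"
  shows "fps_nth (eta_fps D22 (exps22 r1 r2 r11 r22)) n = of_int (qs ! n)"
  using assms(2)
proof (induction n rule: less_induct)
  case (less n)
  define F where "F = eta_fps D22 (exps22 r1 r2 r11 r22)"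
  define L where "L = (\<Sum>d\<in>D22. - (of_int (exps22 r1 r2 r11 r22 d) * divisor_fps d))"
  have FL: "log_deriv F L" unfolding F_def L_def by (rule log_deriv_eta_fps) auto
  have nth_int: "fps_nth (of_int k * H) n = of_int k * fps_nth H n" for k n and H :: "real fps"
    by (simp add: fps_of_int [symmetric])
  have L: "fps_nth L m = of_int (log_coeff sigma_table r1 r2 r11 r22 m)" if "m < 25" for m
  proof -
    have "fps_nth L m = - (\<Sum>d\<in>D22. of_int (exps22 r1 r2 r11 r22 d) * (if d dvd m then real d * of_int (sigma_table ! (m div d)) else 0))"
      unfolding L_def
      by (simp add: fps_sum_nth nth_int divisor_fps_def sum_negf sigma_table that order.strict_trans1[OF div_le_dividend] del: One_nat_def cong: if_cong)
    thus ?thesis unfolding sum_D22 by (simp add: exps22_def log_coeff_def)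
  qed
  show ?case
  proof (cases "n = 0")
    case True
    thus ?thesis using assms(1) by (simp add: eta_fps_nth_0 eta_coeff_check_def)
  next
    case False
    have "of_nat n * fps_nth F n = (\<Sum>j=0..n. fps_nth F j * fps_nth L (n - j))"
      using FL by (simp add: log_deriv_def fps_X_mult_deriv_nth [symmetric] fps_mult_nth)
    also have "\<dots> = (\<Sum>j<n. fps_nth F j * fps_nth L (n - j))"
      by (intro sum.mono_neutral_right) (auto simp: L log_coeff_def sigma_table_def not_less le_less)
    also have "\<dots> = (\<Sum>j<n. of_int (qs ! j) * of_int (log_coeff sigma_table r1 r2 r11 r22 (n - j)))"
      using less L by (intro sum.cong) (auto simp: F_def)
    also have "\<dots> = of_int (sum_list (map (\<lambda>j. qs ! j * log_coeff sigma_table r1 r2 r11 r22 (n - j)) [0..<n]))"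
      by (simp add: sum_list_distinct_conv_sum_set atLeast0LessThan)
    also have "\<dots> = of_int (int n * qs ! n)"
      using assms(1) less.prems False by (simp add: eta_coeff_check_def)
    finally show ?thesis using False by (simp add: F_def)
  qed
qed

text \<open>This list and the following ones start at the leading power of q of the respective
  quotient; \<open>B_nth\<close> restores the shift.\<close>

definition B1_table :: "int list" where
  "B1_table = [1, -6, 11, -2, -7, -10, 6, 32, -18, -6, -11, -6, 20, -44, 35, 60, 46, -68, -192, 78, 66, 66, -5, 48, 36]"

definition B2_table :: "int list" where
  "B2_table = [1, -4, 2, 8, -5, -4, -10, 8, 9, 0, 14, -20, 6, -12, -32, 12, 30, 60, -30, -36, -11, -36, 34, 16, 20]"

definition B3_table :: "int list" where
  "B3_table = [1, -2, -3, 6, 2, 0, -1, -10, 0, -2, 10, 4, -3, 20, -12, -14, -12, 2, 14, 0, 13, -24, -5, 20, -1]"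

definition B4_table :: "int list" where
  "B4_table = [1, 0, -4, 0, 2, 0, 8, 0, -5, 0, -4, 0, -10, 0, 8, 0, 9, 0, 0, 0, 14, 0, -20, 0, 6]"

definition B5_table :: "int list" where
  "B5_table = [1, 2, -1, -2, -1, -6, 0, 4, -5, 4, 6, 4, 9, -2, -3, -4, -5, 0, -4, -14, 1, 20, -2, 0, 0]"

definition B6_table :: "int list" where
  "B6_table = [1, 1, 1, 2, 2, 3, 4, 5, 6, 8, 10, 9, 12, 15, 16, 21, 23, 26, 31, 36, 40, 46, 48, 54, 63]"

definition B7_table :: "int list" where
  "B7_table = [1, 5, 11, 20, 37, 56, 83, 131, 180, 247, 352, 456, 581, 748, 915, 1094, 1355, 1626, 1843, 2212, 2563, 2816, 3317, 3733, 4084]"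

lemma B_table_checks:
  "eta_coeff_check B1_table 6 (-2) 6 (-2)"
  "eta_coeff_check B2_table 4 0 4 0"
  "eta_coeff_check B3_table 2 2 2 2"
  "eta_coeff_check B4_table 0 4 0 4"
  "eta_coeff_check B5_table (-2) 6 (-2) 6"
  "eta_coeff_check B6_table (-1) 1 3 5"
  "eta_coeff_check B7_table (-5) 9 7 (-3)"
  by code_simp+

lemma B_nth:
  assumes "n < 25"
  shows
    "fps_nth B1 n = of_int (if n < 1 then 0 else B1_table ! (n - 1))"
    and "fps_nth B2 n = of_int (if n < 2 then 0 else B2_table ! (n - 2))"
    and "fps_nth B3 n = of_int (if n < 3 then 0 else B3_table ! (n - 3))"
    and "fps_nth B4 n = of_int (if n < 4 then 0 else B4_table ! (n - 4))"
    and "fps_nth B5 n = of_int (if n < 5 then 0 else B5_table ! (n - 5))"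
    and "fps_nth B6 n = of_int (if n < 6 then 0 else B6_table ! (n - 6))"
    and "fps_nth B7 n = of_int (if n < 1 then 0 else B7_table ! (n - 1))"
  using assms unfolding B_conv_eta_fps
  by (auto simp: fps_X_power_mult_nth eta_fps_nth_list[OF B_table_checks(1)] eta_fps_nth_list[OF B_table_checks(2)]
    eta_fps_nth_list[OF B_table_checks(3)] eta_fps_nth_list[OF B_table_checks(4)] eta_fps_nth_list[OF B_table_checks(5)]
    eta_fps_nth_list[OF B_table_checks(6)] eta_fps_nth_list[OF B_table_checks(7)] simp del: One_nat_def power_one_right)

definition frac_list :: "nat \<Rightarrow> nat \<Rightarrow> nat \<Rightarrow> int" where
  "frac_list k n d = (if d dvd n then sigma_list k (n div d) else 0)"

lemma sigmak_frac_conv_list: "int (sigmak_frac k n d) = frac_list k n d"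
  by (simp add: sigmak_frac_def frac_list_def sigmak_conv_list)

text \<open>The factor 16104 is the common denominator of the claimed formula.\<close>
lemma low_coefficients_check:
  "\<forall>n\<in>set [1..<25]. 16104 * sigma_list 1 (n - 22) = 187 * sigma_list 3 n - 132 * frac_list 3 n 2 + 1155 * frac_list 3 n 11
     + 5500 * frac_list 3 n 22 + (671 - 183 * int n) * sigma_list 1 n + (671 - 4026 * int n) * frac_list 1 n 22
     - 126 * (if n < 1 then 0 else B1_table ! (n - 1))
     - 477 * (if n < 2 then 0 else B2_table ! (n - 2))
     - 207 * (if n < 3 then 0 else B3_table ! (n - 3))
     - 768 * (if n < 4 then 0 else B4_table ! (n - 4))
     + 528 * (if n < 5 then 0 else B5_table ! (n - 5))
     - 14091 * (if n < 6 then 0 else B6_table ! (n - 6))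
     - 549 * (if n < 1 then 0 else B7_table ! (n - 1))"
  by code_simp

definition W_formula :: "nat \<Rightarrow> real" where
  "W_formula n = 17/1464 * real (sigmak 3 n) - 1/122 * real (sigmak_frac 3 n 2)
    + 35/488 * real (sigmak_frac 3 n 11) + 125/366 * real (sigmak_frac 3 n 22)
    + (1/24 - real n / 88) * real (sigmak 1 n) + (1/24 - real n / 4) * real (sigmak_frac 1 n 22)
    - 21/2684 * fps_nth B1 n - 159/5368 * fps_nth B2 n - 69/5368 * fps_nth B3 n
    - 32/671 * fps_nth B4 n + 2/61 * fps_nth B5 n - 7/8 * fps_nth B6 n - 3/88 * fps_nth B7 n"

definition sigma_rfps :: "real fps" where
  "sigma_rfps = Abs_fps (\<lambda>n. real (sigmak 1 n))"

lemma W_conv_fps: "real (W 1 22 n) = fps_nth (sigma_rfps * dilate 22 sigma_rfps) n"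
proof -
  have "fps_nth (sigma_rfps * dilate 22 sigma_rfps) n =
     (\<Sum>l=0..n. real (sigmak 1 l) * (if 22 dvd n - l then real (sigmak 1 ((n - l) div 22)) else 0))"
    by (auto simp: fps_mult_nth sigma_rfps_def dilate_def intro!: sum.cong)
  also have "\<dots> = (\<Sum>l\<in>{l. l \<le> n \<and> 22 dvd n - l}. real (sigmak 1 l) * real (sigmak 1 ((n - l) div 22)))"
    by (intro sum.mono_neutral_cong_right) auto
  also have "\<dots> = (\<Sum>(l, m)\<in>{(l, m). 1 * l + 22 * m = n}. real (sigmak 1 l) * real (sigmak 1 m))"
    by (rule sum.reindex_bij_witness[where i = fst and j = "\<lambda>l. (l, (n - l) div 22)"]) auto
  also have "\<dots> = real (W 1 22 n)"
    unfolding W_def by (simp add: case_prod_unfold)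
  finally show ?thesis ..
qed

text \<open>Below 25 only m = 0 and m = 1 occur, and m = 0 contributes nothing. For n < 22 the
  truncated subtraction yields the argument 0, where the divisor sum is 0 as well.\<close>

lemma W_low:
  assumes "n < 25"
  shows "W 1 22 n = sigmak 1 (n - 22)"
proof -
  have s0: "sigmak 1 0 = 0" "sigmak 1 1 = 1" by (auto simp: sigmak_def)
  have "W 1 22 n = (\<Sum>(l, m)\<in>(if n \<ge> 22 then {(n - 22, 1), (n, 0)} else {(n, 0)}). sigmak 1 l * sigmak 1 m)"
    unfolding W_def
  proof (rule sum.cong)
    show "{(l, m). 1 * l + 22 * m = n} = (if n \<ge> 22 then {(n - 22, 1), (n, 0)} else {(n, 0)})"
      using assms by (auto split: if_splits; presburger)
  qed simp
  also have "\<dots> = sigmak 1 (n - 22)"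
    using s0 by (auto simp del: One_nat_def)
  finally show ?thesis .
qed

lemma W_formula_low:
  assumes "n > 0" "n < 25"
  shows "real (W 1 22 n) = W_formula n"
proof -
  have "n \<in> set [1..<25]" using assms by auto
  from bspec[OF low_coefficients_check this, THEN arg_cong[where f = real_of_int]]
  have "16104 * real (sigmak 1 (n - 22)) = 187 * real (sigmak 3 n) - 132 * real (sigmak_frac 3 n 2) + 1155 * real (sigmak_frac 3 n 11)
     + 5500 * real (sigmak_frac 3 n 22) + (671 - 183 * real n) * real (sigmak 1 n) + (671 - 4026 * real n) * real (sigmak_frac 1 n 22)
     - 126 * fps_nth B1 n - 477 * fps_nth B2 n - 207 * fps_nth B3 n - 768 * fps_nth B4 n + 528 * fps_nth B5 n
     - 14091 * fps_nth B6 n - 549 * fps_nth B7 n"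
    unfolding B_nth[OF assms(2)] sigmak_conv_list [symmetric] sigmak_frac_conv_list [symmetric] by simp
  thus ?thesis
    unfolding W_low[OF assms(2)] W_formula_def by (simp add: algebra_simps)
qed

section \<open>The convolution identity\<close>

text \<open>In \<open>(L(q) - 22 L(q\<^sup>2\<^sup>2))\<^sup>2\<close> the sum \<open>W 1 22 n\<close> has the coefficient \<open>- 44 * 576 = - 25344\<close>. The
  coefficients below are those of the claimed formula multiplied by this number, after moving the
  contribution of the two squares to the Eisenstein series.\<close>
definition eis_part :: "real fps" where
  "eis_part = (eis2_rfps - fps_const 22 * dilate 22 eis2_rfps) ^ 2
    - (fps_const (- 69/305) * eis4_rfps + fps_const (264/305) * dilate 2 eis4_rfps
       + fps_const (- 462/61) * dilate 11 eis4_rfps + fps_const (27324/61) * dilate 22 eis4_rfps)"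

definition even_part :: "real fps" where
  "even_part = fps_const (12096/61) * B1 + fps_const (45792/61) * B2 + fps_const (19872/61) * B3
     + fps_const (73728/61) * B4 + fps_const (- 50688/61) * B5"

definition odd_part :: "real fps" where
  "odd_part = fps_const 22176 * B6 + fps_const 864 * B7"

text \<open>The constants 1/24 of the formula come from the linear terms of the mixed product, 44 *
  24 / 25344. The terms with n come from the derivative parts of the two squares: 288 / 25344 = 1/88
  and 484 * 288 / (22 * 25344) = 1/4.\<close>

lemma eis_part_nth:
  assumes "n > 0"
  shows "fps_nth (eis_part - even_part - odd_part) n = - 25344 * (real (W 1 22 n) - W_formula n)"
proof -
  define P where "P = eis2_rfps"
  define P' where "P' = dilate 22 P"
  have PS: "P = 1 - fps_const 24 * sigma_rfps"
    by (rule fps_ext) (simp add: P_def eis2_rfps_def sigma_rfps_def sigmak_def)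
  have PS': "P' = 1 - fps_const 24 * dilate 22 sigma_rfps"
    by (rule fps_ext) (auto simp: P'_def P_def eis2_rfps_def dilate_def sigma_rfps_def sigmak_def)
  have sq: "(P - fps_const 22 * P') ^ 2 = P * P - fps_const 44 * (P * P') + fps_const 484 * (P' * P')"
  proof -
    have "fps_const 44 = 2 * (fps_const 22 :: real fps)" "fps_const 484 = fps_const 22 * (fps_const 22 :: real fps)"
      by (simp_all add: numeral_fps_const)
    thus ?thesis by (simp add: power2_eq_square algebra_simps)
  qed
  have 1: "fps_nth (P * P) n = 240 * real (sigmak 3 n) - 288 * (real n * real (sigmak 1 n))"
    using assms unfolding P_def eis2_rfps_square by simp
  have "P' * P' = dilate 22 (P * P)" by (simp add: P_def P'_def dilate_mult)
  hence 2: "fps_nth (P' * P') n = 240 * real (sigmak_frac 3 n 22) - 288 / 22 * (real n * real (sigmak_frac 1 n 22))"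
    using assms by (auto simp: dilate_def P_def eis2_rfps_square sigmak_frac_def elim!: dvdE)
  have PP': "P * P' = 1 - fps_const 24 * sigma_rfps - fps_const 24 * dilate 22 sigma_rfps
      + fps_const 576 * (sigma_rfps * dilate 22 sigma_rfps)"
  proof -
    have "fps_const 576 = fps_const 24 * (fps_const 24 :: real fps)" by simp
    thus ?thesis unfolding PS PS' by (simp only: ring_distribs left_diff_distrib right_diff_distrib mult_1_left mult_1_right mult_ac) simp
  qed
  have 3: "fps_nth (P * P') n = - 24 * real (sigmak 1 n) - 24 * real (sigmak_frac 1 n 22) + 576 * real (W 1 22 n)"
  proof -
    have "fps_nth sigma_rfps n = real (sigmak 1 n)" "fps_nth (dilate 22 sigma_rfps) n = real (sigmak_frac 1 n 22)"
      by (simp_all add: sigma_rfps_def dilate_def sigmak_frac_def)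
    thus ?thesis using assms unfolding PP' by (simp add: W_conv_fps del: One_nat_def)
  qed
  have 4: "fps_nth (dilate d eis4_rfps) n = 240 * real (sigmak_frac 3 n d)" if "d > 0" for d
    using assms that by (auto simp: dilate_def eis4_rfps_def sigmak_frac_def elim!: dvdE)
  have 5: "fps_nth eis4_rfps n = 240 * real (sigmak 3 n)"
    using assms by (simp add: eis4_rfps_def)
  have "fps_nth (eis_part - even_part - odd_part) n =
      fps_nth (P * P) n - 44 * fps_nth (P * P') n + 484 * fps_nth (P' * P') n
      - (- 69/305 * fps_nth eis4_rfps n + 264/305 * fps_nth (dilate 2 eis4_rfps) n
       - 462/61 * fps_nth (dilate 11 eis4_rfps) n + 27324/61 * fps_nth (dilate 22 eis4_rfps) n)
      - (12096/61 * fps_nth B1 n + 45792/61 * fps_nth B2 n + 19872/61 * fps_nth B3 n + 73728/61 * fps_nth B4 n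
       - 50688/61 * fps_nth B5 n) - (22176 * fps_nth B6 n + 864 * fps_nth B7 n)"
    unfolding eis_part_def even_part_def odd_part_def P_def [symmetric] P'_def [symmetric] sq
    by (simp del: fps_const_neg fps_const_mult)
  also have "\<dots> = - 25344 * (real (W 1 22 n) - W_formula n)"
    unfolding 1 2 3 5 4[OF zero_less_numeral] W_formula_def by (simp add: algebra_simps del: One_nat_def)
  finally show ?thesis .
qed

text \<open>For positive n this is the checked instance of the formula. At n = 0 it says that the
  four Eisenstein coefficients add up to (1 - 22)^2 = 441.\<close>

lemma low_coefficients_vanish:
  assumes "n < 25"
  shows "fps_nth (eis_part - even_part - odd_part) n = 0"
proof (cases "n = 0")
  case True
  have B0: "fps_nth B1 0 = 0" "fps_nth B2 0 = 0" "fps_nth B3 0 = 0" "fps_nth B4 0 = 0" "fps_nth B5 0 = 0"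
    "fps_nth B6 0 = 0" "fps_nth B7 0 = 0"
    by (simp_all add: B_nth)
  show ?thesis
    by (simp add: True eis_part_def even_part_def odd_part_def B0 fps_nth_power_0 dilate_def eis2_rfps_def eis4_rfps_def)
next
  case False
  hence "fps_nth (eis_part - even_part - odd_part) n = - 25344 * (real (W 1 22 n) - W_formula n)"
    by (intro eis_part_nth) simp
  also have "\<dots> = 0" using W_formula_low[of n] False assms by simp
  finally show ?thesis .
qed

section \<open>Modularity of the two sides\<close>

definition eis_fun :: "complex \<Rightarrow> complex" where
  "eis_fun z = (eis2 z - 22 * eis2 (22 * z)) ^ 2
    - (of_real (- 69/305) * eis4 z + of_real (264/305) * eis4 (2 * z)
       + of_real (- 462/61) * eis4 (11 * z) + of_real (27324/61) * eis4 (22 * z))"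

lemma q_expansion_eis_part: "q_expansion eis_part eis_fun"
proof -
  have "q_expansion eis_part (\<lambda>z. (eis2 z - of_real 22 * eis2 (of_nat 22 * z)) ^ 2
    - (of_real (- 69/305) * eis4 z + of_real (264/305) * eis4 (of_nat 2 * z)
       + of_real (- 462/61) * eis4 (of_nat 11 * z) + of_real (27324/61) * eis4 (of_nat 22 * z)))"
    unfolding eis_part_def
    by (intro q_expansion_diff q_expansion_add q_expansion_power q_expansion_cmult q_expansion_dilate
          q_expansion_eis2 q_expansion_eis4) auto
  thus ?thesis by (rule q_expansion_cong) (simp add: eis_fun_def)
qed

lemma modform_eis_fun: "modform 22 4 eis_fun"
proof -
  have 1: "modform 22 4 (\<lambda>z. (eis2 z - of_nat 22 * eis2 (of_nat 22 * z)) ^ 2)"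
    using modform_power[OF modform_eis2_diff[of 22 22], of 2] by simp
  have 2: "modform 22 4 (\<lambda>z. eis4 (of_nat d * z))" if "d dvd 22" for d
    by (rule modform_eis4) (use that in auto)
  have "modform 22 4 (\<lambda>z. (eis2 z - of_nat 22 * eis2 (of_nat 22 * z)) ^ 2
    - (of_real (- 69/305) * eis4 (of_nat 1 * z) + of_real (264/305) * eis4 (of_nat 2 * z)
       + of_real (- 462/61) * eis4 (of_nat 11 * z) + of_real (27324/61) * eis4 (of_nat 22 * z)))"
    by (intro modform_diff modform_add modform_cmult 1 2) auto
  thus ?thesis by (simp add: eis_fun_def [abs_def])
qed

abbreviation eta22 :: "int \<Rightarrow> int \<Rightarrow> int \<Rightarrow> int \<Rightarrow> complex \<Rightarrow> complex" where
  "eta22 r1 r2 r11 r22 \<equiv> eta_powi_quot D22 (exps22 r1 r2 r11 r22)"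

lemma q_expansion_eta22:
  assumes "r1 + 2 * r2 + 11 * r11 + 22 * r22 = 24 * int s"
  shows "q_expansion (fps_X ^ s * eta_fps D22 (exps22 r1 r2 r11 r22)) (eta22 r1 r2 r11 r22)"
proof (rule q_expansion_eta_quotient)
  show "(\<Sum>d\<in>D22. int d * exps22 r1 r2 r11 r22 d) = 24 * int s"
    unfolding sum_D22 assms [symmetric] by (simp add: exps22_def)
qed auto

lemma modform_eta22:
  assumes "(s1, s2, s11, s22) \<in> set weights22" "s1 + s2 + s11 + s22 = int k"
    and "r1 = 2 * s1" "r2 = 2 * s2" "r11 = 2 * s11" "r22 = 2 * s22"
  shows "modform 22 k (eta22 r1 r2 r11 r22)"
  using modform_eta_quot22[OF assms(1,2)] unfolding assms(3-) exps22_double eta_powi_quot_even .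

definition even_fun :: "complex \<Rightarrow> complex" where
  "even_fun z = of_real (12096/61) * eta22 6 (-2) 6 (-2) z + of_real (45792/61) * eta22 4 0 4 0 z
     + of_real (19872/61) * eta22 2 2 2 2 z + of_real (73728/61) * eta22 0 4 0 4 z
     + of_real (- 50688/61) * eta22 (-2) 6 (-2) 6 z"

definition odd_fun :: "complex \<Rightarrow> complex" where
  "odd_fun z = of_real 22176 * eta22 (-1) 1 3 5 z + of_real 864 * eta22 (-5) 9 7 (-3) z"

lemma q_expansion_even_part: "q_expansion even_part even_fun"
  unfolding even_part_def even_fun_def [abs_def] B_conv_eta_fps
  by (intro q_expansion_add q_expansion_cmult q_expansion_eta22) simp_all

lemma q_expansion_odd_part: "q_expansion odd_part odd_fun"
  unfolding odd_part_def odd_fun_def [abs_def] B_conv_eta_fps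
  by (intro q_expansion_add q_expansion_cmult q_expansion_eta22) simp_all

lemma modform_eta22_instances:
  "modform 22 4 (eta22 6 (-2) 6 (-2))" "modform 22 4 (eta22 4 0 4 0)" "modform 22 4 (eta22 2 2 2 2)"
  "modform 22 4 (eta22 0 4 0 4)" "modform 22 4 (eta22 (-2) 6 (-2) 6)"
  "modform 22 8 (eta22 (-2) 2 6 10)" "modform 22 8 (eta22 (-6) 10 10 2)" "modform 22 8 (eta22 (-10) 18 14 (-6))"
  by (rule modform_eta22[of 3 "-1" 3 "-1"] modform_eta22[of 2 0 2 0] modform_eta22[of 1 1 1 1]
        modform_eta22[of 0 2 0 2] modform_eta22[of "-1" 3 "-1" 3] modform_eta22[of "-1" 1 3 5]
        modform_eta22[of "-3" 5 5 1] modform_eta22[of "-5" 9 7 "-3"]; simp add: weights22_def; fail)+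

lemma modform_even_fun: "modform 22 4 even_fun"
  unfolding even_fun_def [abs_def]
  by (intro modform_add modform_cmult modform_eta22_instances)

text \<open>Expanding the square produces only products of two of the quotients, whose exponents are
  sums of two odd numbers and hence even.\<close>

lemma modform_odd_fun_square: "modform 22 8 (\<lambda>z. odd_fun z * odd_fun z)"
proof -
  have "odd_fun z * odd_fun z = of_real 22176 ^ 2 * eta22 (-2) 2 6 10 z
     + 2 * of_real 22176 * of_real 864 * eta22 (-6) 10 10 2 z + of_real 864 ^ 2 * eta22 (-10) 18 14 (-6) z" for z
  proof -
    have "eta22 (-1) 1 3 5 z * eta22 (-1) 1 3 5 z = eta22 (-2) 2 6 10 z"
      "eta22 (-1) 1 3 5 z * eta22 (-5) 9 7 (-3) z = eta22 (-6) 10 10 2 z"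
      "eta22 (-5) 9 7 (-3) z * eta22 (-5) 9 7 (-3) z = eta22 (-10) 18 14 (-6) z"
      unfolding eta_powi_quot_mult exps22_add by simp_all
    moreover have "odd_fun z * odd_fun z = of_real 22176 ^ 2 * (eta22 (-1) 1 3 5 z * eta22 (-1) 1 3 5 z)
     + 2 * of_real 22176 * of_real 864 * (eta22 (-1) 1 3 5 z * eta22 (-5) 9 7 (-3) z)
     + of_real 864 ^ 2 * (eta22 (-5) 9 7 (-3) z * eta22 (-5) 9 7 (-3) z)"
      unfolding odd_fun_def by (simp only: power2_eq_square ring_distribs mult_ac) simp
    ultimately show ?thesis by (simp only:)
  qed
  moreover have "modform 22 8 (\<lambda>z. of_real 22176 ^ 2 * eta22 (-2) 2 6 10 z
     + 2 * of_real 22176 * of_real 864 * eta22 (-6) 10 10 2 z + of_real 864 ^ 2 * eta22 (-10) 18 14 (-6) z)"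
    by (intro modform_add modform_cmult modform_eta22_instances)
  ultimately show ?thesis by presburger
qed

text \<open>The half-plane covers only the punctured disc under \<open>qexp\<close>, by way of the
  logarithm; the centre is supplied by the assumption on the constant term.\<close>

lemma q_expansion_0_imp_fps_0:
  assumes "q_expansion F f" "\<And>z. Im z > 0 \<Longrightarrow> f z = 0" "fps_nth F 0 = 0"
  shows "F = 0"
proof -
  have r: "fps_conv_radius (cplx F) \<ge> 1" using assms(1) by (simp add: q_expansion_def)
  have "eval_fps (cplx F) q = eval_fps 0 q" if "q \<in> ball 0 1" for q
  proof (cases "q = 0")
    case True
    thus ?thesis by (simp add: eval_fps_at_0 assms(3))
  next
    case False
    define z where "z = Ln q / (2 * of_real pi * \<i>)"
    have qz: "qexp z = q" using False by (simp add: qexp_def z_def)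
    hence "exp (- 2 * pi * Im z) < 1" using that norm_qexp[of z] by simp
    hence "Im z > 0" by (simp add: zero_less_mult_iff)
    thus ?thesis using assms(1,2) qz by (auto simp: q_expansion_def)
  qed
  hence "eventually (\<lambda>q. eval_fps (cplx F) q = eval_fps 0 q) (nhds 0)"
    by (intro eventually_nhds_in_open[of "ball 0 1", THEN eventually_mono]) auto
  hence "cplx F = 0"
    using r by (intro eval_fps_eqD) (auto intro: order.strict_trans2[of _ 1])
  thus ?thesis by (auto simp: fps_eq_iff)
qed

text \<open>The eta quotients in \<open>odd_part\<close> have odd exponents, so only its square is known to be
  modular with trivial character; hence the difference of two squares of weight eight.\<close>
lemma eis_part_eq: "eis_part - even_part = odd_part"
proof -
  define A where "A = eis_part - even_part"
  define Q where "Q = A * A - odd_part * odd_part"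
  define f where "f = (\<lambda>z. (eis_fun z - even_fun z) * (eis_fun z - even_fun z) - odd_fun z * odd_fun z)"
  have Qf: "q_expansion Q f"
    unfolding Q_def A_def f_def
    by (intro q_expansion_diff q_expansion_mult q_expansion_eis_part q_expansion_even_part q_expansion_odd_part)
  have Q: "Q = (A - odd_part) * (A + odd_part)" by (simp add: Q_def algebra_simps)
  have low: "fps_nth (A - odd_part) n = 0" if "n < 25" for n
    unfolding A_def by (rule low_coefficients_vanish[OF that])
  \<comment> \<open>The factor \<open>A - odd_part\<close> alone gives the order of vanishing,
    whatever \<open>A + odd_part\<close> is.\<close>
  have Q_low: "fps_nth Q n = 0" if "n < 25" for n
    unfolding Q fps_mult_nth using low that by (intro sum.neutral) auto
  define R where "R = fps_shift 25 (cplx Q)"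
  have "cplx Q = fps_X ^ 25 * R"
    unfolding R_def by (rule fps_ext) (simp add: fps_X_power_mult_nth Q_low)
  moreover have R: "fps_conv_radius R \<ge> 1"
    using Qf by (simp add: R_def q_expansion_def)
  ultimately have eval: "f z = qexp z ^ 25 * eval_fps R (qexp z)" if "Im z > 0" for z
    using Qf that qexp_less_conv_radius[OF R that] by (simp add: q_expansion_def eval_fps_mult)
  have "modform 22 8 f"
    unfolding f_def using modform_mult[OF modform_diff[OF modform_eis_fun modform_even_fun] modform_diff[OF modform_eis_fun modform_even_fun]]
    by (intro modform_diff modform_odd_fun_square) simp
  hence "f z = 0" if "Im z > 0" for z
    by (rule modform22_vanishing[OF _ R eval _ that]) auto
  hence "Q = 0" using Q_low[of 0] by (intro q_expansion_0_imp_fps_0[OF Qf]) auto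
  hence "A - odd_part = 0 \<or> A + odd_part = 0" unfolding Q by simp
  thus ?thesis
  proof
    assume "A + odd_part = 0"
    hence "fps_nth (A + odd_part) 1 = 0" by simp
    moreover have "fps_nth (A - odd_part) 1 = 0" by (rule low) simp
    ultimately have "fps_nth odd_part 1 = 0" by simp
    \<comment> \<open>\<open>B6\<close> begins with q^6, so only the leading term of
      \<open>B7\<close> contributes.\<close>
    moreover have "fps_nth odd_part 1 = 864"
      unfolding odd_part_def by (simp add: B_nth B7_table_def del: One_nat_def)
    ultimately show ?thesis by simp
  qed (simp add: A_def)
qed

theorem theorem3p3:
  fixes n :: nat
  assumes "n > 0"
  shows "real (W 1 22 n) =
      17/1464 * real (sigmak 3 n) - 1/122 * real (sigmak_frac 3 n 2)
    + 35/488 * real (sigmak_frac 3 n 11) + 125/366 * real (sigmak_frac 3 n 22)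
    + (1/24 - real n / 88) * real (sigmak 1 n) + (1/24 - real n / 4) * real (sigmak_frac 1 n 22)
    - 21/2684 * fps_nth B1 n - 159/5368 * fps_nth B2 n - 69/5368 * fps_nth B3 n
    - 32/671 * fps_nth B4 n + 2/61 * fps_nth B5 n - 7/8 * fps_nth B6 n - 3/88 * fps_nth B7 n"
proof -
  have "- 25344 * (real (W 1 22 n) - W_formula n) = 0"
    unfolding eis_part_nth[OF assms, symmetric] eis_part_eq by simp
  hence "real (W 1 22 n) = W_formula n" by simp
  thus ?thesis unfolding W_formula_def .
qed

end
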